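(* Let $f:\mathbb{R}^2\times\mathbb{R}\to\mathbb{R}$ be as in the context, $F(x,t)=\int_0^tf(x,s)ds$, and assume that there are $\alpha_0,c_1,c_2>0$ such that $|\xi|\le c_1|t|+c_2e^{\alpha_0|t|^2}$ for all $\xi\in\partial_tF(x,t)$, $t\in\mathbb{R}$, $x\in\mathbb{R}^2$, and that $\underline f(x,t)$ and $\overline f(x,t)$ are $N$-measurable functions. Let $\Omega\subset\mathbb{R}^2$ be a smooth bounded domain or $\Omega=\mathbb{R}^2$, and let $\Psi:E_\Phi(\Omega)\to\mathbb{R}$, $\Psi(u)=\int_\Omega F(x,u)\,dx$. Then for each $u\in E_\Phi(\Omega)$, $$\partial\Psi(u)\subset\partial_tF(x,u)=[\underline f(x,u(x)),\overline f(x,u(x))]\quad\text{a.e. in }\Omega,$$ in the sense that for every $\xi\in\partial\Psi(u)\subset E_\Phi(\Omega)^*$ there is $\tilde\xi\in L^{\widetilde\Phi}(\Omega)$ such that $\langle\xi,v\rangle=\int_\Omega\tilde\xi v\,dx$ for all $v\in E_\Phi(\Omega)$ and $\tilde\xi(x)\in\partial_tF(x,u(x))=[\underline f(x,u(x)),\overline f(x,u(x))]$ a.e. in $\Omega$. Moreover, with $X=H_0^1(\Omega)$ or $X=H^1(\Omega)$, $$\partial\Psi|_X(u)\subset\partial\Psi(u)\quad\text{for all }u\in X.$$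
   Context: $\Phi(t)=e^{|t|^2}-1$, $\widetilde\Phi(s)=\max_{t\ge0}\{st-\Phi(t)\}$. For an $N$-function $A$, $L^A(\Omega)$ is the Orlicz space with the Luxemburg norm $\|u\|_A=\inf\{\lambda>0:\int_\Omega A(|u|/\lambda)dx\le1\}$, and $E_A(\Omega)$ is the closure in $L^A(\Omega)$ of $L^\infty(\Omega)$ if $|\Omega|<+\infty$, and of $C_0^\infty(\Omega)$ if $|\Omega|=+\infty$. The function $f$ may be discontinuous in $t$; $f(\cdot,t)$ is measurable for each $t$ and $F(x,\cdot)$ is locally Lipschitz for each $x$. There is $t_0\ge0$ such that $f(x,t)=0$ for $t<t_0$ and $f(x,t)>0$ for $t>t_0$, for all $x\in\mathbb{R}^2$. $\partial_tF(x,t)$ is the Clarke generalized gradient of $F$ in $t$, and $\partial\Psi(u)$ is the Clarke generalized gradient of the locally Lipschitz functional $\Psi$. $\underline f(x,t)=\lim_{r\downarrow0}\operatorname{ess\,inf}\{f(x,s):|s-t|<r\}$, $\overline f(x,t)=\lim_{r\downarrow0}\operatorname{ess\,sup}\{f(x,s):|s-t|<r\}$. A function $g:\mathbb{R}^2\times\mathbb{R}\to\mathbb{R}$ is $N$-measurable if $x\mapsto g(x,u(x))$ is measurable for every measurable $u$. Functionals in $\partial\Psi|_X(u)$ belong to $X^*$; $X$ is continuously embedded in $E_\Phi(\Omega)$, and elements of $E_\Phi(\Omega)^*$ are regarded as elements of $X^*$ by restriction.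
   Formalization: F(·,t) is assumed measurable on Ω for each t; and if Ω=ℝ² and t_0=0, Ψ is assumed to be finite (F(x,u) integrable for u in E_Φ) and locally Lipschitz, since otherwise Ψ or ∂Ψ may be undefined (e.g. f=1 for t>0, f=0 for t≤0). *)

theory Defs
  imports "HOL-Analysis.Analysis" "HOL-Probability.Essential_Supremum"
begin

section \<open>Smooth functions and smooth domains\<close>

text \<open>\<open>Ck_on k S g\<close> is meant for open \<open>S\<close>.\<close>

primrec Ck_on :: "nat \<Rightarrow> 'a::euclidean_space set \<Rightarrow> ('a \<Rightarrow> real) \<Rightarrow> bool" where
  "Ck_on 0 S g \<longleftrightarrow> continuous_on S g"
| "Ck_on (Suc k) S g \<longleftrightarrow> (\<forall>x\<in>S. g differentiable (at x)) \<and>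
     (\<forall>b\<in>Basis. Ck_on k S (\<lambda>x. frechet_derivative g (at x) b))"

definition smooth_on :: "'a::euclidean_space set \<Rightarrow> ('a \<Rightarrow> real) \<Rightarrow> bool" where
  "smooth_on S g \<longleftrightarrow> (\<forall>k. Ck_on k S g)"

definition test_functions :: "(real^2) set \<Rightarrow> (real^2 \<Rightarrow> real) set" where
  "test_functions \<Omega> = {\<phi>. smooth_on UNIV \<phi> \<and>
     compact (closure {x. \<phi> x \<noteq> 0}) \<and> closure {x. \<phi> x \<noteq> 0} \<subseteq> \<Omega>}"

text \<open>Near each boundary point the domain is the strict sublevel set of a smooth function whose
  differential does not vanish at that point.\<close>

definition smooth_bounded_domain :: "(real^2) set \<Rightarrow> bool" where
  "smooth_bounded_domain \<Omega> \<longleftrightarrow>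
     open \<Omega> \<and> connected \<Omega> \<and> \<Omega> \<noteq> {} \<and> bounded \<Omega> \<and>
     (\<forall>p\<in>frontier \<Omega>. \<exists>U \<rho>. open U \<and> p \<in> U \<and> smooth_on U \<rho> \<and>
        (\<exists>v. frechet_derivative \<rho> (at p) v \<noteq> 0) \<and>
        \<Omega> \<inter> U = {x\<in>U. \<rho> x < 0})"

section \<open>Orlicz spaces\<close>

text \<open>Elements of all function spaces below are representatives \<open>real^2 \<Rightarrow> real\<close>, considered on
  \<open>\<Omega>\<close> only and up to Lebesgue null sets; the norms are therefore seminorms on representatives.\<close>

definition Phi :: "real \<Rightarrow> real" where
  "Phi t = exp (\<bar>t\<bar>\<^sup>2) - 1"

definition conjugate_N :: "(real \<Rightarrow> real) \<Rightarrow> real \<Rightarrow> real" where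
  "conjugate_N A s = (SUP t\<in>{0..}. s * t - A t)"

definition modular_le_1 :: "(real \<Rightarrow> real) \<Rightarrow> (real^2) set \<Rightarrow> (real^2 \<Rightarrow> real) \<Rightarrow> real set" where
  "modular_le_1 A \<Omega> u =
     {k. k > 0 \<and> (\<integral>\<^sup>+x. ennreal (A (\<bar>u x\<bar> / k)) \<partial>lebesgue_on \<Omega>) \<le> 1}"

definition luxemburg_norm :: "(real \<Rightarrow> real) \<Rightarrow> (real^2) set \<Rightarrow> (real^2 \<Rightarrow> real) \<Rightarrow> real" where
  "luxemburg_norm A \<Omega> u = Inf (modular_le_1 A \<Omega> u)"

definition orlicz_space :: "(real \<Rightarrow> real) \<Rightarrow> (real^2) set \<Rightarrow> (real^2 \<Rightarrow> real) set" where
  "orlicz_space A \<Omega> = {u \<in> borel_measurable (lebesgue_on \<Omega>). modular_le_1 A \<Omega> u \<noteq> {}}"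

definition L_infinity :: "(real^2) set \<Rightarrow> (real^2 \<Rightarrow> real) set" where
  "L_infinity \<Omega> = {u \<in> borel_measurable (lebesgue_on \<Omega>). \<exists>C. AE x in lebesgue_on \<Omega>. \<bar>u x\<bar> \<le> C}"

definition E_space :: "(real \<Rightarrow> real) \<Rightarrow> (real^2) set \<Rightarrow> (real^2 \<Rightarrow> real) set" where
  "E_space A \<Omega> = {u \<in> orlicz_space A \<Omega>. \<forall>\<epsilon>>0.
     \<exists>w \<in> (if emeasure lebesgue \<Omega> < \<infinity> then L_infinity \<Omega> else test_functions \<Omega>).
       luxemburg_norm A \<Omega> (\<lambda>x. u x - w x) < \<epsilon>}"

section \<open>Sobolev spaces\<close>

definition L2_space :: "(real^2) set \<Rightarrow> (real^2 \<Rightarrow> 'b::euclidean_space) set" where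
  "L2_space \<Omega> = {u \<in> borel_measurable (lebesgue_on \<Omega>).
     integrable (lebesgue_on \<Omega>) (\<lambda>x. (norm (u x))\<^sup>2)}"

definition is_weak_gradient :: "(real^2) set \<Rightarrow> (real^2 \<Rightarrow> real) \<Rightarrow> (real^2 \<Rightarrow> real^2) \<Rightarrow> bool" where
  "is_weak_gradient \<Omega> u g \<longleftrightarrow> (\<forall>\<phi>\<in>test_functions \<Omega>. \<forall>i.
     (LINT x|lebesgue_on \<Omega>. u x * frechet_derivative \<phi> (at x) (axis i 1)) =
     - (LINT x|lebesgue_on \<Omega>. g x $ i * \<phi> x))"

definition H1 :: "(real^2) set \<Rightarrow> (real^2 \<Rightarrow> real) set" where
  "H1 \<Omega> = {u \<in> L2_space \<Omega>. \<exists>g \<in> L2_space \<Omega>. is_weak_gradient \<Omega> u g}"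

text \<open>The weak gradient is unique up to null sets.\<close>

definition weak_gradient :: "(real^2) set \<Rightarrow> (real^2 \<Rightarrow> real) \<Rightarrow> (real^2 \<Rightarrow> real^2)" where
  "weak_gradient \<Omega> u = (SOME g. g \<in> L2_space \<Omega> \<and> is_weak_gradient \<Omega> u g)"

definition H1_norm :: "(real^2) set \<Rightarrow> (real^2 \<Rightarrow> real) \<Rightarrow> real" where
  "H1_norm \<Omega> u = sqrt ((LINT x|lebesgue_on \<Omega>. (u x)\<^sup>2) +
     (LINT x|lebesgue_on \<Omega>. (norm (weak_gradient \<Omega> u x))\<^sup>2))"

definition H10 :: "(real^2) set \<Rightarrow> (real^2 \<Rightarrow> real) set" where
  "H10 \<Omega> = {u \<in> H1 \<Omega>. \<forall>\<epsilon>>0. \<exists>\<phi>\<in>test_functions \<Omega>. H1_norm \<Omega> (\<lambda>x. u x - \<phi> x) < \<epsilon>}"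

section \<open>Clarke generalized gradients\<close>

text \<open>For a function of one real variable; functionals on the line are identified with numbers.\<close>

definition clarke_derivative_real :: "(real \<Rightarrow> real) \<Rightarrow> real \<Rightarrow> real \<Rightarrow> ereal" where
  "clarke_derivative_real G t w =
     Limsup (nhds t \<times>\<^sub>F at_right 0) (\<lambda>(s, h). ereal ((G (s + h * w) - G s) / h))"

definition clarke_gradient_real :: "(real \<Rightarrow> real) \<Rightarrow> real \<Rightarrow> real set" where
  "clarke_gradient_real G t = {\<xi>. \<forall>w. ereal (\<xi> * w) \<le> clarke_derivative_real G t w}"

text \<open>For a functional \<open>J\<close> on a space \<open>V\<close> of functions with (semi)norm \<open>N\<close>. Only the values of
  \<open>J\<close>, \<open>N\<close> and of functionals on \<open>V\<close> matter; thus \<open>J\<close> considered on a smaller space with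
  its own norm is the restriction of \<open>J\<close>.\<close>

definition nhds_in :: "('a \<Rightarrow> real) set \<Rightarrow> (('a \<Rightarrow> real) \<Rightarrow> real) \<Rightarrow> ('a \<Rightarrow> real) \<Rightarrow> ('a \<Rightarrow> real) filter" where
  "nhds_in V N u = (INF \<epsilon>\<in>{0<..}. principal {y\<in>V. N (\<lambda>x. y x - u x) < \<epsilon>})"

definition dual_space :: "('a \<Rightarrow> real) set \<Rightarrow> (('a \<Rightarrow> real) \<Rightarrow> real) \<Rightarrow> (('a \<Rightarrow> real) \<Rightarrow> real) set" where
  "dual_space V N = {\<xi>.
     (\<forall>u\<in>V. \<forall>v\<in>V. \<forall>a b. \<xi> (\<lambda>x. a * u x + b * v x) = a * \<xi> u + b * \<xi> v) \<and>
     (\<exists>C. \<forall>v\<in>V. \<bar>\<xi> v\<bar> \<le> C * N v)}"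

definition clarke_derivative ::
    "('a \<Rightarrow> real) set \<Rightarrow> (('a \<Rightarrow> real) \<Rightarrow> real) \<Rightarrow> (('a \<Rightarrow> real) \<Rightarrow> real) \<Rightarrow>
     ('a \<Rightarrow> real) \<Rightarrow> ('a \<Rightarrow> real) \<Rightarrow> ereal" where
  "clarke_derivative V N J u v =
     Limsup (nhds_in V N u \<times>\<^sub>F at_right 0)
       (\<lambda>(y, h). ereal ((J (\<lambda>x. y x + h * v x) - J y) / h))"

definition clarke_gradient ::
    "('a \<Rightarrow> real) set \<Rightarrow> (('a \<Rightarrow> real) \<Rightarrow> real) \<Rightarrow> (('a \<Rightarrow> real) \<Rightarrow> real) \<Rightarrow>
     ('a \<Rightarrow> real) \<Rightarrow> (('a \<Rightarrow> real) \<Rightarrow> real) set" where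
  "clarke_gradient V N J u =
     {\<xi> \<in> dual_space V N. \<forall>v\<in>V. ereal (\<xi> v) \<le> clarke_derivative V N J u v}"

definition locally_lipschitz_functional ::
    "('a \<Rightarrow> real) set \<Rightarrow> (('a \<Rightarrow> real) \<Rightarrow> real) \<Rightarrow> (('a \<Rightarrow> real) \<Rightarrow> real) \<Rightarrow> bool" where
  "locally_lipschitz_functional V N J \<longleftrightarrow> (\<forall>u\<in>V. \<exists>r>0. \<exists>L. \<forall>y\<in>V. \<forall>z\<in>V.
     N (\<lambda>x. y x - u x) < r \<longrightarrow> N (\<lambda>x. z x - u x) < r \<longrightarrow>
     \<bar>J y - J z\<bar> \<le> L * N (\<lambda>x. y x - z x))"

definition continuously_embedded ::
    "('a \<Rightarrow> real) set \<Rightarrow> (('a \<Rightarrow> real) \<Rightarrow> real) \<Rightarrow>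
     ('a \<Rightarrow> real) set \<Rightarrow> (('a \<Rightarrow> real) \<Rightarrow> real) \<Rightarrow> bool" where
  "continuously_embedded X NX V NV \<longleftrightarrow> X \<subseteq> V \<and> (\<exists>C. \<forall>v\<in>X. NV v \<le> C * NX v)"

section \<open>The nonlinearity and the functional\<close>

definition primitive :: "(real^2 \<Rightarrow> real \<Rightarrow> real) \<Rightarrow> real^2 \<Rightarrow> real \<Rightarrow> real" where
  "primitive f x t = interval_lebesgue_integral lebesgue 0 (ereal t) (f x)"

text \<open>The essential infimum is minus the essential supremum of the negative. The limits are taken
  in \<open>ereal\<close>, where they exist by monotonicity; they are finite if \<open>f x\<close> is locally essentially
  bounded.\<close>

definition f_upper :: "(real^2 \<Rightarrow> real \<Rightarrow> real) \<Rightarrow> real^2 \<Rightarrow> real \<Rightarrow> real" where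
  "f_upper f x t = real_of_ereal
     (Lim (at_right 0) (\<lambda>r. esssup (lebesgue_on {s. \<bar>s - t\<bar> < r}) (\<lambda>s. ereal (f x s))))"

definition f_lower :: "(real^2 \<Rightarrow> real \<Rightarrow> real) \<Rightarrow> real^2 \<Rightarrow> real \<Rightarrow> real" where
  "f_lower f x t = real_of_ereal
     (Lim (at_right 0) (\<lambda>r. - esssup (lebesgue_on {s. \<bar>s - t\<bar> < r}) (\<lambda>s. - ereal (f x s))))"

definition N_measurable :: "(real^2 \<Rightarrow> real \<Rightarrow> real) \<Rightarrow> bool" where
  "N_measurable g \<longleftrightarrow>
     (\<forall>u \<in> borel_measurable lebesgue. (\<lambda>x. g x (u x)) \<in> borel_measurable lebesgue)"

definition Psi :: "(real^2 \<Rightarrow> real \<Rightarrow> real) \<Rightarrow> (real^2) set \<Rightarrow> (real^2 \<Rightarrow> real) \<Rightarrow> real" where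
  "Psi f \<Omega> u = (LINT x|lebesgue_on \<Omega>. primitive f x (u x))"

end

theory Submission
  imports Defs
begin

text \<open>
  For fixed \<open>x\<close> the directional derivatives of \<open>F(x, \<cdot>)\<close> in the directions \<open>1\<close> and \<open>-1\<close> are limits of
  essential suprema of \<open>f(x, \<cdot>)\<close> and \<open>-f(x, \<cdot>)\<close>, which identifies the pointwise gradient with an
  interval. If \<open>\<xi> \<in> \<partial>\<Psi>(u)\<close> is tested only with \<open>\<plusminus>1\<^sub>A\<close>, \<open>A\<close> bounded, dominated convergence along a
  rapidly converging sequence realising the upper limit gives
  \<open>0 \<le> \<integral>\<^sub>A f_lower(x, u) \<le> \<xi>(1\<^sub>A) \<le> \<integral>\<^sub>A f_upper(x, u)\<close>. Hence \<open>A \<mapsto> \<xi>(1\<^sub>A)\<close> is a positive measure, and its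
  Radon-Nikodym density represents \<open>\<xi>\<close>, first on bounded functions with bounded support and then by
  density on the whole space; equality in Young's inequality puts the density into the conjugate
  Orlicz space.

  For the restriction to \<open>X\<close>, a subgradient of \<open>\<Psi>|\<^sub>X\<close> is Lipschitz for the coarser norm of
  \<open>E\<^sub>\<Phi>\<close> because \<open>\<Psi>\<close> is; \<open>X\<close> contains the test functions and is therefore dense, so the
  subgradient extends uniquely, and the extension is again dominated by the directional derivative.
\<close>

section \<open>The Clarke gradient of a primitive\<close>

text \<open>Indicators are enough as directions because the pointwise gradient is an interval fixed
  by two directional derivatives. The closure that defines the space is what controls
  \<open>exp (\<gamma> * u^2)\<close> for every \<gamma>: \<open>u\<close> is split into a bounded
  part and a remainder that is small at a scale chosen from \<gamma>. On the plane constants are not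
  integrable, and the growth bound does not vanish at \<open>t = 0\<close>. For
  \<open>t0 > 0\<close> this is repaired by \<open>F = 0\<close> below \<open>t0\<close> and by the
  finite measure of the set where \<open>u\<close> exceeds \<open>t0\<close>. For
  \<open>t0 = 0\<close> integrability can fail, as \<open>F(x,t) = c2 max(t,0)\<close> shows, so
  there the regularity of the functional is a hypothesis. Norm convergence gives neither convergence
  almost everywhere nor a common majorant; distances below a geometric sequence give both, since the
  modulars then have a finite sum. The sign of \<open>f\<close> makes subgradients positive set
  functions, so that the density is found by splitting the plane into bounded pieces and stays
  nonnegative.\<close>

text \<open>The measure with density \<phi> is at most \<open>M\<close> times Lebesgue measure on
  intervals. Covering by nonoverlapping closed intervals of nearly the same total length carries
  this to every measurable subset, in particular to the set where \<phi> exceeds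
  \<open>M\<close>.\<close>

lemma AE_le_of_interval_averages:
  fixes \<phi> :: "real \<Rightarrow> real"
  assumes int: "set_integrable lebesgue {p<..<q} \<phi>"
    and nn: "AE s in lebesgue. s \<in> {p<..<q} \<longrightarrow> 0 \<le> \<phi> s"
    and avg: "\<And>a b. p \<le> a \<Longrightarrow> a < b \<Longrightarrow> b \<le> q \<Longrightarrow>
                (LINT s:{a<..<b}|lebesgue. \<phi> s) \<le> M * (b - a)"
    and M: "0 \<le> M"
  shows "AE s in lebesgue. s \<in> {p<..<q} \<longrightarrow> \<phi> s \<le> M"
proof -
  define g where "g = (\<lambda>s. indicator {p<..<q} s * \<phi> s)"
  have g: "integrable lebesgue g"
    using int by (simp add: g_def set_integrable_def)
  have g_meas [measurable]: "g \<in> borel_measurable lebesgue"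
    using g by auto
  have g_nn: "AE s in lebesgue. 0 \<le> g s"
    using nn by eventually_elim (auto simp: g_def indicator_def)
  define N where "N = density lebesgue (\<lambda>s. ennreal (g s))"
  have sets_N [measurable_cong]: "sets N = sets lebesgue"
    by (simp add: N_def)
  have N_eq: "emeasure N A = ennreal (LINT s:A|lebesgue. g s)" if "A \<in> sets lebesgue" for A
  proof -
    have "emeasure N A = (\<integral>\<^sup>+s. ennreal (indicator A s * g s) \<partial>lebesgue)"
      using that by (auto simp: N_def emeasure_density indicator_def intro!: nn_integral_cong)
    also have "\<dots> = ennreal (LINT s|lebesgue. indicator A s * g s)"
      using integrable_mult_indicator[OF that g] g_nn
      by (intro nn_integral_eq_integral) (auto elim!: eventually_mono simp: indicator_def)
    finally show ?thesis
      by (simp add: set_lebesgue_integral_def)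
  qed
  have N_box: "emeasure N {a<..<b} \<le> ennreal M * emeasure lebesgue {a<..<b}"
    if "p \<le> a" "b \<le> q" for a b
  proof (cases "a < b")
    case True
    have "(LINT s:{a<..<b}|lebesgue. g s) = (LINT s:{a<..<b}|lebesgue. \<phi> s)"
      using that by (intro set_lebesgue_integral_cong) (auto simp: g_def)
    with avg[of a b] True that M show ?thesis
      by (simp add: N_eq ennreal_mult[symmetric] ennreal_leI)
  qed auto
  have N_le: "emeasure N B \<le> ennreal M * emeasure lebesgue B"
    if B: "B \<in> sets lebesgue" "B \<subseteq> {p<..<q}" for B
  proof -
    have Bl: "B \<in> lmeasurable"
      by (rule bounded_set_imp_lmeasurable[OF bounded_subset[of "{p<..<q}"] B(1)]) (use B(2) in auto)
    have le: "emeasure N B \<le> ennreal (M * (measure lebesgue B + e))" if "e > 0" for e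
    proof -
      have "B \<subseteq> cbox p q" using B by auto
      then obtain \<D> where D: "countable \<D>"
        "\<And>K. K \<in> \<D> \<Longrightarrow> K \<subseteq> cbox p q \<and> K \<noteq> {} \<and> (\<exists>c d. K = cbox c d)"
        "pairwise (\<lambda>A B. interior A \<inter> interior B = {}) \<D>"
        "B \<subseteq> \<Union>\<D>" "\<Union>\<D> \<in> lmeasurable" "measure lebesgue (\<Union>\<D>) \<le> measure lebesgue B + e"
        using measurable_outer_intervals_bounded[OF Bl _ \<open>e > 0\<close>] by metis
      have disj: "disjoint_family_on interior \<D>"
        using D(3) by (auto simp: disjoint_family_on_def pairwise_def)
      \<comment> \<open>The covering intervals are closed and may share endpoints, while additivity
        and the bound \<open>N_box\<close> concern open ones; the endpoints are null for
        \<open>lebesgue\<close> and hence for \<open>N\<close>.\<close>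
      have "negligible (\<Union>K\<in>\<D>. K - interior K)"
      proof (rule negligible_countable_Union)
        show "negligible T" if "T \<in> (\<lambda>K. K - interior K) ` \<D>" for T
        proof -
          from that obtain K c d where "T = K - interior K" "K = cbox c d"
            using D(2) by blast
          then show ?thesis
            using negligible_frontier_interval[of c d] by simp
        qed
      qed (use D(1) in auto)
      then have null: "(\<Union>K\<in>\<D>. K - interior K) \<in> null_sets lebesgue"
        by (simp add: negligible_iff_null_sets)
      then have null': "(\<Union>K\<in>\<D>. K - interior K) \<in> null_sets N"
        using absolutely_continuousI_density[of "\<lambda>s. ennreal (g s)" lebesgue]
        by (auto simp: absolutely_continuous_def N_def)
      have op: "open (\<Union>K\<in>\<D>. interior K)" by auto
      have "emeasure N B \<le> emeasure N ((\<Union>K\<in>\<D>. interior K) \<union> (\<Union>K\<in>\<D>. K - interior K))"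
        using D(4) null op by (intro emeasure_mono) (auto simp: sets_N dest: null_setsD2)
      also have "\<dots> = emeasure N (\<Union>K\<in>\<D>. interior K)"
        using null' op by (intro emeasure_Un_null_set) (auto simp: sets_N)
      also have "\<dots> = (\<integral>\<^sup>+K. emeasure N (interior K) \<partial>count_space \<D>)"
        using D(1) disj by (intro emeasure_UN_countable) (auto simp: sets_N)
      also have "\<dots> \<le> (\<integral>\<^sup>+K. ennreal M * emeasure lebesgue (interior K) \<partial>count_space \<D>)"
      proof (intro nn_integral_mono)
        fix K assume "K \<in> space (count_space \<D>)"
        then have "K \<in> \<D>" by simp
        then obtain c d where K: "K = {c..d}" "K \<noteq> {}" "K \<subseteq> {p..q}" 
          using D(2) by (metis cbox_interval)
        then show "emeasure N (interior K) \<le> ennreal M * emeasure lebesgue (interior K)"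
          using N_box[of c d] by auto
      qed
      also have "\<dots> = ennreal M * emeasure lebesgue (\<Union>K\<in>\<D>. interior K)"
        using D(1) disj by (subst emeasure_UN_countable) (auto simp: nn_integral_cmult)
      also have "\<dots> \<le> ennreal M * emeasure lebesgue (\<Union>\<D>)"
        using D(5) interior_subset by (intro mult_left_mono emeasure_mono) (auto simp: fmeasurable_def)
      also have "\<dots> = ennreal (M * measure lebesgue (\<Union>\<D>))"
        using D(5) M by (simp add: emeasure_eq_measure2 ennreal_mult)
      also have "\<dots> \<le> ennreal (M * (measure lebesgue B + e))"
        using D(6) M by (intro ennreal_leI mult_left_mono) auto
      finally show ?thesis .
    qed
    have "(LINT s:B|lebesgue. g s) \<le> M * measure lebesgue B"
    proof (rule field_le_epsilon)
      fix e :: real assume e: "e > 0"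
      \<comment> \<open>Dividing by \<open>M + 1\<close> rather than \<open>M\<close> covers the
        case \<open>M = 0\<close>.\<close>
      have "ennreal (LINT s:B|lebesgue. g s) \<le> ennreal (M * (measure lebesgue B + e / (M + 1)))"
        using le[of "e / (M+1)"] e M by (simp add: N_eq B(1))
      then have "(LINT s:B|lebesgue. g s) \<le> M * (measure lebesgue B + e / (M + 1))"
        using e M by (subst (asm) ennreal_le_iff) auto
      also have "\<dots> \<le> M * measure lebesgue B + e"
        using e M by (simp add: field_simps)
      finally show "(LINT s:B|lebesgue. g s) \<le> M * measure lebesgue B + e" .
    qed
    then show ?thesis
      using Bl M by (simp add: N_eq B(1) emeasure_eq_measure2 ennreal_mult[symmetric] ennreal_leI)
  qed
  define B where "B = {s \<in> space lebesgue. M < g s} \<inter> {p<..<q}"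
  have B: "B \<in> sets lebesgue" "B \<subseteq> {p<..<q}"
    unfolding B_def by (measurable, auto)
  have Bl: "B \<in> lmeasurable"
    by (rule bounded_set_imp_lmeasurable[OF bounded_subset[of "{p<..<q}"] B(1)]) (use B(2) in auto)
  have "ennreal (LINT s:B|lebesgue. g s) \<le> ennreal (M * measure lebesgue B)"
    using N_le[OF B] Bl M by (simp add: N_eq B emeasure_eq_measure2 ennreal_mult)
  then have le: "(LINT s:B|lebesgue. g s) \<le> M * measure lebesgue B"
    using M by (subst (asm) ennreal_le_iff) auto
  \<comment> \<open>On \<open>B\<close> this function is strictly positive, yet its integral is at
    most zero, so \<open>B\<close> is null.\<close>
  define h where "h = (\<lambda>s. indicator B s * (g s - M))"
  have i1: "integrable lebesgue (\<lambda>s. indicator B s * g s)"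
    using integrable_mult_indicator[OF B(1) g] by simp
  have i2: "integrable lebesgue (\<lambda>s. indicator B s * M)"
    using Bl by (intro integrable_mult_left integrable_real_indicator) (auto simp: fmeasurable_def)
  have h_int: "integrable lebesgue h"
    using Bochner_Integration.integrable_diff[OF i1 i2] by (simp add: h_def right_diff_distrib)
  have "(LINT s|lebesgue. h s) = (LINT s:B|lebesgue. g s) - M * measure lebesgue B"
    using i1 i2 Bl
    by (simp add: h_def right_diff_distrib set_lebesgue_integral_def)
  with le have "(LINT s|lebesgue. h s) \<le> 0" by simp
  moreover have hnn: "0 \<le> h s" for s by (auto simp: h_def B_def indicator_def)
  ultimately have "(LINT s|lebesgue. h s) = 0"
    by (intro antisym integral_nonneg_AE) auto
  then have "AE s in lebesgue. h s = 0"
    using integral_nonneg_eq_0_iff_AE[OF h_int] hnn by auto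
  then show ?thesis
  proof eventually_elim
    case (elim s)
    then show ?case
      by (auto simp: h_def B_def indicator_def g_def split: if_splits)
  qed
qed

lemma lmeasurable_Ioo: "{a<..<b :: real} \<in> lmeasurable"
  by (rule bounded_set_imp_lmeasurable) auto

lemma set_integrable_const_Ioo: "set_integrable lebesgue {a<..<b :: real} (\<lambda>s. c :: real)"
  using integrable_mult_left[OF lmeasurable_Ioo[of a b, unfolded lmeasurable_iff_integrable], of c]
  by (simp add: set_integrable_def mult.commute)

text \<open>Only increments of \<open>G\<close> are prescribed: the additive constant is free, and
  the pair may be negated.\<close>

locale interval_primitive =
  fixes \<phi> G :: "real \<Rightarrow> real"
  assumes integrable: "set_integrable lebesgue {a<..<b} \<phi>"
    and increment: "a \<le> b \<Longrightarrow> G b - G a = (LINT s:{a<..<b}|lebesgue. \<phi> s)"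
begin

lemma measurable: "\<phi> \<in> borel_measurable lebesgue"
proof (rule borel_measurable_LIMSEQ_real)
  show "(\<lambda>s. indicator {- real n<..<real n} s * \<phi> s) \<in> borel_measurable lebesgue" for n
    using integrable[of "- real n" "real n"] by (auto simp: set_integrable_def)
  fix s :: real
  obtain n0 where n0: "\<bar>s\<bar> < real n0"
    using reals_Archimedean2 by blast
  have "eventually (\<lambda>n. indicator {- real n<..<real n} s * \<phi> s = \<phi> s) sequentially"
    using eventually_ge_at_top[of n0]
  proof eventually_elim
    case (elim n)
    then have "real n0 \<le> real n" by simp
    with n0 show ?case by (auto simp: indicator_def)
  qed
  then show "(\<lambda>n. indicator {- real n<..<real n} s * \<phi> s) \<longlonglongrightarrow> \<phi> s"
    by (rule tendsto_eventually)
qed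

text \<open>Increments of \<open>G\<close> are integrals over intervals. Adding \<open>c\<close>
  turns \<phi> into a nonnegative density, as the passage from interval averages to pointwise bounds
  requires.\<close>

lemma AE_le_iff_increment_le:
  assumes lower: "AE s in lebesgue. s \<in> {p<..<q} \<longrightarrow> - c \<le> \<phi> s"
  shows "(AE s in lebesgue. s \<in> {p<..<q} \<longrightarrow> \<phi> s \<le> M) \<longleftrightarrow>
         (\<forall>a b. p \<le> a \<longrightarrow> a < b \<longrightarrow> b \<le> q \<longrightarrow> G b - G a \<le> M * (b - a))" (is "?L \<longleftrightarrow> ?R")
proof
  assume L: ?L
  show ?R
  proof (intro allI impI)
    fix a b assume ab: "p \<le> a" "a < b" "b \<le> q"
    have "G b - G a = (LINT s:{a<..<b}|lebesgue. \<phi> s)"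
      using increment ab by simp
    also have "\<dots> \<le> (LINT s:{a<..<b}|lebesgue. M)"
    proof (rule set_integral_mono_AE)
      show "set_integrable lebesgue {a<..<b} (\<lambda>s. M)"
        by (rule set_integrable_const_Ioo)
      show "AE s\<in>{a<..<b} in lebesgue. \<phi> s \<le> M"
        using L by eventually_elim (use ab in auto)
    qed (rule integrable)
    also have "\<dots> = M * (b - a)"
      using ab by (simp add: set_lebesgue_integral_def)
    finally show "G b - G a \<le> M * (b - a)" .
  qed
next
  assume R: ?R
  show ?L
  proof (cases "p < q")
    case pq: True
    have const: "set_integrable lebesgue {a<..<b} (\<lambda>s. c)" for a b :: real
      by (rule set_integrable_const_Ioo)
    have add: "(LINT s:{a<..<b}|lebesgue. \<phi> s + c) = G b - G a + c * (b - a)" if "a < b" for a b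
      using that increment[of a b]
      by (subst set_integral_add(2)[OF integrable const]) (simp add: set_lebesgue_integral_def)
    have avg: "(LINT s:{a<..<b}|lebesgue. \<phi> s + c) \<le> (M + c) * (b - a)"
      if "p \<le> a" "a < b" "b \<le> q" for a b
      using R that by (simp add: add distrib_right)
    have nn: "AE s in lebesgue. s \<in> {p<..<q} \<longrightarrow> 0 \<le> \<phi> s + c"
      using lower by eventually_elim auto
    \<comment> \<open>The averaging lemma asks for a nonnegative constant; the mean over the whole
      interval is nonnegative and at most \<open>M + c\<close>, which supplies the sign.\<close>
    have "0 \<le> (LINT s:{p<..<q}|lebesgue. \<phi> s + c)"
      unfolding set_lebesgue_integral_def
      by (rule integral_nonneg_AE) (use nn in \<open>auto elim!: eventually_mono simp: indicator_def\<close>)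
    with avg[of p q] pq have "0 \<le> (M + c) * (q - p)" by simp
    then have "0 \<le> M + c"
      using pq by (simp add: zero_le_mult_iff)
    from AE_le_of_interval_averages[OF set_integral_add(1)[OF integrable const] nn avg this]
    show ?thesis by simp
  qed auto
qed

end


section \<open>Directional derivatives in one variable as optimal local slopes\<close>

text \<open>A quotient in direction 1 at the left end of an interval and one in direction -1 at its
  right end involve the same increment up to sign. Varying base point and step thus amounts to
  varying an interval near \<open>t\<close>, and the upper limit becomes the best local slope
  bound.\<close>

lemma clarke_derivative_real_unit:
  fixes G :: "real \<Rightarrow> real" and \<sigma> :: real
  assumes \<sigma>: "\<sigma> = 1 \<or> \<sigma> = -1"
  shows "clarke_derivative_real G t \<sigma> =
    Inf (ereal ` {M. \<exists>r>0. \<forall>a b. t - r \<le> a \<longrightarrow> a < b \<longrightarrow> b \<le> t + r \<longrightarrow> \<sigma> * (G b - G a) \<le> M * (b - a)})"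
    (is "_ = Inf (ereal ` ?S)")
proof (rule antisym)
  let ?q = "\<lambda>(s, h). ereal ((G (s + h * \<sigma>) - G s) / h)"
  show "clarke_derivative_real G t \<sigma> \<le> Inf (ereal ` ?S)"
  proof (rule Inf_greatest, safe)
    fix M r assume r: "r > 0"
      "\<forall>a b. t - r \<le> a \<longrightarrow> a < b \<longrightarrow> b \<le> t + r \<longrightarrow> \<sigma> * (G b - G a) \<le> M * (b - a)"
    show "clarke_derivative_real G t \<sigma> \<le> ereal M"
      unfolding clarke_derivative_real_def
    proof (rule Limsup_bounded)
      \<comment> \<open>With the base point within \<open>r/2\<close> of \<open>t\<close> and the
        step below \<open>r/2\<close>, both \<open>s\<close> and \<open>s + h * \<sigma>\<close>
        stay within \<open>r\<close> of \<open>t\<close>.\<close>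
      have "eventually (\<lambda>s. dist s t < r/2) (nhds t)" 
        using r(1) eventually_nhds_metric half_gt_zero by blast
      moreover have "eventually (\<lambda>h. 0 < h \<and> h < r/2) (at_right (0::real))"
        using r(1) by (auto simp: eventually_at_right_field intro!: exI[of _ "r/2"])
      ultimately show "\<forall>\<^sub>F x in nhds t \<times>\<^sub>F at_right 0. ?q x \<le> ereal M"
        unfolding eventually_prod_filter
      proof (intro exI conjI allI impI)
        fix s h assume s: "dist s t < r/2" and h: "0 < h \<and> h < r/2"
        have s': "t - r/2 < s" "s < t + r/2" using s unfolding dist_real_def by linarith+
        from \<sigma> have "G (s + h * \<sigma>) - G s \<le> M * h"
        proof
          assume "\<sigma> = 1" then show ?thesis
            using r(2)[rule_format, of s "s + h"] s' h by simp
        next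
          assume "\<sigma> = -1" then show ?thesis
            using r(2)[rule_format, of "s - h" s] s' h by simp
        qed
        then show "?q (s, h) \<le> ereal M" using h by (simp add: divide_le_eq)
      qed
    qed
  qed
  show "Inf (ereal ` ?S) \<le> clarke_derivative_real G t \<sigma>"
  proof (rule dense_ge)
    fix y assume y: "clarke_derivative_real G t \<sigma> < y"
    then have ev: "\<forall>\<^sub>F x in nhds t \<times>\<^sub>F at_right 0. ?q x < y"
      unfolding clarke_derivative_real_def using Limsup_le_iff by blast
    show "Inf (ereal ` ?S) \<le> y"
    proof (cases y)
      case (real M)
      from ev obtain P Q where P: "eventually P (nhds t)" and Q: "eventually Q (at_right (0::real))"
        and PQ: "\<And>s h. P s \<Longrightarrow> Q h \<Longrightarrow> ?q (s, h) < y"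
        unfolding eventually_prod_filter by blast
      from P obtain d1 where d1: "d1 > 0" "\<And>s. dist s t < d1 \<Longrightarrow> P s"
        unfolding eventually_nhds_metric by blast
      from Q obtain d2 where d2: "d2 > 0" "\<And>h. 0 < h \<Longrightarrow> h < d2 \<Longrightarrow> Q h"
        unfolding eventually_at_right_field by auto
      \<comment> \<open>An interval inside the ball of radius \<open>r\<close> has length at most
        \<open>2 * r\<close>, which the divisor 3 keeps strictly below \<open>d2\<close>.\<close>
      define r where "r = min d1 d2 / 3"
      have "r > 0" using d1 d2 by (auto simp: r_def)
      moreover have "\<sigma> * (G b - G a) \<le> M * (b - a)"
        if ab: "t - r \<le> a" "a < b" "b \<le> t + r" for a b
      proof -
        have "P a" "P b" "Q (b - a)"
          using ab \<open>r > 0\<close> d1(1) d2(1)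
          by (auto intro!: d1(2) d2(2) simp: dist_real_def r_def min_def split: if_splits)
        then have "(G (a + (b - a) * \<sigma>) - G a) / (b - a) < M" "(G (b + (b - a) * \<sigma>) - G b) / (b - a) < M"
          using PQ[of a "b - a"] PQ[of b "b - a"] real by auto
        then show ?thesis using \<sigma> ab by (auto simp: divide_less_eq)
      qed
      ultimately have "M \<in> ?S" by blast
      then show ?thesis unfolding real by (intro Inf_lower) blast
    qed (use y in auto)
  qed
qed

lemma clarke_derivative_real_zero: "clarke_derivative_real G t 0 = 0"
proof -
  have "nhds t \<times>\<^sub>F at_right (0::real) \<noteq> bot"
    by (simp add: prod_filter_eq_bot)
  then show ?thesis
    using Limsup_const[of "nhds t \<times>\<^sub>F at_right (0::real)" "ereal 0"]
    by (simp add: clarke_derivative_real_def case_prod_beta' zero_ereal_def)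
qed


text \<open>Substituting \<open>h / c\<close> for the step relates the two directions. This half of
  positive homogeneity suffices to pass from the directions 1 and -1 to all others.\<close>

lemma clarke_derivative_real_scale_le:
  assumes c: "c > 0"
  shows "ereal c * clarke_derivative_real G t w \<le> clarke_derivative_real G t (c * w)"
proof (rule dense_ge)
  fix y assume y: "clarke_derivative_real G t (c * w) < y"
  then have ev: "\<forall>\<^sub>F (s, h) in nhds t \<times>\<^sub>F at_right 0. ereal ((G (s + h * (c * w)) - G s) / h) < y"
    unfolding clarke_derivative_real_def by (auto dest!: Limsup_lessD simp: case_prod_beta')
  show "ereal c * clarke_derivative_real G t w \<le> y"
  proof (cases y)
    case (real M)
    from ev obtain P Q where P: "eventually P (nhds t)" and Q: "eventually Q (at_right (0::real))"
      and PQ: "\<And>s h. P s \<Longrightarrow> Q h \<Longrightarrow> ereal ((G (s + h * (c * w)) - G s) / h) < y"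
      unfolding eventually_prod_filter case_prod_conv by blast
    from Q obtain d where d: "d > 0" "\<And>h. 0 < h \<Longrightarrow> h < d \<Longrightarrow> Q h"
      unfolding eventually_at_right_field by auto
    have ev2: "eventually (\<lambda>h. 0 < h \<and> h < c * d) (at_right (0::real))"
      using c d(1) by (auto simp: eventually_at_right_field intro!: exI[of _ "c * d"])
    have "clarke_derivative_real G t w \<le> ereal (M / c)"
      unfolding clarke_derivative_real_def
    proof (rule Limsup_bounded, unfold eventually_prod_filter, intro exI conjI allI impI)
      fix s h assume s: "P s" and h: "0 < h \<and> h < c * d"
      have "Q (h / c)" using h c by (intro d(2)) (simp_all add: pos_divide_less_eq mult.commute[of c])
      have "h / c * (c * w) = h * w" using c by simp
      with PQ[OF s \<open>Q (h / c)\<close>] have "(G (s + h * w) - G s) / (h / c) < M"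
        by (simp add: real)
      then have "(G (s + h * w) - G s) < M * (h / c)"
        using h c by (subst (asm) pos_divide_less_eq) auto
      then have "(G (s + h * w) - G s) / h \<le> M / c"
        using h by (simp add: pos_divide_le_eq)
      then show "(case (s, h) of (s, h) \<Rightarrow> ereal ((G (s + h * w) - G s) / h)) \<le> ereal (M / c)"
        by simp
    qed (use P ev2 in auto)
    then have "ereal c * clarke_derivative_real G t w \<le> ereal c * ereal (M / c)"
      using c by (intro ereal_mult_left_mono) auto
    then show ?thesis using c by (simp add: real)
  qed (use y in auto)
qed


text \<open>Every direction is 0 or a positive multiple of 1 or -1, so these two units already
  determine both endpoints.\<close>

lemma clarke_gradient_real_eq:
  assumes U: "clarke_derivative_real G t 1 = ereal U" and L: "clarke_derivative_real G t (-1) = ereal (- L)"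
  shows "clarke_gradient_real G t = {L..U}"
proof (intro set_eqI iffI)
  fix \<xi> assume \<xi>: "\<xi> \<in> clarke_gradient_real G t"
  then have "ereal (\<xi> * 1) \<le> ereal U" "ereal (\<xi> * (-1)) \<le> ereal (- L)"
    unfolding clarke_gradient_real_def U[symmetric] L[symmetric] by blast+
  then show "\<xi> \<in> {L..U}" by simp
next
  fix \<xi> assume \<xi>: "\<xi> \<in> {L..U}"
  show "\<xi> \<in> clarke_gradient_real G t"
    unfolding clarke_gradient_real_def
  proof (intro CollectI allI)
    fix w :: real
    consider "w = 0" | "w > 0" | "w < 0" by linarith
    then show "ereal (\<xi> * w) \<le> clarke_derivative_real G t w"
    proof cases
      case 1 then show ?thesis by (simp add: clarke_derivative_real_zero)
    next
      case 2
      then have "ereal (\<xi> * w) \<le> ereal w * ereal U" using \<xi> by simp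
      also have "\<dots> \<le> clarke_derivative_real G t w"
        using clarke_derivative_real_scale_le[OF 2, of G t 1] U by simp
      finally show ?thesis .
    next
      case 3
      then have "ereal (\<xi> * w) \<le> ereal (-w) * ereal (-L)" using \<xi> by (simp add: mult.commute)
      also have "\<dots> \<le> clarke_derivative_real G t w"
        using clarke_derivative_real_scale_le[of "-w" G t "-1"] L 3 by simp
      finally show ?thesis .
    qed
  qed
qed


section \<open>Local essential suprema and local slope bounds\<close>

text \<open>Essential suprema decrease with the ball, so their limit is an infimum over radii, and
  each of them is itself an infimum of almost-everywhere bounds. The two infima merge into one over
  real local bounds.\<close>

lemma esssup_ball_tendsto:
  fixes \<phi> :: "real \<Rightarrow> real"
  assumes meas: "\<phi> \<in> borel_measurable lebesgue"
  shows "((\<lambda>r. esssup (lebesgue_on {s. \<bar>s - t\<bar> < r}) (\<lambda>s. ereal (\<phi> s))) \<longlongrightarrow>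
    Inf (ereal ` {M. \<exists>r>0. AE s in lebesgue. s \<in> {t - r<..<t + r} \<longrightarrow> \<phi> s \<le> M})) (at_right 0)"
    (is "(?e \<longlongrightarrow> Inf (ereal ` ?S)) _")
proof -
  have ball: "{s. \<bar>s - t\<bar> < r} = {t - r<..<t + r}" for r by auto
  have m: "(\<lambda>s. ereal (\<phi> s)) \<in> borel_measurable (lebesgue_on {t - r<..<t + r})" for r
    using meas by (intro borel_measurable_ereal measurable_restrict_space1)
  have e_eq: "?e r = Inf {z. AE s in lebesgue. s \<in> {t - r<..<t + r} \<longrightarrow> ereal (\<phi> s) \<le> z}" for r
    unfolding ball by (subst esssup_eq_AE[OF m]) (simp add: AE_restrict_space_iff)
  have mono: "?e r \<le> ?e r'" if "r \<le> r'" for r r'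
    unfolding e_eq
  proof (rule Inf_superset_mono, rule subsetI, unfold mem_Collect_eq)
    fix z assume "AE s in lebesgue. s \<in> {t - r'<..<t + r'} \<longrightarrow> ereal (\<phi> s) \<le> z"
    then show "AE s in lebesgue. s \<in> {t - r<..<t + r} \<longrightarrow> ereal (\<phi> s) \<le> z"
      by eventually_elim (use that in auto)
  qed
  have "(?e \<longlongrightarrow> (INF r\<in>{0<..}. ?e r)) (at_right 0)"
  proof (rule order_tendstoI)
    fix a assume a: "a < (INF r\<in>{0<..}. ?e r)"
    show "eventually (\<lambda>r. a < ?e r) (at_right 0)"
      unfolding eventually_at_right_field
      by (rule exI[of _ 1]) (use a in \<open>auto intro: less_le_trans INF_lower\<close>)
  next
    fix a assume "(INF r\<in>{0<..}. ?e r) < a"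
    then obtain r where "r > 0" "?e r < a" by (auto simp: INF_less_iff)
    then show "eventually (\<lambda>r. ?e r < a) (at_right 0)"
      unfolding eventually_at_right_field
      by (intro exI[of _ r]) (use mono le_less_trans in \<open>blast intro: less_imp_le\<close>)
  qed
  also have "(INF r\<in>{0<..}. ?e r) = Inf (ereal ` ?S)"
  proof (rule antisym)
    show "(INF r\<in>{0<..}. ?e r) \<le> Inf (ereal ` ?S)"
    proof (rule Inf_greatest, safe)
      fix M and r :: real assume r: "r > 0" "AE s in lebesgue. s \<in> {t - r<..<t + r} \<longrightarrow> \<phi> s \<le> M"
      then have "?e r \<le> ereal M" unfolding e_eq by (intro Inf_lower) simp
      then show "(INF r\<in>{0<..}. ?e r) \<le> ereal M" using r(1) by (intro INF_lower2) auto
    qed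
    show "Inf (ereal ` ?S) \<le> (INF r\<in>{0<..}. ?e r)"
    proof (rule INF_greatest, unfold e_eq, rule Inf_greatest, unfold mem_Collect_eq)
      fix r :: real and z
      assume r: "r \<in> {0<..}" and z: "AE s in lebesgue. s \<in> {t - r<..<t + r} \<longrightarrow> ereal (\<phi> s) \<le> z"
      show "Inf (ereal ` ?S) \<le> z"
      proof (cases z)
        case (real M)
        then have "M \<in> ?S" using z r by auto
        then show ?thesis unfolding real by (intro Inf_lower) blast
      next
        \<comment> \<open>A bound of minus infinity makes every real number a bound as well, so
          restricting to real bounds loses nothing.\<close>
        case MInf
        have "M \<in> ?S" for M
        proof -
          have "AE s in lebesgue. s \<in> {t - r<..<t + r} \<longrightarrow> \<phi> s \<le> M"
            using z by eventually_elim (auto simp: MInf)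
          then show ?thesis using r by auto
        qed
        then have "Inf (ereal ` ?S) \<le> ereal M" for M by (intro Inf_lower) blast
        then have "Inf (ereal ` ?S) = -\<infinity>" using ereal_bot by blast
        then show ?thesis by simp
      qed auto
    qed
  qed
  finally show ?thesis .
qed

lemma (in interval_primitive) uminus: "interval_primitive (\<lambda>s. - \<phi> s) (\<lambda>s. - G s)"
proof
  show "set_integrable lebesgue {a<..<b} (\<lambda>s. - \<phi> s)" for a b
    using integrable[of a b] by (simp add: set_integrable_def)
  show "- G b - - G a = (LINT s:{a<..<b}|lebesgue. - \<phi> s)" if "a \<le> b" for a b
    using increment[OF that] by (simp add: set_lebesgue_integral_def)
qed

text \<open>Both conditions survive shrinking the ball, so they need only be compared at radii where
  the lower bound on \<phi> is available.\<close>

lemma (in interval_primitive) essential_bounds_eq_increment_bounds: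
  assumes r0: "r0 > 0" and lower: "AE s in lebesgue. s \<in> {t - r0<..<t + r0} \<longrightarrow> - c \<le> \<phi> s"
  shows "{M. \<exists>r>0. AE s in lebesgue. s \<in> {t - r<..<t + r} \<longrightarrow> \<phi> s \<le> M} =
     {M. \<exists>r>0. \<forall>a b. t - r \<le> a \<longrightarrow> a < b \<longrightarrow> b \<le> t + r \<longrightarrow> G b - G a \<le> M * (b - a)}"
proof (intro Collect_cong iffI)
  have iff: "(AE s in lebesgue. s \<in> {t - r<..<t + r} \<longrightarrow> \<phi> s \<le> M) \<longleftrightarrow>
    (\<forall>a b. t - r \<le> a \<longrightarrow> a < b \<longrightarrow> b \<le> t + r \<longrightarrow> G b - G a \<le> M * (b - a))" if "r \<le> r0" for r M
  proof (rule AE_le_iff_increment_le)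
    show "AE s in lebesgue. s \<in> {t - r<..<t + r} \<longrightarrow> - c \<le> \<phi> s"
      using lower by eventually_elim (use that in auto)
  qed
  fix M
  {
    assume "\<exists>r>0. AE s in lebesgue. s \<in> {t - r<..<t + r} \<longrightarrow> \<phi> s \<le> M"
    then obtain r where r: "r > 0" "AE s in lebesgue. s \<in> {t - r<..<t + r} \<longrightarrow> \<phi> s \<le> M" by blast
    have "AE s in lebesgue. s \<in> {t - min r r0<..<t + min r r0} \<longrightarrow> \<phi> s \<le> M"
      using r(2) by eventually_elim auto
    then show "\<exists>r>0. \<forall>a b. t - r \<le> a \<longrightarrow> a < b \<longrightarrow> b \<le> t + r \<longrightarrow> G b - G a \<le> M * (b - a)"
      using iff[of "min r r0" M] r(1) r0 by (intro exI[of _ "min r r0"]) auto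
  next
    assume "\<exists>r>0. \<forall>a b. t - r \<le> a \<longrightarrow> a < b \<longrightarrow> b \<le> t + r \<longrightarrow> G b - G a \<le> M * (b - a)"
    then obtain r where r: "r > 0"
      "\<forall>a b. t - r \<le> a \<longrightarrow> a < b \<longrightarrow> b \<le> t + r \<longrightarrow> G b - G a \<le> M * (b - a)" by blast
    have "\<forall>a b. t - min r r0 \<le> a \<longrightarrow> a < b \<longrightarrow> b \<le> t + min r r0 \<longrightarrow> G b - G a \<le> M * (b - a)"
      using r(2) by auto
    then show "\<exists>r>0. AE s in lebesgue. s \<in> {t - r<..<t + r} \<longrightarrow> \<phi> s \<le> M"
      using iff[of "min r r0" M] r(1) r0 by (intro exI[of _ "min r r0"]) auto
  }
qed

lemma Inf_ereal_image_real:
  assumes "M0 \<in> S" "\<And>M. M \<in> S \<Longrightarrow> c \<le> M"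
  shows "Inf (ereal ` S) = ereal (Inf S)"
proof (rule antisym)
  have bdd: "bdd_below S" by (rule bdd_belowI[of _ c]) (rule assms(2))
  show "ereal (Inf S) \<le> Inf (ereal ` S)"
    using bdd by (intro Inf_greatest) (auto intro: cInf_lower)
  show "Inf (ereal ` S) \<le> ereal (Inf S)"
  proof (rule ereal_le_epsilon2)
    fix e :: real assume e: "0 < e"
    then obtain M where M: "M \<in> S" "M < Inf S + e"
      using cInf_less_iff[of S "Inf S + e"] assms(1) bdd by auto
    then have "Inf (ereal ` S) \<le> ereal M" by (intro Inf_lower) auto
    also have "\<dots> \<le> ereal (Inf S) + ereal e" using M by simp
    finally show "Inf (ereal ` S) \<le> ereal (Inf S) + ereal e" .
  qed
qed

section \<open>Increasing, locally Lipschitz primitives\<close>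

locale lipschitz_primitive = interval_primitive +
  assumes nonneg: "AE s in lebesgue. 0 \<le> \<phi> s"
    and lipschitz: "\<exists>r>0. \<exists>L. L-lipschitz_on (ball t r) G"
begin

text \<open>This and \<open>lower\<close> have the bodies of \<open>f_upper\<close> and
  \<open>f_lower\<close> at a fixed point \<open>x\<close>, so that the later identification is mere
  unfolding.\<close>

definition upper :: "real \<Rightarrow> real" where
  "upper t = real_of_ereal
     (Lim (at_right 0) (\<lambda>r. esssup (lebesgue_on {s. \<bar>s - t\<bar> < r}) (\<lambda>s. ereal (\<phi> s))))"

definition lower :: "real \<Rightarrow> real" where
  "lower t = real_of_ereal
     (Lim (at_right 0) (\<lambda>r. - esssup (lebesgue_on {s. \<bar>s - t\<bar> < r}) (\<lambda>s. - ereal (\<phi> s))))"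

abbreviation "upper_bounds t \<equiv> {M. \<exists>r>0. AE s in lebesgue. s \<in> {t - r<..<t + r} \<longrightarrow> \<phi> s \<le> M}"
abbreviation "lower_bounds t \<equiv> {M. \<exists>r>0. AE s in lebesgue. s \<in> {t - r<..<t + r} \<longrightarrow> - \<phi> s \<le> M}"

lemma upper_bounds_eq: "upper_bounds t =
    {M. \<exists>r>0. \<forall>a b. t - r \<le> a \<longrightarrow> a < b \<longrightarrow> b \<le> t + r \<longrightarrow> G b - G a \<le> M * (b - a)}"
  by (rule essential_bounds_eq_increment_bounds[of 1 _ 0]) (use nonneg in \<open>auto elim!: eventually_mono\<close>)

lemma obtain_upper_bound:
  obtains L where "L \<in> upper_bounds t"
proof -
  obtain r L where r: "r > 0" and L: "L-lipschitz_on (ball t r) G" using lipschitz by blast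
  have "\<forall>a b. t - r/2 \<le> a \<longrightarrow> a < b \<longrightarrow> b \<le> t + r/2 \<longrightarrow> G b - G a \<le> L * (b - a)"
  proof (intro allI impI)
    fix a b assume "t - r/2 \<le> a" "a < b" "b \<le> t + r/2"
    then have "dist (G b) (G a) \<le> L * dist b a"
      using r by (intro lipschitz_onD[OF L]) (auto simp: dist_real_def)
    with \<open>a < b\<close> show "G b - G a \<le> L * (b - a)" by (auto simp: dist_real_def)
  qed
  then have "L \<in> upper_bounds t"
    unfolding upper_bounds_eq using r by (intro CollectI exI[of _ "r/2"]) auto
  then show ?thesis using that by blast
qed

text \<open>For -\<phi> the required lower bound is an upper bound for \<phi>, and local Lipschitz
  continuity of \<open>G\<close> provides it.\<close>

lemma lower_bounds_eq: "lower_bounds t =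
    {M. \<exists>r>0. \<forall>a b. t - r \<le> a \<longrightarrow> a < b \<longrightarrow> b \<le> t + r \<longrightarrow> - 1 * (G b - G a) \<le> M * (b - a)}"
proof -
  interpret u: interval_primitive "\<lambda>s. - \<phi> s" "\<lambda>s. - G s" by (rule uminus)
  obtain L where "L \<in> upper_bounds t" by (rule obtain_upper_bound)
  then obtain r where r: "r > 0" "AE s in lebesgue. s \<in> {t - r<..<t + r} \<longrightarrow> \<phi> s \<le> L" by blast
  from u.essential_bounds_eq_increment_bounds[of r t L] r show ?thesis by simp
qed

text \<open>Both bounds control the single increment \<open>G (t + d) - G t\<close>. This makes the
  two infima finite and puts \<open>lower\<close> below \<open>upper\<close>.\<close>

lemma bounds_consistent:
  assumes "M \<in> upper_bounds t" "M' \<in> lower_bounds t"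
  shows "- M' \<le> M"
proof -
  from assms(1) obtain r where r: "r > 0"
    "\<And>a b. t - r \<le> a \<Longrightarrow> a < b \<Longrightarrow> b \<le> t + r \<Longrightarrow> G b - G a \<le> M * (b - a)"
    unfolding upper_bounds_eq by blast
  from assms(2) obtain r' where r': "r' > 0"
    "\<And>a b. t - r' \<le> a \<Longrightarrow> a < b \<Longrightarrow> b \<le> t + r' \<Longrightarrow> - 1 * (G b - G a) \<le> M' * (b - a)"
    unfolding lower_bounds_eq by blast
  define d where "d = min r r'"
  have d: "d > 0" "d \<le> r" "d \<le> r'" using r(1) r'(1) by (auto simp: d_def)
  then have "- M' * d \<le> G (t + d) - G t" "G (t + d) - G t \<le> M * d"
    using r(2)[of t "t + d"] r'(2)[of t "t + d"] by auto
  then have "- M' * d \<le> M * d" by linarith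
  then show ?thesis using d(1) by (simp only: mult_le_cancel_right_pos)
qed

lemma zero_in_lower_bounds: "0 \<in> lower_bounds t"
  using nonneg by (intro CollectI exI[of _ 1]) (auto elim!: eventually_mono)

lemma Inf_upper_bounds: "Inf (ereal ` upper_bounds t) = ereal (Inf (upper_bounds t))"
proof (rule obtain_upper_bound[of t])
  fix L assume "L \<in> upper_bounds t"
  then show ?thesis
    by (rule Inf_ereal_image_real[of _ _ 0]) (use bounds_consistent[OF _ zero_in_lower_bounds] in force)
qed

lemma Inf_lower_bounds: "Inf (ereal ` lower_bounds t) = ereal (Inf (lower_bounds t))"
proof (rule obtain_upper_bound[of t])
  fix L assume L: "L \<in> upper_bounds t"
  show ?thesis
    by (rule Inf_ereal_image_real[OF zero_in_lower_bounds, of _ "- L"]) (use bounds_consistent[OF L] in force)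
qed

lemma upper_eq: "upper t = Inf (upper_bounds t)"
proof -
  have "Lim (at_right 0) (\<lambda>r. esssup (lebesgue_on {s. \<bar>s - t\<bar> < r}) (\<lambda>s. ereal (\<phi> s))) =
      ereal (Inf (upper_bounds t))"
    using esssup_ball_tendsto[OF measurable, of t] unfolding Inf_upper_bounds
    by (intro tendsto_Lim) auto
  then show ?thesis by (simp add: upper_def)
qed

lemma lower_eq: "lower t = - Inf (lower_bounds t)"
proof -
  have "(\<lambda>s. - \<phi> s) \<in> borel_measurable lebesgue" using measurable by measurable
  from tendsto_uminus_ereal[OF esssup_ball_tendsto[OF this, of t]]
  have "Lim (at_right 0) (\<lambda>r. - esssup (lebesgue_on {s. \<bar>s - t\<bar> < r}) (\<lambda>s. - ereal (\<phi> s))) =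
      - ereal (Inf (lower_bounds t))"
    unfolding Inf_lower_bounds by (intro tendsto_Lim) auto
  then show ?thesis by (simp add: lower_def)
qed

lemma clarke_derivative_upper: "clarke_derivative_real G t 1 = ereal (upper t)"
  using clarke_derivative_real_unit[of 1 G t] Inf_upper_bounds[of t]
  unfolding upper_eq upper_bounds_eq by simp

lemma clarke_derivative_lower: "clarke_derivative_real G t (-1) = ereal (- lower t)"
  using clarke_derivative_real_unit[of "-1" G t] Inf_lower_bounds[of t]
  unfolding lower_eq minus_minus lower_bounds_eq by simp

lemma clarke_gradient: "clarke_gradient_real G t = {lower t..upper t}"
  by (rule clarke_gradient_real_eq[OF clarke_derivative_upper clarke_derivative_lower])

lemma lower_le_upper: "lower t \<le> upper t"
  unfolding lower_eq upper_eq
proof (rule cInf_greatest)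
  show "upper_bounds t \<noteq> {}" by (rule obtain_upper_bound[of t]) blast
  fix M assume M: "M \<in> upper_bounds t"
  have "- M \<le> Inf (lower_bounds t)"
  proof (rule cInf_greatest)
    show "lower_bounds t \<noteq> {}" using zero_in_lower_bounds by blast
    show "- M \<le> M'" if "M' \<in> lower_bounds t" for M'
      using bounds_consistent[OF M that] by simp
  qed
  then show "- Inf (lower_bounds t) \<le> M" by simp
qed

lemma lower_nonneg: "0 \<le> lower t"
proof (rule obtain_upper_bound[of t])
  fix L assume L: "L \<in> upper_bounds t"
  have "Inf (lower_bounds t) \<le> 0"
  proof (rule cInf_lower[OF zero_in_lower_bounds])
    show "bdd_below (lower_bounds t)"
      using bounds_consistent[OF L] by (intro bdd_belowI[of _ "- L"]) force
  qed
  then show ?thesis by (simp add: lower_eq)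
qed

lemma AE_le_of_upper_less:
  assumes "upper t < M"
  obtains r where "r > 0" "AE s in lebesgue. s \<in> {t - r<..<t + r} \<longrightarrow> \<phi> s \<le> M"
proof -
  have "upper_bounds t \<noteq> {}" by (rule obtain_upper_bound[of t]) blast
  moreover have "bdd_below (upper_bounds t)"
    using bounds_consistent[OF _ zero_in_lower_bounds] by (intro bdd_belowI[of _ 0]) force
  ultimately obtain M' where M': "M' \<in> upper_bounds t" "M' < M"
    using assms unfolding upper_eq by (subst (asm) cInf_less_iff) auto
  then obtain r where r: "r > 0" "AE s in lebesgue. s \<in> {t - r<..<t + r} \<longrightarrow> \<phi> s \<le> M'" by blast
  have "AE s in lebesgue. s \<in> {t - r<..<t + r} \<longrightarrow> \<phi> s \<le> M"
    using r(2) by eventually_elim (use M'(2) in auto)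
  with r(1) show ?thesis by (rule that)
qed

text \<open>A mean value inequality for the upper envelope. The pointwise bound gives an
  almost-everywhere bound on \<phi> near each point; compactness of the interval leaves finitely
  many such neighbourhoods, so the exceptional sets stay null.\<close>

lemma increment_le_of_upper_le:
  assumes ab: "a \<le> b" and M: "\<And>t. a \<le> t \<Longrightarrow> t \<le> b \<Longrightarrow> upper t \<le> M"
  shows "G b - G a \<le> M * (b - a)"
proof (rule field_le_epsilon)
  fix e :: real assume e: "e > 0"
  \<comment> \<open>A local bound is available only for numbers strictly above
    \<open>upper t\<close>, hence the room above \<open>M\<close>; dividing by
    \<open>b - a + 1\<close> also covers \<open>a = b\<close>.\<close>
  define M' where "M' = M + e / (b - a + 1)"
  have "M < M'" using e ab by (simp add: M'_def add_pos_nonneg)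
  have "\<exists>r. r > 0 \<and> (AE s in lebesgue. s \<in> {t - r<..<t + r} \<longrightarrow> \<phi> s \<le> M')" if "t \<in> {a..b}" for t
    using AE_le_of_upper_less[of t M'] M[of t] that \<open>M < M'\<close> by (metis atLeastAtMost_iff le_less_trans)
  then obtain r where r: "\<And>t. t \<in> {a..b} \<Longrightarrow> r t > 0"
    "\<And>t. t \<in> {a..b} \<Longrightarrow> AE s in lebesgue. s \<in> {t - r t<..<t + r t} \<longrightarrow> \<phi> s \<le> M'"
    by metis
  have "{a..b} \<subseteq> (\<Union>t\<in>{a..b}. {t - r t<..<t + r t})"
    using r(1) by force
  then obtain D where D: "D \<subseteq> {a..b}" "finite D" "{a..b} \<subseteq> (\<Union>t\<in>D. {t - r t<..<t + r t})"
    by (rule compactE_image[OF compact_Icc[of a b], of "{a..b}" "\<lambda>t. {t - r t<..<t + r t}", rotated]) auto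
  have "AE s in lebesgue. \<forall>t\<in>D. s \<in> {t - r t<..<t + r t} \<longrightarrow> \<phi> s \<le> M'"
    using D r(2) by (intro AE_finite_allI) auto
  then have "AE s in lebesgue. s \<in> {a<..<b} \<longrightarrow> \<phi> s \<le> M'"
  proof eventually_elim
    case (elim s)
    show ?case
    proof
      assume "s \<in> {a<..<b}"
      then have "s \<in> {a..b}" by simp
      with D(3) obtain t where "t \<in> D" "s \<in> {t - r t<..<t + r t}" by blast
      with elim show "\<phi> s \<le> M'" by blast
    qed
  qed
  moreover have "AE s in lebesgue. s \<in> {a<..<b} \<longrightarrow> - 0 \<le> \<phi> s"
    using nonneg by eventually_elim simp
  ultimately have "G b - G a \<le> M' * (b - a)"
    using AE_le_iff_increment_le[of a b 0 M'] ab by (cases "a < b") auto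
  also have "\<dots> \<le> M * (b - a) + e"
    using e ab by (simp add: M'_def distrib_right field_simps)
  finally show "G b - G a \<le> M * (b - a) + e" .
qed

lemma increment_nonneg: "a \<le> b \<Longrightarrow> G a \<le> G b"
proof -
  assume "a \<le> b"
  moreover have "0 \<le> (LINT s:{a<..<b}|lebesgue. \<phi> s)"
    unfolding set_lebesgue_integral_def
    by (rule integral_nonneg_AE) (use nonneg in \<open>auto elim!: eventually_mono\<close>)
  ultimately show ?thesis using increment[of a b] by simp
qed

end

section \<open>The nonlinearity\<close>

lemma set_lebesgue_integral_Ioo_split:
  fixes \<phi> :: "real \<Rightarrow> real"
  assumes "a \<le> c" "c \<le> b" and int: "\<And>a b. set_integrable lebesgue {a<..<b} \<phi>"
  shows "(LINT s:{a<..<b}|lebesgue. \<phi> s) =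
    (LINT s:{a<..<c}|lebesgue. \<phi> s) + (LINT s:{c<..<b}|lebesgue. \<phi> s)"
proof -
  have ne: "AE s in lebesgue. s \<noteq> c"
    by (rule AE_I'[of "{c}"]) auto
  have "(LINT s:{a<..<b}|lebesgue. \<phi> s) =
      (LINT s|lebesgue. indicator {a<..<c} s * \<phi> s + indicator {c<..<b} s * \<phi> s)"
    unfolding set_lebesgue_integral_def
  proof (rule integral_cong_AE)
    show "AE s in lebesgue. indicat_real {a<..<b} s *\<^sub>R \<phi> s =
        indicator {a<..<c} s * \<phi> s + indicator {c<..<b} s * \<phi> s"
      using ne by eventually_elim (use assms(1,2) in \<open>auto simp: indicator_def\<close>)
    show "(\<lambda>s. indicat_real {a<..<b} s *\<^sub>R \<phi> s) \<in> borel_measurable lebesgue"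
      using int[of a b] by (auto simp: set_integrable_def)
    show "(\<lambda>s. indicator {a<..<c} s * \<phi> s + indicator {c<..<b} s * \<phi> s) \<in> borel_measurable lebesgue"
      using int[of a c] int[of c b] by (intro borel_measurable_add) (auto simp: set_integrable_def)
  qed
  also have "\<dots> = (LINT s:{a<..<c}|lebesgue. \<phi> s) + (LINT s:{c<..<b}|lebesgue. \<phi> s)"
    using int[of a c] int[of c b] by (simp add: set_integrable_def set_lebesgue_integral_def)
  finally show ?thesis .
qed

lemma einterval_0: "einterval 0 (ereal t) = {0<..<t}" "einterval (ereal t) 0 = {t<..<0}"
  by (auto simp: einterval_def zero_ereal_def simp del: ereal_less_eq)

lemma interval_primitive_primitive:
  assumes F_defined: "\<And>t. interval_lebesgue_integrable lebesgue 0 (ereal t) (f x)"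
  shows "interval_primitive (f x) (primitive f x)"
proof
  have pos: "set_integrable lebesgue {0<..<t} (f x)" if "0 \<le> t" for t
    using F_defined[of t] that by (simp add: interval_lebesgue_integrable_def einterval_0)
  have neg: "set_integrable lebesgue {t<..<0} (f x)" if "t \<le> 0" for t
    using F_defined[of t] that
    by (cases "t = 0") (auto simp: interval_lebesgue_integrable_def einterval_0 set_integrable_def)
  have zero: "set_integrable lebesgue {0} (f x)"
  proof -
    have "(\<lambda>s. indicat_real {0} s *\<^sub>R f x s) = (\<lambda>s. indicat_real {0} s * f x 0)"
      by (auto simp: indicator_def)
    moreover have "integrable lebesgue (\<lambda>s. indicat_real {0} s * f x 0)"
      by (intro integrable_mult_left integrable_real_indicator) auto
    ultimately show ?thesis by (simp add: set_integrable_def)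
  qed
  show int: "set_integrable lebesgue {a<..<b} (f x)" for a b
  proof -
    have "set_integrable lebesgue ({min a 0<..<0} \<union> {0} \<union> {0<..<max b 0}) (f x)"
      using pos neg zero by (intro set_integrable_Un) auto
    then show ?thesis
      by (rule set_integrable_subset) auto
  qed
  show "primitive f x b - primitive f x a = (LINT s:{a<..<b}|lebesgue. f x s)" if "a \<le> b" for a b
  proof -
    have eq: "primitive f x t = (if 0 \<le> t then LINT s:{0<..<t}|lebesgue. f x s
        else - (LINT s:{t<..<0}|lebesgue. f x s))" for t
      by (simp add: primitive_def interval_lebesgue_integral_def einterval_0)
    show ?thesis
    proof -
      \<comment> \<open>\<open>primitive\<close> changes its form with the sign of its argument, so
        the position of 0 relative to the interval decides how integrals are split.\<close>
      consider "0 \<le> a" | "a < 0" "0 \<le> b" | "b < 0" using that by linarith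
      then show ?thesis
      proof cases
        case 1
        with set_lebesgue_integral_Ioo_split[of 0 a b "f x", OF _ that int] that show ?thesis
          unfolding eq by simp
      next
        case 2
        with set_lebesgue_integral_Ioo_split[of a 0 b "f x", OF _ _ int] show ?thesis
          unfolding eq by simp
      next
        case 3
        with set_lebesgue_integral_Ioo_split[of a b 0 "f x", OF that _ int] that show ?thesis
          unfolding eq by simp
      qed
    qed
  qed
qed

section \<open>Growth of the nonlinearity and of its primitive\<close>

locale nonlinearity =
  fixes f :: "real^2 \<Rightarrow> real \<Rightarrow> real" and t0 \<alpha>0 c1 c2 :: real
  assumes F_defined: "\<And>x t. interval_lebesgue_integrable lebesgue 0 (ereal t) (f x)"
    and F_lipschitz: "\<And>x t. \<exists>r>0. \<exists>L. L-lipschitz_on (ball t r) (primitive f x)"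
    and t0: "t0 \<ge> 0" "\<And>x t. t < t0 \<Longrightarrow> f x t = 0" "\<And>x t. t > t0 \<Longrightarrow> f x t > 0"
    and pos: "\<alpha>0 > 0" "c1 > 0" "c2 > 0"
    and growth: "\<And>x t \<xi>. \<xi> \<in> clarke_gradient_real (primitive f x) t \<Longrightarrow>
                   \<bar>\<xi>\<bar> \<le> c1 * \<bar>t\<bar> + c2 * exp (\<alpha>0 * \<bar>t\<bar>\<^sup>2)"
    and N_meas: "N_measurable (f_lower f)" "N_measurable (f_upper f)"
begin

sublocale P: lipschitz_primitive "f x" "primitive f x" for x
proof -
  interpret interval_primitive "f x" "primitive f x"
    by (rule interval_primitive_primitive) (rule F_defined)
  show "lipschitz_primitive (f x) (primitive f x)"
  proof
    \<comment> \<open>No sign is prescribed for \<open>f x t0\<close>, but a single point is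
      negligible.\<close>
    have "AE s in lebesgue. s \<noteq> t0"
      by (rule AE_I'[of "{t0}"]) auto
    then show "AE s in lebesgue. 0 \<le> f x s"
      by eventually_elim (use t0(2,3) in \<open>metis less_imp_le less_linear order_refl\<close>)
  qed (rule F_lipschitz)
qed

lemma f_upper_eq: "f_upper f x = P.upper x"
  by (simp add: f_upper_def P.upper_def fun_eq_iff)

lemma f_lower_eq: "f_lower f x = P.lower x"
  by (simp add: f_lower_def P.lower_def fun_eq_iff)

lemma clarke_derivative_f:
  "clarke_derivative_real (primitive f x) t 1 = ereal (f_upper f x t)"
  "clarke_derivative_real (primitive f x) t (-1) = ereal (- f_lower f x t)"
  by (simp_all add: f_upper_eq f_lower_eq P.clarke_derivative_upper P.clarke_derivative_lower)

lemma clarke_gradient_f: "clarke_gradient_real (primitive f x) t = {f_lower f x t..f_upper f x t}"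
  by (simp add: f_upper_eq f_lower_eq P.clarke_gradient)

lemma f_lower_nonneg: "0 \<le> f_lower f x t"
  by (simp add: f_lower_eq P.lower_nonneg)

lemma f_lower_le_upper: "f_lower f x t \<le> f_upper f x t"
  by (simp add: f_lower_eq f_upper_eq P.lower_le_upper)

lemma f_upper_nonneg: "0 \<le> f_upper f x t"
  using f_lower_nonneg f_lower_le_upper order_trans by blast

text \<open>The linear term is absorbed by
  \<open>\<bar>t\<bar> \<le> 1 + t^2 \<le> exp (t^2)\<close>. This is the origin of the exponent
  \<open>\<alpha>0 + 1\<close> and of the factor \<open>c1 + c2\<close> in all later
  estimates.\<close>

lemma growth_exp:
  assumes "\<bar>t\<bar> \<le> m"
  shows "c1 * \<bar>t\<bar> + c2 * exp (\<alpha>0 * \<bar>t\<bar>\<^sup>2) \<le> (c1 + c2) * exp ((\<alpha>0 + 1) * m\<^sup>2)"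
proof -
  have t2: "\<bar>t\<bar>\<^sup>2 \<le> m\<^sup>2" using assms by (intro power_mono) auto
  have "0 \<le> (\<bar>t\<bar> - 1)\<^sup>2" by simp
  then have "\<bar>t\<bar> \<le> 1 + \<bar>t\<bar>\<^sup>2" by (simp add: power2_diff) 
  also have "\<dots> \<le> exp (m\<^sup>2)" using exp_ge_add_one_self[of "m\<^sup>2"] t2 by linarith
  also have "\<dots> \<le> exp ((\<alpha>0 + 1) * m\<^sup>2)" using pos by (simp add: algebra_simps)
  finally have 1: "c1 * \<bar>t\<bar> \<le> c1 * exp ((\<alpha>0 + 1) * m\<^sup>2)" using pos by simp
  have "\<alpha>0 * \<bar>t\<bar>\<^sup>2 \<le> (\<alpha>0 + 1) * m\<^sup>2" using pos t2 by (intro mult_mono) auto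
  then have "c2 * exp (\<alpha>0 * \<bar>t\<bar>\<^sup>2) \<le> c2 * exp ((\<alpha>0 + 1) * m\<^sup>2)" using pos by simp
  with 1 show ?thesis by (simp add: distrib_right)
qed

text \<open>The upper envelope is an endpoint of the pointwise gradient and therefore subject to the
  growth condition.\<close>

lemma f_upper_le: "\<bar>t\<bar> \<le> m \<Longrightarrow> f_upper f x t \<le> (c1 + c2) * exp ((\<alpha>0 + 1) * m\<^sup>2)"
  using growth[of "f_upper f x t" x t] growth_exp[of t m] f_lower_le_upper[of x t]
  by (auto simp: clarke_gradient_f)

lemma primitive_zero: "primitive f x 0 = 0"
  by (simp add: primitive_def interval_lebesgue_integral_def einterval_0 set_lebesgue_integral_def)

text \<open>Confines integrals of \<open>F\<close> to the set where an argument exceeds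
  \<open>t0\<close>; for positive \<open>t0\<close> this set has finite measure even on the whole
  plane, if the argument lies in the Orlicz space.\<close>

lemma primitive_eq_0:
  assumes "t \<le> t0"
  shows "primitive f x t = 0"
proof -
  have 0: "(LINT s:{a<..<b}|lebesgue. f x s) = 0" if "b \<le> t0" for a b
    using that t0(2) unfolding set_lebesgue_integral_def
    by (intro integral_eq_zero_AE) (auto simp: indicator_def)
  show ?thesis
  proof (cases "0 \<le> t")
    case True
    then show ?thesis using P.increment[of 0 t x] 0[of t 0] assms primitive_zero by simp
  next
    case False
    then show ?thesis using P.increment[of t 0 x] 0[of 0 t] t0(1) primitive_zero by simp
  qed
qed

text \<open>The mean value inequality for the envelope, with the larger of the two absolute values
  in the exponent; a sum of two exponentials replaces their maximum.\<close>

lemma primitive_diff_le: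
  "\<bar>primitive f x a - primitive f x b\<bar> \<le>
     (c1 + c2) * (exp ((\<alpha>0 + 1) * a\<^sup>2) + exp ((\<alpha>0 + 1) * b\<^sup>2)) * \<bar>a - b\<bar>"
proof -
  have *: "\<bar>primitive f x a - primitive f x b\<bar> \<le>
     (c1 + c2) * (exp ((\<alpha>0 + 1) * a\<^sup>2) + exp ((\<alpha>0 + 1) * b\<^sup>2)) * \<bar>a - b\<bar>" if "a \<le> b" for a b
  proof -
    define m where "m = max \<bar>a\<bar> \<bar>b\<bar>"
    have "P.upper x t \<le> (c1 + c2) * exp ((\<alpha>0 + 1) * m\<^sup>2)" if "a \<le> t" "t \<le> b" for t
      using f_upper_le[of t m x] that by (auto simp: f_upper_eq m_def)
    from P.increment_le_of_upper_le[OF \<open>a \<le> b\<close> this]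
    have "primitive f x b - primitive f x a \<le> (c1 + c2) * exp ((\<alpha>0 + 1) * m\<^sup>2) * (b - a)" by simp
    also have "\<dots> \<le> (c1 + c2) * (exp ((\<alpha>0 + 1) * a\<^sup>2) + exp ((\<alpha>0 + 1) * b\<^sup>2)) * (b - a)"
      using pos that by (intro mult_left_mono mult_right_mono) (auto simp: m_def max_def)
    finally show ?thesis using P.increment_nonneg[OF that] that by simp
  qed
  show ?thesis
  proof (cases "a \<le> b")
    case False
    then show ?thesis using *[of b a] by (simp add: abs_minus_commute add.commute)
  qed (rule *)
qed

end

section \<open>The Orlicz norm\<close>

lemma Phi_0 [simp]: "Phi 0 = 0"
  by (simp add: Phi_def)

lemma Phi_nonneg: "0 \<le> Phi t"
  by (simp add: Phi_def)

lemma Phi_abs [simp]: "Phi \<bar>t\<bar> = Phi t"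
  by (simp add: Phi_def)

lemma Phi_mono: "\<bar>s\<bar> \<le> \<bar>t\<bar> \<Longrightarrow> Phi s \<le> Phi t"
  by (simp add: Phi_def abs_le_square_iff)

lemma power2_le_Phi: "t\<^sup>2 \<le> Phi t"
  using exp_ge_add_one_self[of "t\<^sup>2"] unfolding Phi_def power2_abs by linarith

lemma Phi_measurable [measurable]: "Phi \<in> borel_measurable borel"
  unfolding Phi_def by measurable

text \<open>The square is convex with defect \<theta> (1 - \<theta>) (s - t)^2, and the exponential
  is increasing and convex.\<close>

lemma Phi_convex:
  assumes "0 \<le> \<theta>" "\<theta> \<le> 1"
  shows "Phi ((1 - \<theta>) * s + \<theta> * t) \<le> (1 - \<theta>) * Phi s + \<theta> * Phi t"
proof -
  have "(1 - \<theta>) * s\<^sup>2 + \<theta> * t\<^sup>2 - ((1 - \<theta>) * s + \<theta> * t)\<^sup>2 = \<theta> * (1 - \<theta>) * (s - t)\<^sup>2"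
    by (simp add: power2_eq_square algebra_simps)
  also have "\<dots> \<ge> 0" using assms by simp
  finally have "exp (((1 - \<theta>) * s + \<theta> * t)\<^sup>2) \<le> exp ((1 - \<theta>) * s\<^sup>2 + \<theta> * t\<^sup>2)" by simp
  also have "\<dots> \<le> (1 - \<theta>) * exp (s\<^sup>2) + \<theta> * exp (t\<^sup>2)"
    using convex_onD[OF exp_convex, of \<theta> "s\<^sup>2" "t\<^sup>2"] assms by simp
  finally show ?thesis by (simp add: Phi_def algebra_simps)
qed

lemma Phi_scale_le: "0 \<le> \<theta> \<Longrightarrow> \<theta> \<le> 1 \<Longrightarrow> Phi (\<theta> * t) \<le> \<theta> * Phi t"
  using Phi_convex[of \<theta> 0 t] by simp

section \<open>Admissible levels and the Luxemburg seminorm\<close>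

locale lebesgue_domain =
  fixes \<Omega> :: "(real^2) set"
  assumes domain_sets: "\<Omega> \<in> sets lebesgue"
begin

abbreviation M :: "(real^2) measure" where
  "M \<equiv> lebesgue_on \<Omega>"

abbreviation modular :: "(real^2 \<Rightarrow> real) \<Rightarrow> real set" where
  "modular \<equiv> modular_le_1 Phi \<Omega>"

abbreviation N :: "(real^2 \<Rightarrow> real) \<Rightarrow> real" where
  "N \<equiv> luxemburg_norm Phi \<Omega>"

abbreviation L :: "(real^2 \<Rightarrow> real) set" where
  "L \<equiv> orlicz_space Phi \<Omega>"

lemma modular_iff: "k \<in> modular u \<longleftrightarrow> k > 0 \<and> (\<integral>\<^sup>+x. ennreal (Phi (u x / k)) \<partial>M) \<le> 1"
proof -
  have "Phi (\<bar>u x\<bar> / k) = Phi (u x / k)" for x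
    using Phi_abs[of "\<bar>u x\<bar> / k"] Phi_abs[of "u x / k"] by (simp add: abs_divide)
  then show ?thesis by (simp add: modular_le_1_def)
qed

lemma L_measurable: "u \<in> L \<Longrightarrow> u \<in> borel_measurable M"
  by (simp add: orlicz_space_def)

lemma L_modular: "u \<in> L \<Longrightarrow> modular u \<noteq> {}"
  by (simp add: orlicz_space_def)

lemma LI: "u \<in> borel_measurable M \<Longrightarrow> k \<in> modular u \<Longrightarrow> u \<in> L"
  by (auto simp: orlicz_space_def)

lemma modular_mono:
  assumes k: "k \<in> modular u" and le: "AE x in M. \<bar>v x\<bar> \<le> \<bar>u x\<bar>" and kl: "k \<le> l"
  shows "l \<in> modular v"
proof -
  have k0: "k > 0" using k by (simp add: modular_iff)
  have "(\<integral>\<^sup>+x. ennreal (Phi (v x / l)) \<partial>M) \<le> (\<integral>\<^sup>+x. ennreal (Phi (u x / k)) \<partial>M)"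
  proof (rule nn_integral_mono_AE)
    show "AE x in M. ennreal (Phi (v x / l)) \<le> ennreal (Phi (u x / k))"
      using le
    proof eventually_elim
      case (elim x)
      have "\<bar>v x\<bar> / l \<le> \<bar>u x\<bar> / k" using elim k0 kl by (intro frac_le) auto
      then show ?case using k0 kl by (intro ennreal_leI Phi_mono) (simp add: abs_divide)
    qed
  qed
  also have "\<dots> \<le> 1" using k by (simp add: modular_iff)
  finally show ?thesis using k0 kl by (simp add: modular_iff)
qed

text \<open>\<open>(u + v) / (k + l)\<close> is a convex combination of \<open>u / k\<close> and
  \<open>v / l\<close> with weights proportional to the levels. This is the source of the triangle
  inequality.\<close>

lemma modular_add:
  assumes k: "k \<in> modular u" and l: "l \<in> modular v"
    and [measurable]: "u \<in> borel_measurable M" "v \<in> borel_measurable M"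
  shows "k + l \<in> modular (\<lambda>x. u x + v x)"
proof -
  have kl: "k > 0" "l > 0" using k l by (auto simp: modular_iff)
  define \<theta> where "\<theta> = l / (k + l)"
  have \<theta>: "0 \<le> \<theta>" "\<theta> \<le> 1" "1 - \<theta> = k / (k + l)" using kl by (auto simp: \<theta>_def field_simps)
  have "(\<integral>\<^sup>+x. ennreal (Phi ((u x + v x) / (k + l))) \<partial>M) \<le>
    (\<integral>\<^sup>+x. ennreal (1 - \<theta>) * ennreal (Phi (u x / k)) + ennreal \<theta> * ennreal (Phi (v x / l)) \<partial>M)"
  proof (rule nn_integral_mono)
    fix x
    have "(u x + v x) / (k + l) = (1 - \<theta>) * (u x / k) + \<theta> * (v x / l)"
      unfolding \<theta>(3) using kl by (simp add: \<theta>_def add_divide_distrib)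
    then have "Phi ((u x + v x) / (k + l)) \<le> (1 - \<theta>) * Phi (u x / k) + \<theta> * Phi (v x / l)"
      using Phi_convex[OF \<theta>(1,2)] by metis
    then have "ennreal (Phi ((u x + v x) / (k + l))) \<le> ennreal ((1 - \<theta>) * Phi (u x / k) + \<theta> * Phi (v x / l))"
      by (rule ennreal_leI)
    also have "\<dots> = ennreal (1 - \<theta>) * ennreal (Phi (u x / k)) + ennreal \<theta> * ennreal (Phi (v x / l))"
      using \<theta>(1,2) Phi_nonneg by (simp add: ennreal_mult)
    finally show "ennreal (Phi ((u x + v x) / (k + l))) \<le>
        ennreal (1 - \<theta>) * ennreal (Phi (u x / k)) + ennreal \<theta> * ennreal (Phi (v x / l))" .
  qed
  also have "\<dots> = ennreal (1 - \<theta>) * (\<integral>\<^sup>+x. ennreal (Phi (u x / k)) \<partial>M)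
      + ennreal \<theta> * (\<integral>\<^sup>+x. ennreal (Phi (v x / l)) \<partial>M)"
    by (simp add: nn_integral_add nn_integral_cmult)
  also have "\<dots> \<le> ennreal (1 - \<theta>) * 1 + ennreal \<theta> * 1"
    using k l by (intro add_mono mult_left_mono) (auto simp: modular_iff)
  also have "\<dots> = 1" using \<theta> by (simp add: ennreal_plus[symmetric] del: ennreal_plus)
  finally show ?thesis using kl by (simp add: modular_iff)
qed

lemma modular_scale: "k \<in> modular u \<Longrightarrow> c \<noteq> 0 \<Longrightarrow> \<bar>c\<bar> * k \<in> modular (\<lambda>x. c * u x)"
proof -
  assume k: "k \<in> modular u" and c: "c \<noteq> 0"
  have "Phi (c * u x / (\<bar>c\<bar> * k)) = Phi (u x / k)" for x
  proof -
    have "\<bar>c * u x / (\<bar>c\<bar> * k)\<bar> = \<bar>u x / k\<bar>" using c by (simp add: abs_mult abs_divide)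
    then show ?thesis by (metis Phi_abs)
  qed
  then show ?thesis using k c by (simp add: modular_iff)
qed

lemma N_le: "k \<in> modular u \<Longrightarrow> N u \<le> k"
  unfolding luxemburg_norm_def by (intro cInf_lower bdd_belowI[of _ 0]) (auto simp: modular_iff)

lemma N_nonneg: "modular u \<noteq> {} \<Longrightarrow> 0 \<le> N u"
  unfolding luxemburg_norm_def by (intro cInf_greatest) (auto simp: modular_iff)

text \<open>Admissible levels are upward closed. This is the usual way back from a norm estimate to
  an integral estimate.\<close>

lemma modular_of_N_less: "modular u \<noteq> {} \<Longrightarrow> N u < k \<Longrightarrow> k \<in> modular u"
proof -
  assume "modular u \<noteq> {}" "N u < k"
  then obtain l where "l \<in> modular u" "l < k"
    unfolding luxemburg_norm_def by (metis cInf_lessD)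
  then show ?thesis using modular_mono[of l u u k] by auto
qed

lemma N_triangle:
  assumes "u \<in> L" "v \<in> L"
  shows "N (\<lambda>x. u x + v x) \<le> N u + N v"
proof (rule field_le_epsilon)
  fix e :: real assume "e > 0"
  then have "N u + e / 2 \<in> modular u" "N v + e / 2 \<in> modular v"
    using assms by (auto intro!: modular_of_N_less L_modular)
  from N_le[OF modular_add[OF this]] show "N (\<lambda>x. u x + v x) \<le> N u + N v + e"
    using assms by (simp add: L_measurable)
qed

lemma zero_modular: "k > 0 \<Longrightarrow> k \<in> modular (\<lambda>x. 0)"
  by (simp add: modular_iff)

lemma N_zero: "N (\<lambda>x. 0) = 0"
proof (rule antisym)
  show "N (\<lambda>x. 0) \<le> 0"
    by (rule field_le_epsilon) (use N_le zero_modular in auto)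
  show "0 \<le> N (\<lambda>x. 0)" using zero_modular[of 1] by (intro N_nonneg) auto
qed

lemma N_scale_le:
  assumes u: "u \<in> L"
  shows "N (\<lambda>x. c * u x) \<le> \<bar>c\<bar> * N u"
proof (cases "c = 0")
  case False
  show ?thesis
  proof (rule field_le_epsilon)
    fix e :: real assume "e > 0"
    then have "N u + e / \<bar>c\<bar> \<in> modular u"
      using False by (intro modular_of_N_less L_modular[OF u]) auto
    from N_le[OF modular_scale[OF this False]] show "N (\<lambda>x. c * u x) \<le> \<bar>c\<bar> * N u + e"
      using False by (simp add: distrib_left)
  qed
qed (simp add: N_zero)

lemma N_mono:
  assumes u: "u \<in> L" and le: "AE x in M. \<bar>v x\<bar> \<le> \<bar>u x\<bar>"
  shows "N v \<le> N u"
proof (rule field_le_epsilon)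
  fix e :: real assume "e > 0"
  then have "N u + e \<in> modular u" by (intro modular_of_N_less L_modular[OF u]) auto
  then show "N v \<le> N u + e" using modular_mono[OF _ le] by (blast intro: N_le)
qed

lemma L_zero: "(\<lambda>x. 0) \<in> L"
  using zero_modular[of 1] by (intro LI) auto

lemma L_scale: "u \<in> L \<Longrightarrow> (\<lambda>x. c * u x) \<in> L"
proof (cases "c = 0")
  case False
  assume u: "u \<in> L"
  then obtain k where "k \<in> modular u" using L_modular by blast
  from modular_scale[OF this False] show ?thesis
    using L_measurable[OF u] by (intro LI) auto
qed (simp add: L_zero)

lemma L_add: "u \<in> L \<Longrightarrow> v \<in> L \<Longrightarrow> (\<lambda>x. u x + v x) \<in> L"
proof -
  assume uv: "u \<in> L" "v \<in> L"
  then obtain k l where "k \<in> modular u" "l \<in> modular v" using L_modular by blast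
  from modular_add[OF this] uv show ?thesis
    by (intro LI) (auto intro: borel_measurable_add dest: L_measurable)
qed

lemma L_lincomb: "u \<in> L \<Longrightarrow> v \<in> L \<Longrightarrow> (\<lambda>x. a * u x + b * v x) \<in> L"
  by (intro L_add L_scale)

lemma L_diff: "u \<in> L \<Longrightarrow> v \<in> L \<Longrightarrow> (\<lambda>x. u x - v x) \<in> L"
  using L_lincomb[of u v 1 "-1"] by simp

lemma N_lincomb_le: "u \<in> L \<Longrightarrow> v \<in> L \<Longrightarrow> N (\<lambda>x. a * u x + b * v x) \<le> \<bar>a\<bar> * N u + \<bar>b\<bar> * N v"
  using N_triangle[of "\<lambda>x. a * u x" "\<lambda>x. b * v x"] L_scale N_scale_le[of u a] N_scale_le[of v b] by force

lemma N_diff_triangle: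
  assumes "u \<in> L" "v \<in> L" "w \<in> L"
  shows "N (\<lambda>x. u x - w x) \<le> N (\<lambda>x. u x - v x) + N (\<lambda>x. v x - w x)"
  using N_triangle[OF L_diff[OF assms(1,2)] L_diff[OF assms(2,3)]] by simp

lemma N_abs_cong: "(\<And>x. \<bar>u x\<bar> = \<bar>v x\<bar>) \<Longrightarrow> N u = N v"
  unfolding luxemburg_norm_def modular_le_1_def by simp

lemma N_diff_commute: "N (\<lambda>x. u x - v x) = N (\<lambda>x. v x - u x)"
  by (rule N_abs_cong) simp

text \<open>This class replaces both dense classes in the definition of \<open>E_space\<close>: it is
  \<open>L_infinity \<Omega>\<close> for bounded \<open>\<Omega>\<close> and lies between the test functions and their closure in general.\<close>

definition bounded_support :: "(real^2 \<Rightarrow> real) set" where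
  "bounded_support = {w \<in> borel_measurable M.
     \<exists>C R. AE x in M. \<bar>w x\<bar> \<le> C \<and> (R < norm x \<longrightarrow> w x = 0)}"

lemma restrict_lborel_measurable: "f \<in> borel_measurable borel \<Longrightarrow> f \<in> borel_measurable M"
  for f :: "real^2 \<Rightarrow> 'b::topological_space"
  using borel_measurable_subalgebra[of borel] by (intro measurable_restrict_space1 measurable_completion) simp

lemma norm_measurable: "norm \<in> borel_measurable M"
  by (rule restrict_lborel_measurable) simp

lemma cball_finite: "(\<integral>\<^sup>+x. indicator (cball 0 R) x \<partial>M) < \<infinity>"
proof -
  have "(\<integral>\<^sup>+x. indicator (cball 0 R) x \<partial>M) =
      (\<integral>\<^sup>+x. indicator (cball 0 R) x * indicator \<Omega> x \<partial>lebesgue)"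
    using domain_sets by (intro nn_integral_restrict_space) auto
  also have "\<dots> \<le> (\<integral>\<^sup>+x. indicator (cball 0 R) (x :: real^2) \<partial>lebesgue)"
    by (intro nn_integral_mono) (auto simp: indicator_def)
  also have "\<dots> = emeasure lebesgue (cball 0 R :: (real^2) set)" by (intro nn_integral_indicator) auto
  also have "\<dots> < \<infinity>" using emeasure_bounded_finite[of "cball 0 R :: (real^2) set"] by simp
  finally show ?thesis .
qed

text \<open>A common bound and a common bounded support give the dominating function
  \<open>Phi (C / k)\<close> on a ball, integrable at every scale \<open>k\<close>.\<close>

lemma Phi_integral_tendsto_0:
  assumes k: "k > 0" and meas: "\<And>n. w n \<in> borel_measurable M"
    and bound: "\<And>n. AE x in M. \<bar>w n x\<bar> \<le> C \<and> (R < norm x \<longrightarrow> w n x = 0)"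
    and lim: "AE x in M. (\<lambda>n. w n x) \<longlonglongrightarrow> 0"
  shows "(\<lambda>n. \<integral>\<^sup>+x. ennreal (Phi (w n x / k)) \<partial>M) \<longlonglongrightarrow> 0"
proof -
  have "(\<lambda>n. \<integral>\<^sup>+x. ennreal (Phi (w n x / k)) \<partial>M) \<longlonglongrightarrow> (\<integral>\<^sup>+x. ennreal (Phi 0) \<partial>M)"
  proof (rule nn_integral_dominated_convergence[where w="\<lambda>x. ennreal (Phi (C / k)) * indicator (cball 0 R) x"])
    show "(\<lambda>x. ennreal (Phi (w n x / k))) \<in> borel_measurable M" for n
      using meas[of n] by measurable
    have ind: "(\<lambda>x. indicator (cball 0 R) x :: ennreal) \<in> borel_measurable M"
      by (intro restrict_lborel_measurable borel_measurable_indicator) auto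
    then show "(\<lambda>x. ennreal (Phi (C / k)) * indicator (cball 0 R) x) \<in> borel_measurable M"
      by measurable
    show "(\<integral>\<^sup>+x. ennreal (Phi (C / k)) * indicator (cball 0 R) x \<partial>M) < \<infinity>"
      using cball_finite[of R] ind by (subst nn_integral_cmult) (auto simp: ennreal_mult_less_top)
    show "AE x in M. ennreal (Phi (w n x / k)) \<le> ennreal (Phi (C / k)) * indicator (cball 0 R) x" for n
      using bound[of n]
    proof eventually_elim
      case (elim x)
      then have "Phi (w n x / k) \<le> Phi (C / k)"
        using k by (intro Phi_mono) (auto simp: abs_divide intro!: divide_right_mono)
      then show ?case using elim by (auto simp: indicator_def not_le intro: ennreal_leI)
    qed
    show "AE x in M. (\<lambda>n. ennreal (Phi (w n x / k))) \<longlonglongrightarrow> ennreal (Phi 0)"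
      using lim
    proof eventually_elim
      case (elim x)
      then have "(\<lambda>n. exp (\<bar>w n x / k\<bar>\<^sup>2) - 1) \<longlonglongrightarrow> exp (\<bar>0 / k\<bar>\<^sup>2) - 1"
        using k by (intro tendsto_intros) auto
      then show ?case by (intro tendsto_ennrealI) (simp add: Phi_def)
    qed
  qed simp
  then show ?thesis by simp
qed

text \<open>Bounded convergence for the Luxemburg norm: the modular tends to zero at every scale, so
  every positive level eventually becomes admissible.\<close>

lemma eventually_modular:
  assumes meas: "\<And>n. w n \<in> borel_measurable M"
    and bound: "\<And>n. AE x in M. \<bar>w n x\<bar> \<le> C \<and> (R < norm x \<longrightarrow> w n x = 0)"
    and lim: "AE x in M. (\<lambda>n. w n x) \<longlonglongrightarrow> 0"
    and e: "e > 0"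
  shows "\<forall>\<^sub>F n in sequentially. e \<in> modular (w n)"
proof -
  have "\<forall>\<^sub>F n in sequentially. (\<integral>\<^sup>+x. ennreal (Phi (w n x / e)) \<partial>M) < 1"
    using Phi_integral_tendsto_0[OF e meas bound lim] by (rule order_tendstoD) simp
  then show ?thesis
    by eventually_elim (use e in \<open>auto simp: modular_iff\<close>)
qed

lemma bounded_support_L: "w \<in> bounded_support \<Longrightarrow> w \<in> L"
proof -
  assume "w \<in> bounded_support"
  then obtain C R where w: "w \<in> borel_measurable M"
      "AE x in M. \<bar>w x\<bar> \<le> C \<and> (R < norm x \<longrightarrow> w x = 0)"
    by (auto simp: bounded_support_def)
  \<comment> \<open>These multiples of \<open>w\<close> tend to zero boundedly, so some of them has
    the admissible level 1; scaling back yields a level of \<open>w\<close>.\<close>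
  define W where "W = (\<lambda>n x. w x / real (Suc n))"
  have "\<forall>\<^sub>F n in sequentially. 1 \<in> modular (W n)"
  proof (rule eventually_modular)
    show "W n \<in> borel_measurable M" for n
      using w(1) unfolding W_def by measurable
    show "AE x in M. \<bar>W n x\<bar> \<le> C \<and> (R < norm x \<longrightarrow> W n x = 0)" for n
      using w(2)
    proof eventually_elim
      case (elim x)
      have "\<bar>w x\<bar> / real (Suc n) \<le> \<bar>w x\<bar> / 1" by (intro divide_left_mono) auto
      with elim show ?case by (auto simp: W_def abs_divide)
    qed
    show "AE x in M. (\<lambda>n. W n x) \<longlonglongrightarrow> 0"
      unfolding W_def using LIMSEQ_Suc[OF lim_const_over_n] by (intro AE_I2) blast
  qed auto
  then obtain n where "1 \<in> modular (W n)"
    using eventually_happens'[OF sequentially_bot] by blast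
  from modular_scale[OF this, of "real (Suc n)"] have "real (Suc n) \<in> modular w"
    by (simp add: W_def del: of_nat_Suc)
  then show "w \<in> L" using w(1) by (rule LI[rotated])
qed

lemma bounded_support_lincomb:
  assumes "u \<in> bounded_support" "v \<in> bounded_support"
  shows "(\<lambda>x. a * u x + b * v x) \<in> bounded_support"
proof -
  from assms obtain C R C' R' where
    u: "u \<in> borel_measurable M" "AE x in M. \<bar>u x\<bar> \<le> C \<and> (R < norm x \<longrightarrow> u x = 0)" and
    v: "v \<in> borel_measurable M" "AE x in M. \<bar>v x\<bar> \<le> C' \<and> (R' < norm x \<longrightarrow> v x = 0)"
    by (auto simp: bounded_support_def)
  have "AE x in M. \<bar>a * u x + b * v x\<bar> \<le> \<bar>a\<bar> * C + \<bar>b\<bar> * C' \<and>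
      (max R R' < norm x \<longrightarrow> a * u x + b * v x = 0)"
    using u(2) v(2)
  proof eventually_elim
    case (elim x)
    have "\<bar>a * u x + b * v x\<bar> \<le> \<bar>a\<bar> * \<bar>u x\<bar> + \<bar>b\<bar> * \<bar>v x\<bar>" by (metis abs_mult abs_triangle_ineq)
    also have "\<dots> \<le> \<bar>a\<bar> * C + \<bar>b\<bar> * C'" using elim by (intro add_mono mult_left_mono) auto
    finally show ?case using elim by auto
  qed
  moreover have "(\<lambda>x. a * u x + b * v x) \<in> borel_measurable M"
    using u(1) v(1) by measurable
  ultimately show ?thesis unfolding bounded_support_def by blast
qed

lemma indicator_measurable:
  "A \<in> sets lebesgue \<Longrightarrow> (indicator A :: _ \<Rightarrow> real) \<in> borel_measurable M"
  by (intro measurable_restrict_space1 borel_measurable_indicator)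

lemma indicator_bounded_support:
  assumes "A \<in> sets lebesgue" "bounded A"
  shows "indicator A \<in> bounded_support"
proof -
  obtain R where "\<And>x. x \<in> A \<Longrightarrow> norm x \<le> R" using assms(2) by (auto simp: bounded_iff)
  then have "AE x in M. \<bar>indicator A x :: real\<bar> \<le> 1 \<and> (R < norm x \<longrightarrow> indicator A x = (0::real))"
    by (intro AE_I2) (force simp: indicator_def)
  then show ?thesis using indicator_measurable[OF assms(1)] unfolding bounded_support_def by blast
qed

end

context lebesgue_domain begin

lemma sets_lebesgue_Collect:
  assumes "Measurable.pred M P"
  shows "{x \<in> \<Omega>. P x} \<in> sets lebesgue"
proof -
  have "{x \<in> space M. P x} \<in> sets M"
    using assms by measurable
  then show ?thesis
    using domain_sets by (subst (asm) sets_restrict_space_iff) auto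
qed

lemma bounded_support_sum:
  assumes "finite J" "\<And>j. j \<in> J \<Longrightarrow> w j \<in> bounded_support"
  shows "(\<lambda>x. \<Sum>j\<in>J. c j * w j x) \<in> bounded_support"
  using assms
proof (induction J rule: finite_induct)
  case empty
  have "indicator {} \<in> bounded_support" by (rule indicator_bounded_support) auto
  then show ?case by (simp add: indicator_def[abs_def])
next
  case (insert j J)
  then show ?case using bounded_support_lincomb[of "w j" "\<lambda>x. \<Sum>j\<in>J. c j * w j x" "c j" 1] by simp
qed

text \<open>Rounding \<open>w\<close> down to multiples of \<open>1 / (n + 1)\<close> on a ball
  gives simple functions that converge boundedly with common support. A property that is linear and
  stable under such limits therefore has to be checked on indicators of bounded sets only.\<close>

lemma bounded_support_induct [consumes 1, case_names indicator lincomb limit]: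
  assumes w: "w \<in> bounded_support"
    and ind: "\<And>A. A \<in> sets lebesgue \<Longrightarrow> A \<subseteq> \<Omega> \<Longrightarrow> bounded A \<Longrightarrow> P (indicator A)"
    and lin: "\<And>u v a b. u \<in> bounded_support \<Longrightarrow> v \<in> bounded_support \<Longrightarrow> P u \<Longrightarrow> P v \<Longrightarrow>
      P (\<lambda>x. a * u x + b * v x)"
    and lim: "\<And>u U C R. u \<in> bounded_support \<Longrightarrow> (\<And>n::nat. U n \<in> bounded_support) \<Longrightarrow> (\<And>n. P (U n)) \<Longrightarrow>
      (\<And>n. AE x in M. \<bar>U n x\<bar> \<le> C \<and> (R < norm x \<longrightarrow> U n x = 0)) \<Longrightarrow>
      (AE x in M. (\<lambda>n. U n x) \<longlonglongrightarrow> u x) \<Longrightarrow> P u"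
  shows "P w"
proof -
  obtain C R where wm: "w \<in> borel_measurable M" and
      wb: "AE x in M. \<bar>w x\<bar> \<le> C \<and> (R < norm x \<longrightarrow> w x = 0)"
    using w by (auto simp: bounded_support_def)
  \<comment> \<open>A finite integer interval containing every value of the floor of
    \<open>(n + 1) * w x\<close> once \<open>\<bar>w x\<bar> \<le> C\<close>.\<close>
  define J where "J n = {- \<lceil>real (Suc n) * C\<rceil>..\<lceil>real (Suc n) * C\<rceil>}" for n
  define A where "A n j = {x \<in> \<Omega>. norm x \<le> R \<and> \<lfloor>real (Suc n) * w x\<rfloor> = j}" for n j
  define U where "U n = (\<lambda>x. \<Sum>j\<in>J n. real_of_int j / real (Suc n) * indicator (A n j) x)" for n
  have A: "A n j \<in> sets lebesgue" "A n j \<subseteq> \<Omega>" "bounded (A n j)" for n j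
  proof -
    have [measurable]: "norm \<in> borel_measurable M" by (rule norm_measurable)
    note wm [measurable]
    show "A n j \<in> sets lebesgue"
      unfolding A_def by (rule sets_lebesgue_Collect) measurable
  qed (auto simp: A_def bounded_iff)
  have P0: "P (\<lambda>x. 0)"
  proof -
    have "P (indicator {})" by (rule ind) auto
    then show ?thesis by (simp add: indicator_def[abs_def])
  qed
  have sum: "P (\<lambda>x. \<Sum>j\<in>K. c j * indicator (A n j) x)" if "finite K" for c n K
    using that
  proof (induction K rule: finite_induct)
    case (insert j K)
    have "P (\<lambda>x. c j * indicator (A n j) x + 1 * (\<Sum>j\<in>K. c j * indicator (A n j) x))"
    proof (rule lin)
      show "indicator (A n j) \<in> bounded_support" by (rule indicator_bounded_support[OF A(1,3)])
      show "(\<lambda>x. \<Sum>j\<in>K. c j * indicator (A n j) x) \<in> bounded_support"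
        using insert A by (intro bounded_support_sum indicator_bounded_support)
      show "P (indicator (A n j))" by (rule ind[OF A])
      show "P (\<lambda>x. \<Sum>j\<in>K. c j * indicator (A n j) x)" by fact
    qed
    then show ?case by (simp only: sum.insert[OF insert(1,2)] mult_1)
  qed (simp add: P0)
  have U_eq: "U n x = (if norm x \<le> R then \<lfloor>real (Suc n) * w x\<rfloor> / real (Suc n) else 0)"
    if x: "x \<in> \<Omega>" "\<bar>w x\<bar> \<le> C" for n x
  proof (cases "norm x \<le> R")
    case True
    define y where "y = real (Suc n) * w x"
    have "\<bar>y\<bar> \<le> real (Suc n) * C"
      unfolding y_def abs_mult using x(2) by (intro mult_mono) auto
    then have y: "\<bar>y\<bar> \<le> \<lceil>real (Suc n) * C\<rceil>" by linarith
    have "\<lfloor>y\<rfloor> \<in> J n" unfolding J_def using y by (simp add: le_floor_iff floor_le_iff) linarith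
    have "U n x = (\<Sum>j\<in>J n. if j = \<lfloor>y\<rfloor> then real_of_int j / real (Suc n) else 0)"
      unfolding U_def using x True by (intro sum.cong) (auto simp: A_def y_def)
    also have "\<dots> = \<lfloor>y\<rfloor> / real (Suc n)"
      using \<open>\<lfloor>y\<rfloor> \<in> J n\<close> by (subst sum.delta) (auto simp: J_def)
    finally show ?thesis using True by (simp add: y_def)
  next
    case False
    then show ?thesis by (auto simp: U_def A_def)
  qed
  have near: "\<bar>\<lfloor>real (Suc n) * y\<rfloor> / real (Suc n) - y\<bar> \<le> 1 / real (Suc n)" for n and y :: real
  proof -
    have "\<bar>\<lfloor>real (Suc n) * y\<rfloor> - real (Suc n) * y\<bar> \<le> 1" by linarith
    then have "\<bar>\<lfloor>real (Suc n) * y\<rfloor> - real (Suc n) * y\<bar> / real (Suc n) \<le> 1 / real (Suc n)"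
      by (intro divide_right_mono) auto
    also have "\<bar>\<lfloor>real (Suc n) * y\<rfloor> - real (Suc n) * y\<bar> / real (Suc n) =
        \<bar>(\<lfloor>real (Suc n) * y\<rfloor> - real (Suc n) * y) / real (Suc n)\<bar>" by (simp add: abs_divide)
    also have "(\<lfloor>real (Suc n) * y\<rfloor> - real (Suc n) * y) / real (Suc n) = \<lfloor>real (Suc n) * y\<rfloor> / real (Suc n) - y"
      by (simp add: diff_divide_distrib del: of_nat_Suc)
    finally show ?thesis .
  qed
  have space: "AE x in M. x \<in> \<Omega>"
    using AE_space[of M] by simp
  show "P w"
  proof (rule lim[OF w])
    show "U n \<in> bounded_support" for n
      unfolding U_def by (rule bounded_support_sum) (use A in \<open>auto simp: J_def intro!: indicator_bounded_support\<close>)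
    show "P (U n)" for n
      unfolding U_def by (rule sum) (simp add: J_def)
    \<comment> \<open>Rounding moves a value by at most 1, hence \<open>C + 1\<close>.\<close>
    show "AE x in M. \<bar>U n x\<bar> \<le> C + 1 \<and> (R < norm x \<longrightarrow> U n x = 0)" for n
      using wb space
    proof eventually_elim
      case (elim x)
      have "1 / real (Suc n) \<le> 1" by simp
      then have "\<bar>\<lfloor>real (Suc n) * w x\<rfloor> / real (Suc n) - w x\<bar> \<le> 1"
        using near[of n "w x"] by linarith
      with elim show ?case unfolding U_eq[OF elim(2) conjunct1[OF elim(1)]] by auto
    qed
    show "AE x in M. (\<lambda>n. U n x) \<longlonglongrightarrow> w x"
      using wb space
    proof eventually_elim
      case (elim x)
      have "\<bar>U n x - w x\<bar> \<le> 1 / real (Suc n)" for n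
        using near[of n "w x"] elim unfolding U_eq[OF elim(2) conjunct1[OF elim(1)]] by auto
      then have "(\<lambda>n. \<bar>U n x - w x\<bar>) \<longlonglongrightarrow> 0"
        by (intro tendsto_sandwich[OF _ _ tendsto_const LIMSEQ_Suc[OF lim_1_over_n]]) auto
      then show ?case by (simp add: LIM_zero_iff tendsto_rabs_zero_iff)
    qed
  qed
qed

text \<open>One closure for both cases in the definition of \<open>E_space\<close>;
  \<open>E_space_eq_support_closure\<close> identifies the two sets on the domains at hand.\<close>

definition support_closure :: "(real^2 \<Rightarrow> real) set" where
  "support_closure = {u \<in> L. \<forall>\<epsilon>>0. \<exists>w\<in>bounded_support. N (\<lambda>x. u x - w x) < \<epsilon>}"

lemma support_closure_L: "u \<in> support_closure \<Longrightarrow> u \<in> L"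
  by (simp add: support_closure_def)

lemma bounded_support_closure: "w \<in> bounded_support \<Longrightarrow> w \<in> support_closure"
  unfolding support_closure_def using bounded_support_L N_zero by force

lemma support_closure_lincomb:
  assumes "u \<in> support_closure" "v \<in> support_closure"
  shows "(\<lambda>x. a * u x + b * v x) \<in> support_closure"
  unfolding support_closure_def
proof (intro CollectI conjI allI impI)
  show "(\<lambda>x. a * u x + b * v x) \<in> L" using assms by (intro L_lincomb support_closure_L)
  fix \<epsilon> :: real assume \<epsilon>: "\<epsilon> > 0"
  \<comment> \<open>The extra 1 avoids a zero denominator and leaves a spare \<open>d\<close>, which
    makes the final inequality strict.\<close>
  define d where "d = \<epsilon> / (\<bar>a\<bar> + \<bar>b\<bar> + 1)"
  have d: "d > 0" using \<epsilon> by (simp add: d_def add_nonneg_pos)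
  obtain w z where w: "w \<in> bounded_support" "N (\<lambda>x. u x - w x) < d"
    and z: "z \<in> bounded_support" "N (\<lambda>x. v x - z x) < d"
    using assms d unfolding support_closure_def by blast
  have "N (\<lambda>x. (a * u x + b * v x) - (a * w x + b * z x)) =
      N (\<lambda>x. a * (u x - w x) + b * (v x - z x))" by (simp add: algebra_simps)
  also have "\<dots> \<le> \<bar>a\<bar> * N (\<lambda>x. u x - w x) + \<bar>b\<bar> * N (\<lambda>x. v x - z x)"
    using assms w z by (intro N_lincomb_le L_diff support_closure_L bounded_support_L)
  also have "\<dots> \<le> \<bar>a\<bar> * d + \<bar>b\<bar> * d"
    using w z by (intro add_mono mult_left_mono) auto
  also have "\<dots> < \<epsilon>"
  proof -
    have "(\<bar>a\<bar> + \<bar>b\<bar> + 1) * d = \<epsilon>" by (simp add: d_def add_nonneg_pos order.strict_implies_not_eq[symmetric])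
    then have "\<bar>a\<bar> * d + \<bar>b\<bar> * d + d = \<epsilon>" by (simp add: distrib_right)
    then show ?thesis using d by linarith
  qed
  finally show "\<exists>w\<in>bounded_support. N (\<lambda>x. a * u x + b * v x - w x) < \<epsilon>"
    by (intro bexI[of _ "\<lambda>x. a * w x + b * z x"] bounded_support_lincomb w z)
qed

lemma support_closure_add_scaled: "u \<in> support_closure \<Longrightarrow> v \<in> support_closure \<Longrightarrow> (\<lambda>x. u x + h * v x) \<in> support_closure"
  using support_closure_lincomb[of u v 1 h] by simp

lemma support_closure_diff: "u \<in> support_closure \<Longrightarrow> v \<in> support_closure \<Longrightarrow> (\<lambda>x. u x - v x) \<in> support_closure"
  using support_closure_lincomb[of u v 1 "-1"] by simp

end

section \<open>Density of test functions\<close>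

text \<open>Derivatives on the whole space are unique, so an explicit derivative may replace
  \<open>frechet_derivative\<close> in the recursion of \<open>Ck_on\<close>.\<close>

lemma Ck_on_UNIV_SucI:
  assumes "\<And>x. (g has_derivative g' x) (at x)" and "\<And>b. b \<in> Basis \<Longrightarrow> Ck_on k UNIV (\<lambda>x. g' x b)"
  shows "Ck_on (Suc k) UNIV g"
proof -
  have "frechet_derivative g (at x) = g' x" for x
    using assms(1) frechet_derivative_at by metis
  then show ?thesis using assms by (auto simp: differentiable_def)
qed

lemma Ck_on_UNIV_SucE:
  assumes "Ck_on (Suc k) UNIV g"
  shows "(g has_derivative frechet_derivative g (at x)) (at x)"
    "b \<in> Basis \<Longrightarrow> Ck_on k UNIV (\<lambda>x. frechet_derivative g (at x) b)"
  using assms by (auto simp: frechet_derivative_works[symmetric])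

lemma Ck_on_Suc_imp: "Ck_on (Suc k) UNIV g \<Longrightarrow> Ck_on k UNIV g"
proof (induction k arbitrary: g)
  case 0
  then have "g differentiable (at x)" for x by simp
  then show ?case by (auto intro!: continuous_at_imp_continuous_on differentiable_imp_continuous_within)
next
  case (Suc k)
  from Suc.prems show ?case by (subst Ck_on.simps(2)) (use Suc.IH in auto)
qed

lemma Ck_on_const: "Ck_on k UNIV (\<lambda>x. c)"
proof (induction k arbitrary: c)
  case (Suc k)
  show ?case by (rule Ck_on_UNIV_SucI[where g'="\<lambda>x b. 0"]) (use Suc in auto)
qed simp

lemma Ck_on_add: "Ck_on k UNIV f \<Longrightarrow> Ck_on k UNIV g \<Longrightarrow> Ck_on k UNIV (\<lambda>x. f x + g x)"
proof (induction k arbitrary: f g)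
  case (Suc k)
  show ?case
    by (rule Ck_on_UNIV_SucI[OF has_derivative_add[OF Ck_on_UNIV_SucE(1)[OF Suc.prems(1)] Ck_on_UNIV_SucE(1)[OF Suc.prems(2)]]])
      (intro Suc.IH Ck_on_UNIV_SucE(2) Suc.prems)
qed (simp add: continuous_on_add)

lemma Ck_on_mult: "Ck_on k UNIV f \<Longrightarrow> Ck_on k UNIV g \<Longrightarrow> Ck_on k UNIV (\<lambda>x. f x * g x)"
proof (induction k arbitrary: f g)
  case (Suc k)
  show ?case
    by (rule Ck_on_UNIV_SucI[OF has_derivative_mult[OF Ck_on_UNIV_SucE(1)[OF Suc.prems(1)] Ck_on_UNIV_SucE(1)[OF Suc.prems(2)]]])
      (intro Suc.IH Ck_on_add Ck_on_UNIV_SucE(2) Suc.prems Ck_on_Suc_imp)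
qed (simp add: continuous_on_mult)

lemma Ck_on_sum: "(\<And>i. i \<in> I \<Longrightarrow> Ck_on k UNIV (f i)) \<Longrightarrow> Ck_on k UNIV (\<lambda>x. \<Sum>i\<in>I. f i x)"
  by (induction I rule: infinite_finite_induct) (auto intro: Ck_on_const Ck_on_add)

lemma Ck_on_power: "Ck_on k UNIV f \<Longrightarrow> Ck_on k UNIV (\<lambda>x. f x ^ n)"
  by (induction n) (auto intro: Ck_on_const Ck_on_mult)

lemma Ck_on_neg_dist_square:
  fixes a :: "'a::euclidean_space"
  shows "Ck_on k UNIV (\<lambda>x. c - (x - a) \<bullet> (x - a))"
proof (cases k)
  case 0
  then show ?thesis by (simp add: continuous_intros)
next
  case (Suc l)
  have aff: "Ck_on l UNIV (\<lambda>x. - 2 * ((x - a) \<bullet> b))" for b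
  proof (cases l)
    case 0
    then show ?thesis by (simp add: continuous_intros)
  next
    case (Suc j)
    show ?thesis unfolding Suc
      by (rule Ck_on_UNIV_SucI[where g'="\<lambda>x h. - 2 * (h \<bullet> b)"])
        (auto intro!: derivative_eq_intros Ck_on_const)
  qed
  show ?thesis unfolding Suc
  proof (rule Ck_on_UNIV_SucI)
    show "((\<lambda>x. c - (x - a) \<bullet> (x - a)) has_derivative (\<lambda>h. - 2 * ((x - a) \<bullet> h))) (at x)" for x
      by (auto intro!: derivative_eq_intros simp: inner_commute)
  qed (rule aff)
qed

section \<open>Smooth bumps and smooth approximate indicators\<close>

text \<open>The factors \<open>1 / t ^ m\<close> close the family under differentiation: every
  derivative of \<open>flat_exp 0\<close> is a linear combination of members.\<close>

definition flat_exp :: "nat \<Rightarrow> real \<Rightarrow> real" where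
  "flat_exp m t = (if 0 < t then exp (- 1 / t) / t ^ m else 0)"

lemma flat_exp_nonneg: "0 \<le> flat_exp m t"
  by (simp add: flat_exp_def)

lemma flat_exp_pos_iff: "0 < flat_exp m t \<longleftrightarrow> 0 < t"
  by (simp add: flat_exp_def)

lemma flat_exp_0_le: "flat_exp 0 t \<le> 1"
  by (simp add: flat_exp_def)

text \<open>With \<open>n = m + 2\<close>, the inequality \<open>(1 + x / n) ^ n \<le> exp x\<close>
  at \<open>x = 1 / t\<close> bounds \<open>exp (- 1 / t)\<close> by \<open>(n * t) ^ n\<close>;
  after division by \<open>t ^ m\<close> exactly a square remains. It gives derivative 0 at the
  origin.\<close>

lemma flat_exp_le_square: "flat_exp m t \<le> real (m + 2) ^ (m + 2) * t\<^sup>2"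
proof (cases "0 < t")
  case t: True
  define n where "n = m + 2"
  have n: "0 < n" by (simp add: n_def)
  have "(1 / (t * real n)) ^ n \<le> (1 + (1 / t) / real n) ^ n"
    using t n by (intro power_mono) auto
  also have "\<dots> \<le> exp (1 / t)"
    using t n by (intro exp_ge_one_plus_x_over_n_power_n) (auto intro: order_trans[of _ 0])
  finally have "inverse (exp (1 / t)) \<le> inverse ((1 / (t * real n)) ^ n)"
    using t n by (intro le_imp_inverse_le) auto
  moreover have "exp (- 1 / t) = inverse (exp (1 / t))"
    by (simp add: exp_minus[symmetric])
  moreover have "inverse ((1 / (t * real n)) ^ n) = (t * real n) ^ n"
    by (simp add: power_one_over)
  ultimately have "exp (- 1 / t) \<le> (t * real n) ^ n"
    by simp
  then have "exp (- 1 / t) / t ^ m \<le> (t * real n) ^ n / t ^ m"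
    using t by (intro divide_right_mono) auto
  also have "\<dots> = real n ^ n * t\<^sup>2"
    using t by (simp add: n_def power_mult_distrib power_add power2_eq_square)
  finally show ?thesis using t by (simp add: flat_exp_def n_def)
qed (simp add: flat_exp_def)

lemma flat_exp_DERIV:
  "(flat_exp m has_real_derivative (flat_exp (m + 2) t - real m * flat_exp (m + 1) t)) (at t)"
proof -
  consider "t > 0" | "t < 0" | "t = 0" by linarith
  then show ?thesis
  proof cases
    case 1
    have "((\<lambda>t. exp (- 1 / t) / t ^ m) has_real_derivative
        (flat_exp (m + 2) t - real m * flat_exp (m + 1) t)) (at t)"
    proof -
      have e: "((\<lambda>t. exp (- 1 / t)) has_real_derivative exp (- 1 / t) * (1 / t\<^sup>2)) (at t)"
        using 1 by (auto intro!: derivative_eq_intros simp: power2_eq_square)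
      have "(exp (- 1 / t) * (1 / t\<^sup>2) * t ^ m - exp (- 1 / t) * (real m * t ^ (m - Suc 0))) / (t ^ m * t ^ m) =
          flat_exp (m + 2) t - real m * flat_exp (m + 1) t"
        using 1 by (cases m) (auto simp: flat_exp_def field_simps power_add power2_eq_square)
      with DERIV_divide[OF e DERIV_pow[of m t]] 1 show ?thesis by simp
    qed
    then show ?thesis
      by (rule has_field_derivative_transform_within_open[of _ _ _ "{0<..}"]) (use 1 in \<open>auto simp: flat_exp_def\<close>)
  next
    case 2
    have "((\<lambda>t. 0) has_real_derivative 0) (at t)" by simp
    then have "(flat_exp m has_real_derivative 0) (at t)"
      by (rule has_field_derivative_transform_within_open[of _ _ _ "{..<0}"]) (use 2 in \<open>auto simp: flat_exp_def\<close>)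
    then show ?thesis using 2 by (simp add: flat_exp_def)
  next
    case 3
    have "((\<lambda>h. (flat_exp m (0 + h) - flat_exp m 0) / h) \<longlongrightarrow> 0) (at 0)"
    proof (rule Lim_null_comparison)
      show "\<forall>\<^sub>F h in at 0. norm ((flat_exp m (0 + h) - flat_exp m 0) / h) \<le> real (m + 2) ^ (m + 2) * \<bar>h\<bar>"
        unfolding eventually_at_filter
      proof (intro always_eventually allI impI)
        fix h :: real assume "h \<noteq> 0"
        have "\<bar>flat_exp m h\<bar> / \<bar>h\<bar> \<le> real (m + 2) ^ (m + 2) * h\<^sup>2 / \<bar>h\<bar>"
          using flat_exp_le_square[of m h] flat_exp_nonneg[of m h] by (intro divide_right_mono) auto
        also have "\<dots> = real (m + 2) ^ (m + 2) * \<bar>h\<bar>"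
          using \<open>h \<noteq> 0\<close> by (simp add: power2_eq_square abs_if)
        finally show "norm ((flat_exp m (0 + h) - flat_exp m 0) / h) \<le> real (m + 2) ^ (m + 2) * \<bar>h\<bar>"
          by (simp add: flat_exp_def[of m 0] abs_divide)
      qed
      show "((\<lambda>h. real (m + 2) ^ (m + 2) * \<bar>h\<bar>) \<longlongrightarrow> 0) (at (0::real))"
        by (auto intro!: tendsto_eq_intros)
    qed
    then have "(flat_exp m has_real_derivative 0) (at 0)" by (simp only: DERIV_def)
    then show ?thesis using 3 by (simp add: flat_exp_def[of _ 0])
  qed
qed

text \<open>The induction on \<open>k\<close> must cover all \<open>m\<close> at once, since one
  differentiation raises \<open>m\<close> by 1 and by 2.\<close>

lemma Ck_on_flat_exp_compose:
  assumes q: "\<And>k. Ck_on k UNIV q"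
  shows "Ck_on k UNIV (\<lambda>x. flat_exp m (q x))"
proof (induction k arbitrary: m)
  case 0
  have "continuous_on UNIV (flat_exp m)"
    using flat_exp_DERIV by (intro continuous_at_imp_continuous_on) (auto intro: DERIV_isCont)
  then show ?case using q[of 0] by (auto intro: continuous_on_compose2)
next
  case (Suc k)
  show ?case
  proof (rule Ck_on_UNIV_SucI)
    show "((\<lambda>x. flat_exp m (q x)) has_derivative
        (\<lambda>h. (flat_exp (m + 2) (q x) + (- real m) * flat_exp (m + 1) (q x)) * frechet_derivative q (at x) h)) (at x)" for x
      using has_derivative_compose[OF Ck_on_UNIV_SucE(1)[OF q] flat_exp_DERIV[unfolded has_field_derivative_def]]
      by simp
    show "Ck_on k UNIV (\<lambda>x. (flat_exp (m + 2) (q x) + (- real m) * flat_exp (m + 1) (q x)) * frechet_derivative q (at x) b)"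
      if "b \<in> Basis" for b
      by (intro Ck_on_mult Ck_on_add Ck_on_const Suc Ck_on_UNIV_SucE(2)[OF q that])
  qed
qed

text \<open>Bumps over a finite cover of \<open>K\<close> add up to a smooth \<open>q\<close> with
  values in [0,1] that is positive on \<open>K\<close>, hence at least a positive minimum there.
  Powers of \<open>1 - q\<close> then tend to zero uniformly on \<open>K\<close>, while
  \<open>1 - (1 - q) ^ n\<close> vanishes wherever \<open>q\<close> does.\<close>

lemma smooth_approx_indicator:
  fixes K :: "'a::euclidean_space set"
  assumes K: "compact K" and U: "open U" "K \<subseteq> U" and e: "e > 0"
  obtains \<phi> where "smooth_on UNIV \<phi>" "compact (closure {x. \<phi> x \<noteq> 0})" "closure {x. \<phi> x \<noteq> 0} \<subseteq> U"
    "\<And>x. 0 \<le> \<phi> x" "\<And>x. \<phi> x \<le> 1" "\<And>x. x \<in> K \<Longrightarrow> 1 - e \<le> \<phi> x"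
proof (cases "K = {}")
  case True
  show ?thesis
    by (rule that[of "\<lambda>x. 0"]) (use True in \<open>auto simp: smooth_on_def Ck_on_const\<close>)
next
  case False
  have "\<forall>x\<in>K. \<exists>r>0. cball x r \<subseteq> U"
    using U by (meson open_contains_cball subsetD)
  then obtain r where r: "\<And>x. x \<in> K \<Longrightarrow> r x > 0" "\<And>x. x \<in> K \<Longrightarrow> cball x (r x) \<subseteq> U" by metis
  have "K \<subseteq> (\<Union>x\<in>K. ball x (r x))" using r(1) by force
  then obtain D where D: "D \<subseteq> K" "finite D" "K \<subseteq> (\<Union>x\<in>D. ball x (r x))"
    by (rule compactE_image[OF K, of K "\<lambda>x. ball x (r x)", rotated]) auto
  have D0: "card D > 0" using D False by (auto simp: card_gt_0_iff)
  define p where "p x = (\<Sum>a\<in>D. flat_exp 0 ((r a)\<^sup>2 - (x - a) \<bullet> (x - a)))" for x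
  define q where "q x = (1 / card D) * p x" for x
  have term_pos: "0 < flat_exp 0 ((r a)\<^sup>2 - (x - a) \<bullet> (x - a)) \<longleftrightarrow> x \<in> ball a (r a)" if "a \<in> D" for a x
  proof -
    have "(x - a) \<bullet> (x - a) < (r a)\<^sup>2 \<longleftrightarrow> norm (x - a) < r a"
      using r(1)[of a] that D(1) power_less_imp_less_base[of "norm (x - a)" 2 "r a"]
        power_strict_mono[of "norm (x - a)" "r a" 2] by (auto simp: dot_square_norm)
    then show ?thesis by (simp add: flat_exp_pos_iff dist_norm norm_minus_commute)
  qed
  have p_le: "p x \<le> card D" for x
    unfolding p_def using sum_bounded_above[of D "\<lambda>a. flat_exp 0 ((r a)\<^sup>2 - (x - a) \<bullet> (x - a))" 1] flat_exp_0_le by simp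
  have p_nn: "0 \<le> p x" for x
    unfolding p_def by (intro sum_nonneg flat_exp_nonneg)
  have q01: "0 \<le> q x" "q x \<le> 1" for x
    using p_nn p_le D0 by (auto simp: q_def divide_le_eq)
  have q_pos: "0 < q x" if x: "x \<in> K" for x
  proof -
    obtain a where a: "a \<in> D" "x \<in> ball a (r a)" using D(3) x by blast
    have "0 < p x"
      unfolding p_def using D(2) a term_pos by (intro sum_pos2[of _ a]) (auto intro: flat_exp_nonneg)
    then show ?thesis using D0 by (simp add: q_def)
  qed
  have q_Ck: "Ck_on k UNIV q" for k
    unfolding q_def[abs_def] p_def
    by (intro Ck_on_mult Ck_on_const Ck_on_sum Ck_on_flat_exp_compose Ck_on_neg_dist_square)
  have "continuous_on K q"
    using q_Ck[of 0] continuous_on_subset by fastforce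
  then obtain x0 where x0: "x0 \<in> K" "\<And>x. x \<in> K \<Longrightarrow> q x0 \<le> q x"
    using continuous_attains_inf[OF K False] by blast
  have "(\<lambda>n. (1 - q x0) ^ n) \<longlonglongrightarrow> 0"
    using q_pos[OF x0(1)] q01[of x0] by (intro LIMSEQ_power_zero) auto
  then obtain n where n: "(1 - q x0) ^ n < e"
    using e by (metis eventually_happens' order_tendstoD(2) sequentially_bot)
  \<comment> \<open>Written with sums, products and powers only, to match the closure properties of
    \<open>Ck_on\<close>.\<close>
  define \<phi> where "\<phi> x = 1 + (-1) * (1 + (-1) * q x) ^ n" for x
  have supp: "{x. \<phi> x \<noteq> 0} \<subseteq> (\<Union>a\<in>D. cball a (r a))"
  proof safe
    fix x assume "\<phi> x \<noteq> 0"
    then have "p x \<noteq> 0" by (auto simp: \<phi>_def q_def)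
    then obtain a where "a \<in> D" "flat_exp 0 ((r a)\<^sup>2 - (x - a) \<bullet> (x - a)) \<noteq> 0"
      unfolding p_def by (meson sum.neutral)
    then show "x \<in> (\<Union>a\<in>D. cball a (r a))"
      using term_pos[of a x] flat_exp_nonneg[of 0] by (metis UN_iff ball_subset_cball less_eq_real_def subsetD)
  qed
  have cpt: "compact (\<Union>a\<in>D. cball a (r a))" using D(2) by (intro compact_UN) auto
  have cl: "closure {x. \<phi> x \<noteq> 0} \<subseteq> (\<Union>a\<in>D. cball a (r a))"
    using supp compact_imp_closed[OF cpt] by (rule closure_minimal)
  show ?thesis
  proof (rule that)
    show "smooth_on UNIV \<phi>"
      unfolding smooth_on_def \<phi>_def[abs_def]
      by (intro allI Ck_on_add Ck_on_mult Ck_on_power Ck_on_const q_Ck)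
    show "compact (closure {x. \<phi> x \<noteq> 0})"
      using cl cpt by (meson bounded_subset closed_closure compact_eq_bounded_closed)
    show "closure {x. \<phi> x \<noteq> 0} \<subseteq> U" using cl r(2) D(1) by blast
    show "0 \<le> \<phi> x" for x using q01[of x] by (simp add: \<phi>_def power_le_one)
    show "\<phi> x \<le> 1" for x using q01[of x] by (simp add: \<phi>_def)
    show "1 - e \<le> \<phi> x" if "x \<in> K" for x
    proof -
      have "(1 - q x) ^ n \<le> (1 - q x0) ^ n" using x0(2)[OF that] q01[of x] by (intro power_mono) auto
      then show ?thesis using n by (simp add: \<phi>_def)
    qed
  qed
qed

text \<open>Regularity of Lebesgue measure gives compact \<open>K n\<close> inside and open
  \<open>U n\<close> around \<open>A\<close> with summable gaps. By Borel-Cantelli almost every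
  point lies in finitely many gaps only, and outside the gap \<open>\<phi> n\<close> is within
  \<open>(1/2) ^ n\<close> of the indicator.\<close>

lemma test_functions_approx_indicator:
  assumes A: "A \<in> sets lebesgue" "A \<subseteq> \<Omega>" "bounded A" and \<Omega>: "open \<Omega>"
  obtains \<phi> :: "nat \<Rightarrow> real^2 \<Rightarrow> real" and R where "\<And>n. \<phi> n \<in> test_functions \<Omega>"
    "\<And>n x. 0 \<le> \<phi> n x" "\<And>n x. \<phi> n x \<le> 1" "\<And>n x. R < norm x \<Longrightarrow> \<phi> n x = 0"
    "AE x in lebesgue. (\<lambda>n. \<phi> n x) \<longlonglongrightarrow> indicator A x"
proof -
  obtain R where R: "A \<subseteq> ball 0 R" using A(3) bounded_subset_ballD by blast
  have "\<exists>K U. compact K \<and> K \<subseteq> A \<and> open U \<and> A \<subseteq> U \<and> U \<subseteq> \<Omega> \<inter> ball 0 R \<and>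
      U - K \<in> lmeasurable \<and> measure lebesgue (U - K) \<le> 2 * (1/2) ^ n" for n :: nat
  proof -
    obtain K where K: "closed K" "K \<subseteq> A" "A - K \<in> lmeasurable" "emeasure lebesgue (A - K) < ennreal ((1/2) ^ n)"
      using sets_lebesgue_inner_closed[OF A(1), of "(1/2)^n"] by auto
    obtain V where V: "open V" "A \<subseteq> V" "V - A \<in> lmeasurable" "emeasure lebesgue (V - A) < ennreal ((1/2) ^ n)"
      using sets_lebesgue_outer_open[OF A(1), of "(1/2)^n"] by auto
    \<comment> \<open>Intersecting with the domain keeps the supports inside it; intersecting with
      the ball gives one radius valid for all \<open>n\<close>.\<close>
    define U where "U = V \<inter> (\<Omega> \<inter> ball 0 R)"
    have cK: "compact K" using K A(3) bounded_subset compact_eq_bounded_closed by blast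
    have U: "open U" "A \<subseteq> U" "U \<subseteq> \<Omega> \<inter> ball 0 R"
      using V \<Omega> A(2) R by (auto simp: U_def)
    have UK: "U - K \<subseteq> (V - A) \<union> (A - K)" by (auto simp: U_def)
    have UKs: "U - K \<in> sets lebesgue" using U(1) K(1) by (intro sets.Diff) auto
    have un: "(V - A) \<union> (A - K) \<in> lmeasurable" using V(3) K(3) by (rule fmeasurable.Un)
    then have UKl: "U - K \<in> lmeasurable" using UK UKs by (rule fmeasurableI2)
    have "measure lebesgue (U - K) \<le> measure lebesgue ((V - A) \<union> (A - K))"
      using UK un UKs by (intro measure_mono_fmeasurable) auto
    also have "\<dots> \<le> measure lebesgue (V - A) + measure lebesgue (A - K)"
      using V(3) K(3) by (intro measure_Un_le) auto
    also have "\<dots> \<le> (1/2)^n + (1/2)^n"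
      using V(3,4) K(3,4) by (intro add_mono) (auto simp: emeasure_eq_measure2 ennreal_less_iff intro: less_imp_le)
    finally show ?thesis using cK K(2) U UKl by (intro exI[of _ K] exI[of _ U]) auto
  qed
  then obtain K U where KU: "\<And>n. compact (K n)" "\<And>n. K n \<subseteq> A" "\<And>n. open (U n)" "\<And>n. A \<subseteq> U n"
     "\<And>n. U n \<subseteq> \<Omega> \<inter> ball 0 R" "\<And>n. U n - K n \<in> lmeasurable" "\<And>n::nat. measure lebesgue (U n - K n) \<le> 2 * (1/2) ^ n"
    by metis
  have "\<exists>\<phi>. smooth_on UNIV \<phi> \<and> compact (closure {x. \<phi> x \<noteq> 0}) \<and> closure {x. \<phi> x \<noteq> 0} \<subseteq> U n \<and>
     (\<forall>x. 0 \<le> \<phi> x \<and> \<phi> x \<le> 1) \<and> (\<forall>x\<in>K n. 1 - (1/2)^n \<le> \<phi> x)" for n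
  proof (rule smooth_approx_indicator[OF KU(1) KU(3), of n n "(1/2)^n"])
    show "K n \<subseteq> U n" using KU(2,4) by blast
  qed (simp, blast)
  then obtain \<phi> where \<phi>: "\<And>n. smooth_on UNIV (\<phi> n)" "\<And>n. compact (closure {x. \<phi> n x \<noteq> 0})"
    "\<And>n. closure {x. \<phi> n x \<noteq> 0} \<subseteq> U n" "\<And>n x. 0 \<le> \<phi> n x" "\<And>n x. \<phi> n x \<le> 1"
    "\<And>n x. x \<in> K n \<Longrightarrow> 1 - (1/2)^n \<le> \<phi> n x"
    by metis
  have outside: "\<phi> n x = 0" if "x \<notin> U n" for n x
    using \<phi>(3)[of n] closure_subset[of "{x. \<phi> n x \<noteq> 0}"] that by blast
  have "AE x in lebesgue. \<forall>\<^sub>F n in sequentially. x \<in> space lebesgue - (U n - K n)"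
  proof (rule borel_cantelli_AE1)
    show "summable (\<lambda>n. measure lebesgue (U n - K n))"
      by (rule summable_comparison_test[of _ "\<lambda>n. 2 * (1/2::real) ^ n"])
        (use KU(7) in \<open>auto intro!: summable_mult summable_geometric exI[of _ 0]\<close>)
    show "U n - K n \<in> sets lebesgue" "emeasure lebesgue (U n - K n) < \<infinity>" for n
      using KU(6)[of n] unfolding fmeasurable_def by blast+
  qed
  then have lim: "AE x in lebesgue. (\<lambda>n. \<phi> n x) \<longlonglongrightarrow> indicator A x"
  proof eventually_elim
    case (elim x)
    show ?case
    proof (cases "x \<in> A")
      case True
      have ev: "\<forall>\<^sub>F n in sequentially. 1 - (1/2)^n \<le> \<phi> n x"
        using elim by eventually_elim (use True KU(4) \<phi>(6) in auto)
      have "(\<lambda>n. 1 - (1/2::real)^n) \<longlonglongrightarrow> 1 - 0"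
        by (intro tendsto_diff tendsto_const LIMSEQ_power_zero) auto
      then have "(\<lambda>n. 1 - (1/2::real)^n) \<longlonglongrightarrow> 1" by simp
      from tendsto_sandwich[OF ev _ this tendsto_const] have "(\<lambda>n. \<phi> n x) \<longlonglongrightarrow> 1"
        using \<phi>(5) by simp
      then show ?thesis using True by simp
    next
      case False
      have "\<forall>\<^sub>F n in sequentially. \<phi> n x = 0"
        using elim by eventually_elim (use False KU(2) outside in auto)
      then show ?thesis using False by (simp add: tendsto_eventually)
    qed
  qed
  show ?thesis
  proof (rule that[of \<phi> R])
    show "\<phi> n \<in> test_functions \<Omega>" for n
      using \<phi>(1,2,3) KU(5) unfolding test_functions_def by blast
    show "\<phi> n x = 0" if "R < norm x" for n x
      by (rule outside) (use KU(5)[of n] that in auto)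
  qed (use \<phi> lim in auto)
qed

lemma smooth_on_UNIV_derivative:
  assumes "smooth_on UNIV \<phi>"
  shows "continuous_on UNIV \<phi>" "\<And>x. (\<phi> has_derivative frechet_derivative \<phi> (at x)) (at x)"
    "\<And>b. b \<in> Basis \<Longrightarrow> continuous_on UNIV (\<lambda>x. frechet_derivative \<phi> (at x) b)"
proof -
  have 0: "Ck_on 0 UNIV \<phi>" and 1: "Ck_on (Suc 0) UNIV \<phi>"
    using assms by (auto simp: smooth_on_def simp del: Ck_on.simps)
  show "continuous_on UNIV \<phi>" using 0 by simp
  show "(\<phi> has_derivative frechet_derivative \<phi> (at x)) (at x)" for x
    using Ck_on_UNIV_SucE(1)[OF 1] .
  show "continuous_on UNIV (\<lambda>x. frechet_derivative \<phi> (at x) b)" if "b \<in> Basis" for b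
    using Ck_on_UNIV_SucE(2)[OF 1 that] by simp
qed

lemma continuous_compact_support_bounds:
  fixes g :: "'a::euclidean_space \<Rightarrow> real"
  assumes "continuous_on UNIV g" "compact K" "\<And>x. x \<notin> K \<Longrightarrow> g x = 0"
  obtains C R where "\<And>x. \<bar>g x\<bar> \<le> C" "\<And>x. R < norm x \<Longrightarrow> g x = 0"
proof -
  obtain R where R: "\<And>x. x \<in> K \<Longrightarrow> norm x \<le> R"
    using compact_imp_bounded[OF assms(2)] by (auto simp: bounded_iff)
  have "compact (g ` K)"
    by (rule compact_continuous_image[OF continuous_on_subset[OF assms(1)] assms(2)]) simp
  then obtain C where C: "\<And>x. x \<in> K \<Longrightarrow> norm (g x) \<le> C"
    using compact_imp_bounded[of "g ` K"] by (auto simp: bounded_iff)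
  show ?thesis
  proof (rule that[of "max C 0" R])
    show "\<bar>g x\<bar> \<le> max C 0" for x using C[of x] assms(3)[of x] by (cases "x \<in> K") auto
    show "g x = 0" if "R < norm x" for x using R[of x] assms(3)[of x] that by (cases "x \<in> K") auto
  qed
qed

lemma test_function_bounded:
  assumes \<phi>: "\<phi> \<in> test_functions \<Omega>"
  obtains C R where "\<And>x. \<bar>\<phi> x\<bar> \<le> C" "\<And>x. R < norm x \<Longrightarrow> \<phi> x = 0"
proof (rule continuous_compact_support_bounds)
  show "continuous_on UNIV \<phi>"
    using \<phi> by (intro smooth_on_UNIV_derivative(1)) (simp add: test_functions_def)
  show "compact (closure {x. \<phi> x \<noteq> 0})" using \<phi> by (simp add: test_functions_def)
  show "\<phi> x = 0" if "x \<notin> closure {x. \<phi> x \<noteq> 0}" for x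
    using that closure_subset[of "{x. \<phi> x \<noteq> 0}"] by auto
qed (rule that)

lemma test_functions_lincomb:
  assumes "\<phi> \<in> test_functions \<Omega>" "\<psi> \<in> test_functions \<Omega>"
  shows "(\<lambda>x. a * \<phi> x + b * \<psi> x) \<in> test_functions \<Omega>"
proof -
  let ?K = "closure {x. \<phi> x \<noteq> 0} \<union> closure {x. \<psi> x \<noteq> 0}"
  have K: "compact ?K" "?K \<subseteq> \<Omega>" using assms by (auto simp: test_functions_def)
  have "{x. a * \<phi> x + b * \<psi> x \<noteq> 0} \<subseteq> {x. \<phi> x \<noteq> 0} \<union> {x. \<psi> x \<noteq> 0}"
    by auto
  then have "{x. a * \<phi> x + b * \<psi> x \<noteq> 0} \<subseteq> ?K"
    using closure_subset[of "{x. \<phi> x \<noteq> 0}"] closure_subset[of "{x. \<psi> x \<noteq> 0}"] by blast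
  then have cl: "closure {x. a * \<phi> x + b * \<psi> x \<noteq> 0} \<subseteq> ?K"
    using compact_imp_closed[OF K(1)] by (rule closure_minimal)
  have "smooth_on UNIV (\<lambda>x. a * \<phi> x + b * \<psi> x)"
    using assms unfolding smooth_on_def test_functions_def
    by (auto intro!: Ck_on_add Ck_on_mult Ck_on_const simp del: Ck_on.simps)
  moreover have "compact (closure {x. a * \<phi> x + b * \<psi> x \<noteq> 0})"
    using cl K(1) by (meson bounded_subset closed_closure compact_eq_bounded_closed)
  ultimately show ?thesis using cl K(2) unfolding test_functions_def by blast
qed

locale open_domain = lebesgue_domain +
  assumes open_domain: "open \<Omega>"
begin

lemma test_function_bounded_support:
  assumes "\<phi> \<in> test_functions \<Omega>"
  shows "\<phi> \<in> bounded_support"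
proof -
  have "smooth_on UNIV \<phi>" using assms by (simp add: test_functions_def)
  then have "\<phi> \<in> borel_measurable M"
    by (intro restrict_lborel_measurable borel_measurable_continuous_onI smooth_on_UNIV_derivative(1))
  moreover obtain C R where "\<And>x. \<bar>\<phi> x\<bar> \<le> C" "\<And>x. R < norm x \<Longrightarrow> \<phi> x = 0"
    using test_function_bounded[OF assms] by blast
  ultimately show ?thesis unfolding bounded_support_def by blast
qed

lemma bounded_support_measurable: "w \<in> bounded_support \<Longrightarrow> w \<in> borel_measurable M"
  by (simp add: bounded_support_def)

lemma AE_lebesgue_on: "AE x in lebesgue. P x \<Longrightarrow> AE x in M. P x"
  using domain_sets by (subst AE_restrict_space_iff) (auto elim!: eventually_mono)

text \<open>The induction principle reduces the claim to indicators; there, as in the limit case,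
  bounded convergence with common support is norm convergence.\<close>

lemma test_functions_dense_bounded_support:
  assumes "w \<in> bounded_support" "\<epsilon> > 0"
  shows "\<exists>\<phi>\<in>test_functions \<Omega>. N (\<lambda>x. w x - \<phi> x) < \<epsilon>"
  using assms
proof (induction arbitrary: \<epsilon> rule: bounded_support_induct)
  case (indicator A)
  obtain \<phi> R where \<phi>: "\<And>n. \<phi> n \<in> test_functions \<Omega>" "\<And>n x. 0 \<le> \<phi> n x" "\<And>n x. \<phi> n x \<le> 1"
    "\<And>n x. R < norm x \<Longrightarrow> \<phi> n x = 0" "AE x in lebesgue. (\<lambda>n. \<phi> n x) \<longlonglongrightarrow> (indicator A x :: real)"
    using test_functions_approx_indicator[OF indicator(1-3) open_domain] by blast
  obtain R' where R': "\<And>x. x \<in> A \<Longrightarrow> norm x \<le> R'" using indicator(3) by (auto simp: bounded_iff)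
  have "\<forall>\<^sub>F n in sequentially. \<epsilon> / 2 \<in> modular (\<lambda>x. indicator A x - \<phi> n x)"
  proof (rule eventually_modular)
    show "(\<lambda>x. indicator A x - \<phi> n x) \<in> borel_measurable M" for n
      using test_function_bounded_support[OF \<phi>(1)] indicator_measurable[OF indicator(1)]
      by (intro borel_measurable_diff) (auto simp: bounded_support_def)
    show "AE x in M. \<bar>indicator A x - \<phi> n x\<bar> \<le> 1 \<and>
        (max R R' < norm x \<longrightarrow> indicator A x - \<phi> n x = 0)" for n
    proof (rule AE_I2)
      fix x
      have "\<bar>indicator A x - \<phi> n x\<bar> \<le> 1" using \<phi>(2,3)[of n x] by (auto simp: indicator_def)
      moreover have "indicator A x - \<phi> n x = 0" if "max R R' < norm x"
        using that R'[of x] \<phi>(4)[of x n] by (auto simp: indicator_def)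
      ultimately show "\<bar>indicator A x - \<phi> n x\<bar> \<le> 1 \<and> (max R R' < norm x \<longrightarrow> indicator A x - \<phi> n x = 0)"
        by blast
    qed
    show "AE x in M. (\<lambda>n. indicator A x - \<phi> n x) \<longlonglongrightarrow> 0"
      using AE_lebesgue_on[OF \<phi>(5)]
    proof eventually_elim
      case (elim x)
      from tendsto_diff[OF tendsto_const elim, of "indicator A x"] show ?case by simp
    qed
  qed (use indicator in auto)
  then obtain n where "\<epsilon> / 2 \<in> modular (\<lambda>x. indicator A x - \<phi> n x)"
    using eventually_happens'[OF sequentially_bot] by blast
  then have "N (\<lambda>x. indicator A x - \<phi> n x) < \<epsilon>" using N_le indicator(4) by fastforce
  then show ?case using \<phi>(1) by blast
next
  case (lincomb u v a b)
  define d where "d = \<epsilon> / (\<bar>a\<bar> + \<bar>b\<bar> + 1)"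
  have d: "d > 0" using lincomb(5) by (simp add: d_def add_nonneg_pos)
  obtain \<phi> \<psi> where \<phi>: "\<phi> \<in> test_functions \<Omega>" "N (\<lambda>x. u x - \<phi> x) < d"
    and \<psi>: "\<psi> \<in> test_functions \<Omega>" "N (\<lambda>x. v x - \<psi> x) < d"
    using lincomb(3,4) d by meson
  have "N (\<lambda>x. (a * u x + b * v x) - (a * \<phi> x + b * \<psi> x)) =
      N (\<lambda>x. a * (u x - \<phi> x) + b * (v x - \<psi> x))" by (simp add: algebra_simps)
  also have "\<dots> \<le> \<bar>a\<bar> * N (\<lambda>x. u x - \<phi> x) + \<bar>b\<bar> * N (\<lambda>x. v x - \<psi> x)"
    using lincomb(1,2) \<phi>(1) \<psi>(1) bounded_support_L test_function_bounded_support
    by (intro N_lincomb_le L_diff) auto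
  also have "\<dots> \<le> \<bar>a\<bar> * d + \<bar>b\<bar> * d"
    using \<phi> \<psi> by (intro add_mono mult_left_mono) auto
  also have "\<dots> < \<epsilon>"
  proof -
    have "(\<bar>a\<bar> + \<bar>b\<bar> + 1) * d = \<epsilon>" by (simp add: d_def add_nonneg_pos order.strict_implies_not_eq[symmetric])
    then have "\<bar>a\<bar> * d + \<bar>b\<bar> * d + d = \<epsilon>" by (simp add: distrib_right)
    then show ?thesis using d by linarith
  qed
  finally show ?case
    by (rule bexI[OF _ test_functions_lincomb[OF \<phi>(1) \<psi>(1)]])
next
  case (limit u U C R)
  obtain C' R' where u: "AE x in M. \<bar>u x\<bar> \<le> C' \<and> (R' < norm x \<longrightarrow> u x = 0)"
    using limit.hyps(1) by (auto simp: bounded_support_def)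
  have "\<forall>\<^sub>F n in sequentially. \<epsilon> / 2 \<in> modular (\<lambda>x. u x - U n x)"
  proof (rule eventually_modular)
    show "(\<lambda>x. u x - U n x) \<in> borel_measurable M" for n
      by (intro borel_measurable_diff bounded_support_measurable limit.hyps(1,2))
    show "AE x in M. \<bar>u x - U n x\<bar> \<le> C' + C \<and> (max R R' < norm x \<longrightarrow> u x - U n x = 0)" for n
      using u limit.hyps(3)[of n] by eventually_elim auto
    show "AE x in M. (\<lambda>n. u x - U n x) \<longlonglongrightarrow> 0"
      using limit.hyps(4)
    proof eventually_elim
      case (elim x)
      from tendsto_diff[OF tendsto_const elim, of "u x"] show ?case by simp
    qed
  qed (use limit.prems in auto)
  then obtain n where "\<epsilon> / 2 \<in> modular (\<lambda>x. u x - U n x)"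
    using eventually_happens'[OF sequentially_bot] by blast
  then have n: "N (\<lambda>x. u x - U n x) \<le> \<epsilon> / 2" by (rule N_le)
  obtain \<phi> where \<phi>: "\<phi> \<in> test_functions \<Omega>" "N (\<lambda>x. U n x - \<phi> x) < \<epsilon> / 2"
    using limit.IH[of "\<epsilon> / 2" n] limit.prems by auto
  have "N (\<lambda>x. u x - \<phi> x) \<le> N (\<lambda>x. u x - U n x) + N (\<lambda>x. U n x - \<phi> x)"
    using bounded_support_L[OF limit.hyps(1)] bounded_support_L[OF limit.hyps(2)]
      bounded_support_L[OF test_function_bounded_support[OF \<phi>(1)]]
    by (rule N_diff_triangle)
  also have "\<dots> < \<epsilon>" using n \<phi>(2) by linarith
  finally show ?case by (rule bexI[OF _ \<phi>(1)])
qed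

lemma support_closureD:
  "u \<in> support_closure \<Longrightarrow> \<epsilon> > 0 \<Longrightarrow> \<exists>w\<in>bounded_support. N (\<lambda>x. u x - w x) < \<epsilon>"
  by (simp add: support_closure_def)

lemma test_functions_dense:
  assumes "u \<in> support_closure" "\<epsilon> > 0"
  shows "\<exists>\<phi>\<in>test_functions \<Omega>. N (\<lambda>x. u x - \<phi> x) < \<epsilon>"
proof -
  obtain w where w: "w \<in> bounded_support" "N (\<lambda>x. u x - w x) < \<epsilon> / 2"
    using support_closureD[OF assms(1) half_gt_zero[OF assms(2)]] by blast
  obtain \<phi> where \<phi>: "\<phi> \<in> test_functions \<Omega>" "N (\<lambda>x. w x - \<phi> x) < \<epsilon> / 2"
    using test_functions_dense_bounded_support[OF w(1), of "\<epsilon> / 2"] assms(2) by auto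
  have "N (\<lambda>x. u x - \<phi> x) \<le> N (\<lambda>x. u x - w x) + N (\<lambda>x. w x - \<phi> x)"
    using support_closure_L[OF assms(1)] bounded_support_L[OF w(1)]
      bounded_support_L[OF test_function_bounded_support[OF \<phi>(1)]]
    by (rule N_diff_triangle)
  also have "\<dots> < \<epsilon>" using w(2) \<phi>(2) by linarith
  finally show ?thesis by (rule bexI[OF _ \<phi>(1)])
qed

text \<open>The plane has infinite measure, and density of test functions gives the inclusion that
  is not immediate. On a bounded domain every essentially bounded function has bounded
  support.\<close>

lemma E_space_eq_support_closure:
  assumes "bounded \<Omega> \<or> \<Omega> = UNIV"
  shows "E_space Phi \<Omega> = support_closure"
proof (cases "\<Omega> = UNIV")
  case True
  then have "\<not> emeasure lebesgue \<Omega> < \<infinity>" by (simp add: emeasure_lborel_UNIV)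
  then have E: "E_space Phi \<Omega> = {u \<in> L. \<forall>\<epsilon>>0. \<exists>w\<in>test_functions \<Omega>. N (\<lambda>x. u x - w x) < \<epsilon>}"
    by (simp add: E_space_def)
  show ?thesis
  proof (intro set_eqI iffI)
    fix u assume "u \<in> E_space Phi \<Omega>"
    then have u: "u \<in> L" "\<forall>\<epsilon>>0. \<exists>w\<in>test_functions \<Omega>. N (\<lambda>x. u x - w x) < \<epsilon>"
      unfolding E by simp_all
    show "u \<in> support_closure"
      unfolding support_closure_def
    proof (intro CollectI conjI allI impI)
      fix \<epsilon> :: real assume "\<epsilon> > 0"
      then obtain w where w: "w \<in> test_functions \<Omega>" "N (\<lambda>x. u x - w x) < \<epsilon>" using u(2) by blast
      then show "\<exists>w\<in>bounded_support. N (\<lambda>x. u x - w x) < \<epsilon>"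
        by (intro bexI[of _ w] test_function_bounded_support)
    qed (rule u)
  next
    fix u assume "u \<in> support_closure"
    then show "u \<in> E_space Phi \<Omega>"
      unfolding E using test_functions_dense[of u] support_closure_L[of u] by simp
  qed
next
  case False
  then have b: "bounded \<Omega>" using assms by blast
  then have "emeasure lebesgue \<Omega> < \<infinity>"
    using bounded_set_imp_lmeasurable[OF b domain_sets] unfolding fmeasurable_def by blast
  then have E: "E_space Phi \<Omega> = {u \<in> L. \<forall>\<epsilon>>0. \<exists>w\<in>L_infinity \<Omega>. N (\<lambda>x. u x - w x) < \<epsilon>}"
    by (simp add: E_space_def)
  obtain R where R: "\<And>x. x \<in> \<Omega> \<Longrightarrow> norm x \<le> R" using b by (auto simp: bounded_iff)
  have "L_infinity \<Omega> = bounded_support"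
  proof safe
    fix w assume "w \<in> L_infinity \<Omega>"
    then obtain C where w: "w \<in> borel_measurable M" "AE x in M. \<bar>w x\<bar> \<le> C"
      by (auto simp: L_infinity_def)
    have "AE x in M. \<bar>w x\<bar> \<le> C \<and> (R < norm x \<longrightarrow> w x = 0)"
      using w(2) AE_space[of M] by eventually_elim (use R in force)
    then show "w \<in> bounded_support" using w(1) unfolding bounded_support_def by blast
  next
    fix w assume "w \<in> bounded_support"
    then obtain C R where w: "w \<in> borel_measurable M"
      "AE x in M. \<bar>w x\<bar> \<le> C \<and> (R < norm x \<longrightarrow> w x = 0)"
      by (auto simp: bounded_support_def)
    have "AE x in M. \<bar>w x\<bar> \<le> C" using w(2) by eventually_elim auto
    then show "w \<in> L_infinity \<Omega>" using w(1) unfolding L_infinity_def by blast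
  qed
  then show ?thesis unfolding E support_closure_def by simp
qed

end

section \<open>Integrability and local Lipschitz continuity of the functional\<close>

text \<open>Write \<open>a\<close> as \<open>(a - u x) + (u x - w x) + w x\<close> with
  \<open>w\<close> bounded and near \<open>u\<close>. Squaring three terms costs a factor 3;
  estimating the product of two exponentials by squares costs a factor 2. The null set does not
  depend on \<open>a\<close>, so whole sequences of functions may be inserted for it.\<close>

lemma (in lebesgue_domain) exp_square_bound:
  assumes u: "u \<in> support_closure" and \<gamma>: "\<gamma> > 0"
  obtains \<delta> K V where "\<delta> > 0" "0 \<le> K" "V \<in> borel_measurable M" "\<And>x. 0 \<le> V x"
    "(\<integral>\<^sup>+x. ennreal (V x) \<partial>M) \<le> 1"
    "AE x in M. \<forall>a. exp (\<gamma> * a\<^sup>2) \<le> K * (1 + Phi ((a - u x) / \<delta>) + V x)"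
proof -
  \<comment> \<open>The scale at which \<open>1 + Phi (p / \<delta>)\<close> equals
    \<open>exp (6 * \<gamma> * p^2)\<close>, where 6 combines the losses 3 and 2.\<close>
  define \<delta> where "\<delta> = 1 / sqrt (6 * \<gamma>)"
  have \<delta>: "\<delta> > 0" using \<gamma> by (simp add: \<delta>_def)
  have sq: "(p / \<delta>)\<^sup>2 = 6 * \<gamma> * p\<^sup>2" for p
    using \<gamma> by (simp add: \<delta>_def power_mult_distrib)
  obtain w where w: "w \<in> bounded_support" "N (\<lambda>x. u x - w x) < \<delta>"
    using u \<delta> by (auto simp: support_closure_def)
  have uL: "u \<in> L" and wL: "w \<in> L" using u w(1) by (auto intro: support_closure_L bounded_support_L)
  obtain C where C: "AE x in M. \<bar>w x\<bar> \<le> C"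
    using w(1) by (auto simp: bounded_support_def)
  define V where "V x = Phi ((u x - w x) / \<delta>)" for x
  define K where "K = exp (3 * \<gamma> * C\<^sup>2)"
  show ?thesis
  proof (rule that[OF \<delta>, of K V])
    show "V \<in> borel_measurable M"
      using L_measurable[OF uL] L_measurable[OF wL] unfolding V_def by measurable
    have "\<delta> \<in> modular (\<lambda>x. u x - w x)"
      using w(2) by (intro modular_of_N_less L_modular L_diff uL wL)
    then show "(\<integral>\<^sup>+x. ennreal (V x) \<partial>M) \<le> 1"
      by (simp add: modular_iff V_def)
    show "AE x in M. \<forall>a. exp (\<gamma> * a\<^sup>2) \<le> K * (1 + Phi ((a - u x) / \<delta>) + V x)"
      using C
    proof (eventually_elim, intro allI)
      fix x a assume w: "\<bar>w x\<bar> \<le> C"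
      define p q where "p = a - u x" and "q = u x - w x"
      have a: "a = p + q + w x" by (simp add: p_def q_def)
      have "3 * (p\<^sup>2 + q\<^sup>2 + (w x)\<^sup>2) - a\<^sup>2 = (p - q)\<^sup>2 + (q - w x)\<^sup>2 + (p - w x)\<^sup>2"
        unfolding a by (simp add: power2_eq_square algebra_simps)
      then have "a\<^sup>2 \<le> 3 * (p\<^sup>2 + q\<^sup>2 + (w x)\<^sup>2)"
        by (smt (verit) zero_le_power2)
      also have "\<dots> \<le> 3 * (p\<^sup>2 + q\<^sup>2 + C\<^sup>2)"
        using w by (simp add: abs_le_square_iff[symmetric])
      finally have "\<gamma> * a\<^sup>2 \<le> \<gamma> * (3 * (p\<^sup>2 + q\<^sup>2 + C\<^sup>2))"
        using \<gamma> by simp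
      then have "exp (\<gamma> * a\<^sup>2) \<le> exp (3 * \<gamma> * C\<^sup>2 + (3 * \<gamma> * p\<^sup>2 + 3 * \<gamma> * q\<^sup>2))"
        by (simp add: algebra_simps)
      also have "\<dots> = K * (exp (3 * \<gamma> * p\<^sup>2) * exp (3 * \<gamma> * q\<^sup>2))"
        by (simp add: K_def exp_add)
      also have "\<dots> \<le> K * (1 + Phi (p / \<delta>) + Phi (q / \<delta>))"
      proof (rule mult_left_mono)
        define s t where "s = exp (3 * \<gamma> * p\<^sup>2)" and "t = exp (3 * \<gamma> * q\<^sup>2)"
        have st: "s\<^sup>2 = 1 + Phi (p / \<delta>)" "t\<^sup>2 = 1 + Phi (q / \<delta>)"
          by (simp_all add: Phi_def s_def t_def sq exp_double[symmetric] del: abs_divide)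
        have "2 * (s * t) \<le> s\<^sup>2 + t\<^sup>2"
          using sum_squares_bound[of s t] by simp
        then have "s * t \<le> 1 + Phi (p / \<delta>) + Phi (q / \<delta>)"
          using st Phi_nonneg[of "p / \<delta>"] Phi_nonneg[of "q / \<delta>"] by linarith
        then show "exp (3 * \<gamma> * p\<^sup>2) * exp (3 * \<gamma> * q\<^sup>2) \<le> 1 + Phi (p / \<delta>) + Phi (q / \<delta>)"
          by (simp add: s_def t_def)
      qed (simp add: K_def)
      finally show "exp (\<gamma> * a\<^sup>2) \<le> K * (1 + Phi ((a - u x) / \<delta>) + V x)"
        by (simp add: p_def q_def V_def)
    qed
  qed (simp_all add: V_def K_def Phi_nonneg)
qed

locale problem = nonlinearity + open_domain +
  assumes F_measurable: "\<And>t. (\<lambda>x. primitive f x t) \<in> borel_measurable M"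
begin

abbreviation F :: "real^2 \<Rightarrow> real \<Rightarrow> real" where "F \<equiv> primitive f"

lemma F_isCont: "isCont (F x) t"
proof -
  obtain r l where "r > 0" "l-lipschitz_on (ball t r) (F x)" using F_lipschitz by blast
  then show ?thesis
    by (metis centre_in_ball continuous_on_eq_continuous_at lipschitz_on_continuous_on open_ball)
qed

text \<open>Continuity in \<open>t\<close> permits rounding \<open>y\<close> to countably many
  values, and for each fixed value measurability in \<open>x\<close> is assumed.\<close>

lemma F_comp_measurable:
  assumes y: "y \<in> borel_measurable M"
  shows "(\<lambda>x. F x (y x)) \<in> borel_measurable M"
proof (rule borel_measurable_LIMSEQ_real)
  let ?y = "\<lambda>n x. real_of_int \<lfloor>real (Suc n) * y x\<rfloor> / real (Suc n)"
  show "(\<lambda>x. F x (?y n x)) \<in> borel_measurable M" for n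
  proof (rule measurable_compose_countable[where f="\<lambda>i x. F x (real_of_int i / real (Suc n))"])
    show "(\<lambda>x. F x (real_of_int i / real (Suc n))) \<in> borel_measurable M" for i
      by (rule F_measurable)
    show "(\<lambda>x. \<lfloor>real (Suc n) * y x\<rfloor>) \<in> measurable M (count_space UNIV)"
      using y by measurable
  qed
  fix x
  have "(\<lambda>n. ?y n x) \<longlonglongrightarrow> y x"
  proof (rule LIM_zero_cancel, rule Lim_null_comparison)
    show "\<forall>\<^sub>F n in sequentially. norm (?y n x - y x) \<le> 1 / real (Suc n)"
    proof (intro always_eventually allI)
      fix n
      have "?y n x - y x = (\<lfloor>real (Suc n) * y x\<rfloor> - real (Suc n) * y x) / real (Suc n)"
        by (simp add: diff_divide_distrib del: of_nat_Suc)
      also have "norm \<dots> = \<bar>\<lfloor>real (Suc n) * y x\<rfloor> - real (Suc n) * y x\<bar> / real (Suc n)"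
        by (simp add: abs_divide)
      also have "\<dots> \<le> 1 / real (Suc n)" by (intro divide_right_mono) linarith+
      finally show "norm (?y n x - y x) \<le> 1 / real (Suc n)" .
    qed
    show "(\<lambda>n. 1 / real (Suc n)) \<longlonglongrightarrow> 0" by (rule LIMSEQ_Suc[OF lim_1_over_n])
  qed
  then show "(\<lambda>n. F x (?y n x)) \<longlonglongrightarrow> F x (y x)"
    by (rule isCont_tendsto_compose[OF F_isCont])
qed

text \<open>Young's inequality with \<open>\<bar>a - b\<bar> / l\<close> as one factor. The number
  \<open>l\<close> stays in front, so integrating at an admissible level \<open>l\<close> of a
  difference gives a Lipschitz estimate. Squaring the other factor doubles the exponent.\<close>

lemma F_diff_le_Young:
  assumes l: "l > 0"
  shows "\<bar>F x a - F x b\<bar> \<le> l * (c1 + c2) *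
     (exp (2 * (\<alpha>0 + 1) * a\<^sup>2) + exp (2 * (\<alpha>0 + 1) * b\<^sup>2) + Phi ((a - b) / l))"
proof -
  define A B s where "A = exp ((\<alpha>0 + 1) * a\<^sup>2)" and "B = exp ((\<alpha>0 + 1) * b\<^sup>2)" and "s = \<bar>a - b\<bar> / l"
  have AB: "A\<^sup>2 = exp (2 * (\<alpha>0 + 1) * a\<^sup>2)" "B\<^sup>2 = exp (2 * (\<alpha>0 + 1) * b\<^sup>2)"
    by (simp_all add: A_def B_def exp_double[symmetric] mult.assoc)
  have s: "\<bar>a - b\<bar> = l * s" using l by (simp add: s_def)
  have "2 * (A * s) \<le> A\<^sup>2 + s\<^sup>2" "2 * (B * s) \<le> B\<^sup>2 + s\<^sup>2"
    using sum_squares_bound[of A s] sum_squares_bound[of B s] by simp_all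
  then have "(A + B) * s \<le> A\<^sup>2 + B\<^sup>2 + s\<^sup>2"
    using zero_le_power2[of A] zero_le_power2[of B] unfolding distrib_right by linarith
  also have "s\<^sup>2 \<le> Phi ((a - b) / l)"
    using power2_le_Phi[of "(a - b) / l"] by (simp add: s_def power_divide)
  finally have *: "(A + B) * s \<le> A\<^sup>2 + B\<^sup>2 + Phi ((a - b) / l)" by simp
  have "\<bar>F x a - F x b\<bar> \<le> (c1 + c2) * (A + B) * \<bar>a - b\<bar>"
    unfolding A_def B_def by (rule primitive_diff_le)
  also have "\<dots> = (l * (c1 + c2)) * ((A + B) * s)" by (simp add: s)
  also have "\<dots> \<le> (l * (c1 + c2)) * (A\<^sup>2 + B\<^sup>2 + Phi ((a - b) / l))"
    using * l pos by (intro mult_left_mono) auto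
  finally show ?thesis by (simp add: AB)
qed

text \<open>Where neither function exceeds \<open>t0\<close> both values of \<open>F\<close> vanish,
  so the exponentials, which are at least 1, are integrated over the remaining set only. The three
  summands of the constant stem from the two exponentials and the modular of
  \<open>y - z\<close>.\<close>

lemma F_diff_nn_integral_le:
  assumes y: "y \<in> borel_measurable M" and z: "z \<in> borel_measurable M"
    and l: "l \<in> modular (\<lambda>x. y x - z x)"
    and Iy: "(\<integral>\<^sup>+x. ennreal (exp (2 * (\<alpha>0 + 1) * (y x)\<^sup>2)) * indicator {x. t0 < y x \<or> t0 < z x} x \<partial>M) \<le> ennreal I"
    and Iz: "(\<integral>\<^sup>+x. ennreal (exp (2 * (\<alpha>0 + 1) * (z x)\<^sup>2)) * indicator {x. t0 < y x \<or> t0 < z x} x \<partial>M) \<le> ennreal I'"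
    and I: "0 \<le> I" "0 \<le> I'"
  shows "(\<integral>\<^sup>+x. ennreal \<bar>F x (y x) - F x (z x)\<bar> \<partial>M) \<le> ennreal (l * ((c1 + c2) * (I + I' + 1)))"
proof -
  note [measurable] = y z
  have l0: "l > 0" using l by (simp add: modular_iff)
  let ?B = "\<lambda>x. indicator {x. t0 < y x \<or> t0 < z x} x :: ennreal"
  let ?e = "\<lambda>t. ennreal (exp (2 * (\<alpha>0 + 1) * t\<^sup>2))"
  let ?c = "ennreal (l * (c1 + c2))"
  have [measurable]: "?B \<in> borel_measurable M"
    unfolding indicator_def by measurable
  have "(\<integral>\<^sup>+x. ennreal \<bar>F x (y x) - F x (z x)\<bar> \<partial>M) \<le>
     (\<integral>\<^sup>+x. ?c * (?e (y x) * ?B x + ?e (z x) * ?B x + ennreal (Phi ((y x - z x) / l))) \<partial>M)"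
  proof (rule nn_integral_mono)
    fix x
    show "ennreal \<bar>F x (y x) - F x (z x)\<bar> \<le>
        ?c * (?e (y x) * ?B x + ?e (z x) * ?B x + ennreal (Phi ((y x - z x) / l)))"
    proof (cases "t0 < y x \<or> t0 < z x")
      case True
      have "ennreal \<bar>F x (y x) - F x (z x)\<bar> \<le> ennreal (l * (c1 + c2) *
          (exp (2 * (\<alpha>0 + 1) * (y x)\<^sup>2) + exp (2 * (\<alpha>0 + 1) * (z x)\<^sup>2) + Phi ((y x - z x) / l)))"
        by (intro ennreal_leI F_diff_le_Young l0)
      also have "\<dots> = ?c * (?e (y x) * ?B x + ?e (z x) * ?B x + ennreal (Phi ((y x - z x) / l)))"
        using True l0 pos Phi_nonneg by (subst ennreal_mult) (auto simp: ennreal_plus)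
      finally show ?thesis .
    next
      case False
      then have "F x (y x) = 0" "F x (z x) = 0" by (auto intro!: primitive_eq_0)
      then show ?thesis by simp
    qed
  qed
  also have "\<dots> = ?c * ((\<integral>\<^sup>+x. ?e (y x) * ?B x \<partial>M) + (\<integral>\<^sup>+x. ?e (z x) * ?B x \<partial>M) +
      (\<integral>\<^sup>+x. ennreal (Phi ((y x - z x) / l)) \<partial>M))"
    by (simp add: nn_integral_cmult nn_integral_add)
  also have "\<dots> \<le> ?c * (ennreal I + ennreal I' + 1)"
    using l by (intro mult_left_mono add_mono Iy Iz) (auto simp: modular_iff)
  also have "\<dots> = ennreal (l * ((c1 + c2) * (I + I' + 1)))"
    using I l0 pos by (simp add: ennreal_mult[symmetric] ennreal_plus[symmetric] ennreal_1[symmetric] mult.assoc del: ennreal_plus ennreal_1)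
  finally show ?thesis .
qed

end

context problem begin

text \<open>For positive \<open>t0\<close> this is Chebyshev's inequality: a point with
  \<open>t0 < y x\<close> contributes at least \<open>Phi (t0 / k)\<close> to a modular of at most
  1. The bound depends on the level alone and is thus uniform on norm balls.\<close>

lemma superlevel_bound:
  assumes fin: "bounded \<Omega> \<or> t0 > 0" and k: "k > 0"
  obtains m where "0 \<le> m" "\<And>y. y \<in> borel_measurable M \<Longrightarrow> k \<in> modular y \<Longrightarrow>
    (\<integral>\<^sup>+x. indicator {x. t0 < y x} x \<partial>M) \<le> ennreal m"
proof (cases "bounded \<Omega>")
  case True
  then have l: "\<Omega> \<in> lmeasurable" using domain_sets by (rule bounded_set_imp_lmeasurable)
  show ?thesis
  proof (rule that[of "measure lebesgue \<Omega>"])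
    fix y
    have "(\<integral>\<^sup>+x. indicator {x. t0 < y x} x \<partial>M) \<le> (\<integral>\<^sup>+x. 1 \<partial>M)"
      by (intro nn_integral_mono) (auto simp: indicator_def)
    also have "\<dots> = emeasure lebesgue \<Omega>"
      using domain_sets by (simp add: emeasure_restrict_space)
    finally show "(\<integral>\<^sup>+x. indicator {x. t0 < y x} x \<partial>M) \<le> ennreal (measure lebesgue \<Omega>)"
      by (simp only: emeasure_eq_measure2[OF l])
  qed simp
next
  case False
  with fin have t0': "t0 > 0" by blast
  have P: "Phi (t0 / k) > 0" using t0' k by (simp add: Phi_def)
  show ?thesis
  proof (rule that[of "1 / Phi (t0 / k)"])
    fix y assume y: "y \<in> borel_measurable M" "k \<in> modular y"
    have "(\<integral>\<^sup>+x. indicator {x. t0 < y x} x \<partial>M) \<le>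
        (\<integral>\<^sup>+x. ennreal (1 / Phi (t0 / k)) * ennreal (Phi (y x / k)) \<partial>M)"
    proof (rule nn_integral_mono)
      fix x
      have "1 \<le> 1 / Phi (t0 / k) * Phi (y x / k)" if "t0 < y x"
      proof -
        have "Phi (t0 / k) \<le> Phi (y x / k)"
          using that t0' k by (intro Phi_mono) (auto simp: abs_divide divide_right_mono)
        then show ?thesis using P by simp
      qed
      then show "indicator {x. t0 < y x} x \<le> ennreal (1 / Phi (t0 / k)) * ennreal (Phi (y x / k))"
        using P Phi_nonneg by (auto simp: indicator_def ennreal_mult[symmetric] simp del: ennreal_1 simp flip: ennreal_1 intro!: ennreal_leI)
    qed
    also have "\<dots> = ennreal (1 / Phi (t0 / k)) * (\<integral>\<^sup>+x. ennreal (Phi (y x / k)) \<partial>M)"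
    proof (rule nn_integral_cmult)
      note [measurable] = y(1)
      show "(\<lambda>x. ennreal (Phi (y x / k))) \<in> borel_measurable M" by measurable
    qed
    also have "\<dots> \<le> ennreal (1 / Phi (t0 / k)) * 1"
      using y(2) by (intro mult_left_mono) (auto simp: modular_iff)
    finally show "(\<integral>\<^sup>+x. indicator {x. t0 < y x} x \<partial>M) \<le> ennreal (1 / Phi (t0 / k))" by simp
  qed (use P in simp)
qed

text \<open>In the factor \<open>m + 2\<close>, the \<open>m\<close> comes from the constant term
  over \<open>S\<close>, the two units from the modular of \<open>y - u\<close> and from
  \<open>V\<close>.\<close>

lemma exp_square_nn_integral_le:
  assumes \<delta>: "\<delta> > 0" "0 \<le> K" "V \<in> borel_measurable M" "\<And>x. 0 \<le> V x"
    "(\<integral>\<^sup>+x. ennreal (V x) \<partial>M) \<le> 1"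
    "AE x in M. \<forall>a. exp (\<gamma> * a\<^sup>2) \<le> K * (1 + Phi ((a - u x) / \<delta>) + V x)"
    and u: "u \<in> borel_measurable M"
    and y: "y \<in> borel_measurable M" "\<delta> \<in> modular (\<lambda>x. y x - u x)"
    and S: "(indicator S :: _ \<Rightarrow> ennreal) \<in> borel_measurable M" "(\<integral>\<^sup>+x. indicator S x \<partial>M) \<le> ennreal m" "0 \<le> m"
  shows "(\<integral>\<^sup>+x. ennreal (exp (\<gamma> * (y x)\<^sup>2)) * indicator S x \<partial>M) \<le> ennreal (K * (m + 2))"
proof -
  note [measurable] = \<delta>(3) u y(1) S(1)
  have "(\<integral>\<^sup>+x. ennreal (exp (\<gamma> * (y x)\<^sup>2)) * indicator S x \<partial>M) \<le>
     (\<integral>\<^sup>+x. ennreal K * (indicator S x + ennreal (Phi ((y x - u x) / \<delta>)) + ennreal (V x)) \<partial>M)"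
  proof (rule nn_integral_mono_AE)
    show "AE x in M. ennreal (exp (\<gamma> * (y x)\<^sup>2)) * indicator S x \<le>
        ennreal K * (indicator S x + ennreal (Phi ((y x - u x) / \<delta>)) + ennreal (V x))"
      using \<delta>(6)
    proof eventually_elim
      case (elim x)
      show ?case
      proof (cases "x \<in> S")
        case True
        have "ennreal (exp (\<gamma> * (y x)\<^sup>2)) \<le> ennreal (K * (1 + Phi ((y x - u x) / \<delta>) + V x))"
          using elim by (intro ennreal_leI) blast
        also have "\<dots> = ennreal K * (1 + ennreal (Phi ((y x - u x) / \<delta>)) + ennreal (V x))"
          using \<delta> Phi_nonneg by (simp add: ennreal_mult ennreal_plus)
        finally show ?thesis using True by simp
      qed simp
    qed
  qed
  also have "\<dots> = ennreal K * ((\<integral>\<^sup>+x. indicator S x \<partial>M) +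
      (\<integral>\<^sup>+x. ennreal (Phi ((y x - u x) / \<delta>)) \<partial>M) + (\<integral>\<^sup>+x. ennreal (V x) \<partial>M))"
    by (simp add: nn_integral_cmult nn_integral_add)
  also have "\<dots> \<le> ennreal K * (ennreal m + 1 + 1)"
    using y(2) by (intro mult_left_mono add_mono S \<delta>) (auto simp: modular_iff)
  also have "\<dots> = ennreal (K * (m + 2))"
  proof -
    have "ennreal (m + 2) = ennreal m + 1 + 1"
      using S(3) by (simp add: ennreal_plus[symmetric] ennreal_1[symmetric] add.assoc del: ennreal_plus ennreal_1)
    then show ?thesis using \<delta>(2) S(3) by (simp only: ennreal_mult[of K "m + 2"])
  qed
  finally show ?thesis .
qed

lemma Psi_integrable_lipschitz:
  assumes fin: "bounded \<Omega> \<or> t0 > 0"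
  shows "\<forall>u\<in>support_closure. integrable M (\<lambda>x. F x (u x))"
    and "locally_lipschitz_functional support_closure N (Psi f \<Omega>)"
proof -
  have \<gamma>: "2 * (\<alpha>0 + 1) > 0" using pos by simp
  have meas: "(indicator {x. t0 < y x} :: _ \<Rightarrow> ennreal) \<in> borel_measurable M"
    "(indicator {x. t0 < y x \<or> t0 < z x} :: _ \<Rightarrow> ennreal) \<in> borel_measurable M"
    if "y \<in> borel_measurable M" "z \<in> borel_measurable M" for y z
    using that unfolding indicator_def by measurable
  show int: "\<forall>u\<in>support_closure. integrable M (\<lambda>x. F x (u x))"
  proof
    fix u assume u: "u \<in> support_closure"
    have um: "u \<in> borel_measurable M" by (intro L_measurable support_closure_L u)
    obtain \<delta> K V where \<delta>: "\<delta> > 0" "0 \<le> K" "V \<in> borel_measurable M" "\<And>x. 0 \<le> V x"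
      "(\<integral>\<^sup>+x. ennreal (V x) \<partial>M) \<le> 1"
      "AE x in M. \<forall>a. exp (2 * (\<alpha>0 + 1) * a\<^sup>2) \<le> K * (1 + Phi ((a - u x) / \<delta>) + V x)"
      by (rule exp_square_bound[OF u \<gamma>]) blast
    obtain k where k: "k \<in> modular u" using L_modular[OF support_closure_L[OF u]] by blast
    obtain m where m: "0 \<le> m" "(\<integral>\<^sup>+x. indicator {x. t0 < u x} x \<partial>M) \<le> ennreal m"
      using superlevel_bound[OF fin, of k] k um by (metis modular_iff)
    \<comment> \<open>Integrability is read off from a comparison with the zero function, where
      \<open>F\<close> vanishes; as \<open>t0\<close> is nonnegative, that function adds nothing to
      the superlevel set.\<close>
    have S: "{x. t0 < u x \<or> t0 < 0} = {x. t0 < u x}" using t0(1) by auto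
    have "(\<integral>\<^sup>+x. ennreal \<bar>F x (u x) - F x 0\<bar> \<partial>M) \<le> ennreal (k * ((c1 + c2) * (K * (m + 2) + m + 1)))"
    proof (rule F_diff_nn_integral_le[OF um])
      show "(\<integral>\<^sup>+x. ennreal (exp (2 * (\<alpha>0 + 1) * (u x)\<^sup>2)) * indicator {x. t0 < u x \<or> t0 < 0} x \<partial>M) \<le> ennreal (K * (m + 2))"
        unfolding S using \<delta>(1) by (intro exp_square_nn_integral_le[OF \<delta> um um]) (simp_all add: zero_modular meas(1)[OF um um] m)
      show "(\<integral>\<^sup>+x. ennreal (exp (2 * (\<alpha>0 + 1) * 0\<^sup>2)) * indicator {x. t0 < u x \<or> t0 < 0} x \<partial>M) \<le> ennreal m"
        unfolding S using m by simp
    qed (use k m \<delta> in auto)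
    also have "\<dots> < \<infinity>" by simp
    finally show "integrable M (\<lambda>x. F x (u x))"
      by (intro integrableI_bounded F_comp_measurable um) (simp add: primitive_zero)
  qed
  show "locally_lipschitz_functional support_closure N (Psi f \<Omega>)"
    unfolding locally_lipschitz_functional_def
  proof
    fix u assume u: "u \<in> support_closure"
    have um: "u \<in> borel_measurable M" by (intro L_measurable support_closure_L u)
    obtain \<delta> K V where \<delta>: "\<delta> > 0" "0 \<le> K" "V \<in> borel_measurable M" "\<And>x. 0 \<le> V x"
      "(\<integral>\<^sup>+x. ennreal (V x) \<partial>M) \<le> 1"
      "AE x in M. \<forall>a. exp (2 * (\<alpha>0 + 1) * a\<^sup>2) \<le> K * (1 + Phi ((a - u x) / \<delta>) + V x)"
      by (rule exp_square_bound[OF u \<gamma>]) blast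
    \<comment> \<open>Every function within \<delta> of \<open>u\<close> has norm below
      \<open>k\<close>, so one bound \<open>m\<close> serves the whole ball.\<close>
    define k where "k = N u + \<delta>"
    have "0 \<le> N u" by (intro N_nonneg L_modular support_closure_L u)
    then have "k > 0" using \<delta>(1) by (simp add: k_def)
    from superlevel_bound[OF fin this] obtain m where m: "0 \<le> m"
      "\<And>y. y \<in> borel_measurable M \<Longrightarrow> k \<in> modular y \<Longrightarrow>
        (\<integral>\<^sup>+x. indicator {x. t0 < y x} x \<partial>M) \<le> ennreal m"
      by blast
    have near: "k \<in> modular y" "\<delta> \<in> modular (\<lambda>x. y x - u x)"
      if y: "y \<in> support_closure" "N (\<lambda>x. y x - u x) < \<delta>" for y
    proof -
      have "N y \<le> N (\<lambda>x. y x - u x) + N u"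
        using N_triangle[OF L_diff[OF support_closure_L[OF y(1)] support_closure_L[OF u]] support_closure_L[OF u]] by simp
      then have "N y < k" using y(2) by (simp add: k_def)
      then show "k \<in> modular y" by (intro modular_of_N_less L_modular support_closure_L y)
      show "\<delta> \<in> modular (\<lambda>x. y x - u x)"
        by (intro modular_of_N_less L_modular L_diff support_closure_L y u)
    qed
    \<comment> \<open>The set where one of the two functions exceeds \<open>t0\<close> has measure
      at most \<open>2 * m\<close>, so \<open>K * (2 * m + 2)\<close> bounds each exponential
      integral over it.\<close>
    define C where "C = (c1 + c2) * (K * (2 * m + 2) + K * (2 * m + 2) + 1)"
    have "\<bar>Psi f \<Omega> y - Psi f \<Omega> z\<bar> \<le> C * N (\<lambda>x. y x - z x)"
      if y: "y \<in> support_closure" "N (\<lambda>x. y x - u x) < \<delta>" and z: "z \<in> support_closure" "N (\<lambda>x. z x - u x) < \<delta>" for y z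
    proof -
      have ym: "y \<in> borel_measurable M" and zm: "z \<in> borel_measurable M"
        by (intro L_measurable support_closure_L y z)+
      let ?S = "{x. t0 < y x \<or> t0 < z x}"
      have "(\<integral>\<^sup>+x. indicator ?S x \<partial>M) \<le>
          (\<integral>\<^sup>+x. indicator {x. t0 < y x} x + indicator {x. t0 < z x} x \<partial>M)"
        by (intro nn_integral_mono) (auto simp: indicator_def)
      also have "\<dots> = (\<integral>\<^sup>+x. indicator {x. t0 < y x} x \<partial>M) + (\<integral>\<^sup>+x. indicator {x. t0 < z x} x \<partial>M)"
        by (rule nn_integral_add[OF meas(1)[OF ym ym] meas(1)[OF zm zm]])
      also have "\<dots> \<le> ennreal m + ennreal m"
        by (intro add_mono m near y z ym zm)
      also have "\<dots> = ennreal (2 * m)" using m(1) by (simp add: ennreal_plus[symmetric] del: ennreal_plus)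
      finally have S: "(\<integral>\<^sup>+x. indicator ?S x \<partial>M) \<le> ennreal (2 * m)" .
      have le: "\<bar>Psi f \<Omega> y - Psi f \<Omega> z\<bar> \<le> l * C" if l: "l \<in> modular (\<lambda>x. y x - z x)" for l
      proof -
        have l0: "l > 0" using l by (simp add: modular_iff)
        have C0: "0 \<le> C" using \<delta>(2) m(1) pos by (simp add: C_def)
        have "\<bar>Psi f \<Omega> y - Psi f \<Omega> z\<bar> = \<bar>LINT x|M. F x (y x) - F x (z x)\<bar>"
          using int y z by (simp add: Psi_def)
        also have "ennreal \<dots> \<le> (\<integral>\<^sup>+x. ennreal \<bar>F x (y x) - F x (z x)\<bar> \<partial>M)"
          using int y z integral_norm_bound_ennreal[of M "\<lambda>x. F x (y x) - F x (z x)"] by simp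
        also have "\<dots> \<le> ennreal (l * C)"
          unfolding C_def
        proof (rule F_diff_nn_integral_le[OF ym zm l])
          show "(\<integral>\<^sup>+x. ennreal (exp (2 * (\<alpha>0 + 1) * (y x)\<^sup>2)) * indicator ?S x \<partial>M) \<le> ennreal (K * (2 * m + 2))"
            by (intro exp_square_nn_integral_le[OF \<delta> um ym]) (simp_all add: near y meas ym zm S m)
          show "(\<integral>\<^sup>+x. ennreal (exp (2 * (\<alpha>0 + 1) * (z x)\<^sup>2)) * indicator ?S x \<partial>M) \<le> ennreal (K * (2 * m + 2))"
            by (intro exp_square_nn_integral_le[OF \<delta> um zm]) (simp_all add: near z meas ym zm S m)
        qed (use \<delta> m in auto)
        finally show ?thesis using l0 C0 by (simp add: ennreal_le_iff)
      qed
      have C0: "0 < C" using \<delta>(2) m(1) pos by (simp add: C_def add_nonneg_pos)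
      show ?thesis
      proof (rule field_le_epsilon)
        fix e :: real assume e: "e > 0"
        \<comment> \<open>The norm is an infimum of admissible levels, so the estimate is applied
          slightly above it.\<close>
        have "N (\<lambda>x. y x - z x) + e / C \<in> modular (\<lambda>x. y x - z x)"
          using e C0 by (intro modular_of_N_less L_modular L_diff support_closure_L y z) auto
        from le[OF this] show "\<bar>Psi f \<Omega> y - Psi f \<Omega> z\<bar> \<le> C * N (\<lambda>x. y x - z x) + e"
          using C0 by (simp add: distrib_right mult.commute[of C "N _"])
      qed
    qed
    then show "\<exists>r>0. \<exists>L. \<forall>y\<in>support_closure. \<forall>z\<in>support_closure.
        N (\<lambda>x. y x - u x) < r \<longrightarrow> N (\<lambda>x. z x - u x) < r \<longrightarrow> \<bar>Psi f \<Omega> y - Psi f \<Omega> z\<bar> \<le> L * N (\<lambda>x. y x - z x)"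
      using \<delta>(1) by blast
  qed
qed

end

section \<open>Directional derivatives of the functional\<close>

lemma eventually_nhds_in:
  "eventually P (nhds_in V NV u) \<longleftrightarrow> (\<exists>\<epsilon>>0. \<forall>y\<in>V. NV (\<lambda>x. y x - u x) < \<epsilon> \<longrightarrow> P y)"
proof -
  let ?B = "\<lambda>\<epsilon>. {y\<in>V. NV (\<lambda>x. y x - u x) < \<epsilon>}"
  have "eventually P (nhds_in V NV u) \<longleftrightarrow> (\<exists>\<epsilon>\<in>{0<..}. eventually P (principal (?B \<epsilon>)))"
    unfolding nhds_in_def
  proof (rule eventually_INF_base)
    show "{0::real<..} \<noteq> {}" by (simp add: greaterThan_non_empty)
    fix a b :: real assume "a \<in> {0<..}" "b \<in> {0<..}"
    then have m: "min a b \<in> {0<..}" by simp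
    have "principal (?B (min a b)) \<le> inf (principal (?B a)) (principal (?B b))"
      unfolding inf_principal principal_le_iff by (rule subsetI) simp
    then show "\<exists>x\<in>{0<..}. principal (?B x) \<le> inf (principal (?B a)) (principal (?B b))"
      by (rule bexI[OF _ m])
  qed
  then show ?thesis
    by (simp only: eventually_principal Ball_def Bex_def mem_Collect_eq greaterThan_iff imp_conjL)
qed

text \<open>If the derivative exceeded \<open>c\<close>, quotients of at least some
  \<open>c' > c\<close> would occur in every neighbourhood and could be selected one by one. The
  radii \<open>a n\<close> are free, so the selection can be made to converge as fast as needed; a
  single small quotient then contradicts it.\<close>

lemma clarke_derivative_le_sequentially:
  assumes a: "\<And>n::nat. a n > 0"
    and seq: "\<And>y h e. (\<And>n. y n \<in> V) \<Longrightarrow> (\<And>n. NV (\<lambda>x. y n x - u x) < a n) \<Longrightarrow>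
      (\<And>n. 0 < h n) \<Longrightarrow> (\<And>n. h n < 1 / real (Suc n)) \<Longrightarrow> e > 0 \<Longrightarrow>
      \<exists>n. (J (\<lambda>x. y n x + h n * v x) - J (y n)) / h n < c + e"
  shows "clarke_derivative V NV J u v \<le> ereal c"
proof (rule ccontr)
  assume "\<not> ?thesis"
  then have "ereal c < clarke_derivative V NV J u v" by simp
  then obtain c' where c': "c < c'" "ereal c' < clarke_derivative V NV J u v"
    using ereal_dense2[of "ereal c" "clarke_derivative V NV J u v"] by auto
  let ?q = "\<lambda>y h. (J (\<lambda>x. y x + h * v x) - J y) / h"
  have ex: "\<exists>y h. y \<in> V \<and> NV (\<lambda>x. y x - u x) < a n \<and> 0 < h \<and> h < 1 / real (Suc n) \<and> c' \<le> ?q y h" for n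
  proof (rule ccontr)
    assume no: "\<not> ?thesis"
    have "eventually (\<lambda>y. y \<in> V \<and> NV (\<lambda>x. y x - u x) < a n) (nhds_in V NV u)"
      unfolding eventually_nhds_in using a[of n] by blast
    moreover have "eventually (\<lambda>h. 0 < h \<and> h < 1 / real (Suc n)) (at_right 0)"
      unfolding eventually_at_right_field by (intro exI[of _ "1 / real (Suc n)"]) auto
    ultimately have "eventually (\<lambda>(y, h). ereal (?q y h) \<le> ereal c') (nhds_in V NV u \<times>\<^sub>F at_right 0)"
      unfolding eventually_prod_filter
    proof (intro exI conjI allI impI)
      fix y h
      assume "y \<in> V \<and> NV (\<lambda>x. y x - u x) < a n" "0 < h \<and> h < 1 / real (Suc n)"
      then have "\<not> c' \<le> ?q y h" using no by blast
      then show "case (y, h) of (y, h) \<Rightarrow> ereal (?q y h) \<le> ereal c'" by simp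
    qed
    then have "clarke_derivative V NV J u v \<le> ereal c'"
      unfolding clarke_derivative_def by (intro Limsup_bounded) (simp add: case_prod_beta')
    with c'(2) show False by simp
  qed
  let ?Q = "\<lambda>n y h. y \<in> V \<and> NV (\<lambda>x. y x - u x) < a n \<and> 0 < h \<and> h < 1 / real (Suc n) \<and> c' \<le> ?q y h"
  from choice[of "\<lambda>n y. \<exists>h. ?Q n y h", OF allI[OF ex]] obtain y where "\<forall>n. \<exists>h. ?Q n (y n) h" ..
  from choice[OF this] obtain h where "\<forall>n. ?Q n (y n) (h n)" ..
  then have yh: "\<And>n. y n \<in> V" "\<And>n. NV (\<lambda>x. y n x - u x) < a n" "\<And>n. 0 < h n"
    "\<And>n. h n < 1 / real (Suc n)" "\<And>n. c' \<le> ?q (y n) (h n)"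
    by simp_all
  have "\<exists>n. ?q (y n) (h n) < c + (c' - c)"
    using yh(1-4) by (rule seq) (use c'(1) in simp)
  then show False using yh(5) by (auto simp: not_less[symmetric])
qed

text \<open>Gathers the regularity of the functional from its two sources:
  \<open>Psi_integrable_lipschitz\<close> if the domain is bounded or \<open>t0 > 0\<close>, and the
  hypothesis of the theorem otherwise.\<close>

locale lipschitz_problem = problem +
  assumes F_integrable: "u \<in> support_closure \<Longrightarrow> integrable M (\<lambda>x. F x (u x))"
    and Psi_lipschitz: "locally_lipschitz_functional support_closure N (Psi f \<Omega>)"
begin

text \<open>Convexity and \<open>Phi 0 = 0\<close> turn a small level into a small modular at the
  fixed scale \<open>k\<close>; geometric levels thus give summable modulars.\<close>

lemma Phi_integral_scaled_le:
  assumes k: "k / 2 ^ n \<in> modular u" and [measurable]: "u \<in> borel_measurable M"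
  shows "(\<integral>\<^sup>+x. ennreal (Phi (u x / k)) \<partial>M) \<le> ennreal ((1/2) ^ n)"
proof -
  have "(\<integral>\<^sup>+x. ennreal (Phi (u x / k)) \<partial>M) \<le>
      (\<integral>\<^sup>+x. ennreal ((1/2) ^ n) * ennreal (Phi (u x / (k / 2 ^ n))) \<partial>M)"
  proof (rule nn_integral_mono)
    fix x
    have "Phi (u x / k) = Phi ((1/2) ^ n * (u x / (k / 2 ^ n)))"
      by (simp add: power_one_over)
    also have "\<dots> \<le> (1/2) ^ n * Phi (u x / (k / 2 ^ n))"
      by (rule Phi_scale_le) (auto simp: power_le_one)
    finally show "ennreal (Phi (u x / k)) \<le> ennreal ((1/2) ^ n) * ennreal (Phi (u x / (k / 2 ^ n)))"
      by (subst ennreal_mult[symmetric]) (auto simp: Phi_nonneg intro!: ennreal_leI)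
  qed
  also have "\<dots> = ennreal ((1/2) ^ n) * (\<integral>\<^sup>+x. ennreal (Phi (u x / (k / 2 ^ n))) \<partial>M)"
    by (rule nn_integral_cmult) measurable
  also have "\<dots> \<le> ennreal ((1/2) ^ n) * 1"
    using k by (intro mult_left_mono) (auto simp: modular_iff)
  finally show ?thesis by simp
qed

text \<open>For steps of length at most 1, \<open>(a + h * w)^2 \<le> 2 * a^2 + 2\<close>. The bound
  then involves \<open>a\<close> alone and can be fed into \<open>exp_square_bound\<close> with
  \<gamma> = 2 (\<alpha>0 + 1).\<close>

lemma difference_quotient_le:
  assumes h: "0 < h" "h \<le> 1" and w: "\<bar>w\<bar> = 1"
  shows "\<bar>(F x (a + h * w) - F x a) / h\<bar> \<le> 2 * (c1 + c2) * exp (2 * (\<alpha>0 + 1)) * exp (2 * (\<alpha>0 + 1) * a\<^sup>2)"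
proof -
  let ?b = "\<alpha>0 + 1"
  have b: "?b > 0" using pos by simp
  have hw: "\<bar>h * w\<bar> = h" using h w by (simp add: abs_mult)
  then have hw2: "(h * w)\<^sup>2 \<le> 1" using h by (metis abs_ge_zero power2_abs power_le_one)
  have "2 * a\<^sup>2 + 2 * (h * w)\<^sup>2 - (a + h * w)\<^sup>2 = (a - h * w)\<^sup>2"
    by (simp add: power2_eq_square algebra_simps)
  then have "(a + h * w)\<^sup>2 \<le> 2 * a\<^sup>2 + 2"
    using hw2 by (smt (verit) zero_le_power2)
  then have "?b * (a + h * w)\<^sup>2 \<le> ?b * (2 * a\<^sup>2 + 2)"
    using b by (intro mult_left_mono) auto
  also have "\<dots> = 2 * ?b + 2 * ?b * a\<^sup>2" by (simp add: algebra_simps)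
  finally have 1: "exp (?b * (a + h * w)\<^sup>2) \<le> exp (2 * ?b + 2 * ?b * a\<^sup>2)" by simp
  have "0 \<le> ?b * a\<^sup>2" using b by simp
  moreover have "q \<le> 2 * ?b + 2 * q" if "0 \<le> q" for q using b that by simp
  ultimately have "?b * a\<^sup>2 \<le> 2 * ?b + 2 * ?b * a\<^sup>2" unfolding mult.assoc by blast
  then have 2: "exp (?b * a\<^sup>2) \<le> exp (2 * ?b + 2 * ?b * a\<^sup>2)" by simp
  have "\<bar>F x (a + h * w) - F x a\<bar> \<le> (c1 + c2) * (exp (?b * (a + h * w)\<^sup>2) + exp (?b * a\<^sup>2)) * \<bar>a + h * w - a\<bar>"
    by (rule primitive_diff_le)
  also have "\<bar>a + h * w - a\<bar> = h" using hw by simp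
  finally have "\<bar>F x (a + h * w) - F x a\<bar> / h \<le> (c1 + c2) * (exp (?b * (a + h * w)\<^sup>2) + exp (?b * a\<^sup>2))"
    using h by (simp add: divide_le_eq)
  also have "\<dots> \<le> (c1 + c2) * (2 * exp (2 * ?b + 2 * ?b * a\<^sup>2))"
    using pos by (intro mult_left_mono order_trans[OF add_mono[OF 1 2]]) simp_all
  also have "\<dots> = 2 * (c1 + c2) * exp (2 * ?b) * exp (2 * ?b * a\<^sup>2)"
    by (simp add: exp_add)
  finally show ?thesis using h by (simp add: abs_divide)
qed

lemma indicator_integrable:
  assumes "A \<in> sets lebesgue" "A \<subseteq> \<Omega>" "bounded A"
  shows "integrable M (indicator A :: _ \<Rightarrow> real)"
proof -
  have "A \<in> lmeasurable" using assms by (simp add: bounded_set_imp_lmeasurable)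
  then have "emeasure lebesgue A < \<infinity>" unfolding fmeasurable_def by blast
  moreover have "emeasure M A = emeasure lebesgue A"
    using assms domain_sets by (intro emeasure_restrict_space) auto
  ultimately show ?thesis
    using assms domain_sets by (intro integrable_real_indicator) (auto simp: sets_restrict_space_iff)
qed

text \<open>The direction is \<open>w\<close> on \<open>A\<close> and 0 elsewhere, so the quotient
  of the functional is an integral over \<open>A\<close> of one-variable quotients. Their base
  points and steps tend to \<open>u x\<close> and 0, and their upper limit is at most
  \<open>U x\<close> by the definition of the one-variable derivative.\<close>

lemma clarke_derivative_Psi_le:
  assumes u: "u \<in> support_closure" and A: "A \<in> sets lebesgue" "A \<subseteq> \<Omega>" "bounded A"
    and w: "\<bar>w\<bar> = 1"
    and U: "\<And>x. clarke_derivative_real (F x) (u x) w = ereal (U x)"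
      "\<And>x. \<bar>U x\<bar> \<le> (c1 + c2) * exp ((\<alpha>0 + 1) * (u x)\<^sup>2)"
      "U \<in> borel_measurable M"
  shows "integrable M (\<lambda>x. indicator A x * U x)"
    and "clarke_derivative support_closure N (Psi f \<Omega>) u (\<lambda>x. w * indicator A x) \<le>
      ereal (LINT x|M. indicator A x * U x)"
proof -
  let ?b = "\<alpha>0 + 1"
  have b: "2 * ?b > 0" using pos by simp
  have um [measurable]: "u \<in> borel_measurable M" by (intro L_measurable support_closure_L u)
  note Um [measurable] = U(3)
  have Am [measurable]: "(indicator A :: _ \<Rightarrow> real) \<in> borel_measurable M"
    by (rule indicator_measurable[OF A(1)])
  obtain \<delta> K V where \<delta>: "\<delta> > 0" "0 \<le> K" and Vm [measurable]: "V \<in> borel_measurable M"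
    and V: "\<And>x. 0 \<le> V x" "(\<integral>\<^sup>+x. ennreal (V x) \<partial>M) \<le> 1"
    and exp_le: "AE x in M. \<forall>a. exp (2 * ?b * a\<^sup>2) \<le> K * (1 + Phi ((a - u x) / \<delta>) + V x)"
    by (rule exp_square_bound[OF u b]) blast
  define C where "C = 2 * (c1 + c2) * exp (2 * ?b) * K"
  have C: "0 \<le> C" using pos \<delta>(2) by (simp add: C_def)
  have V_int: "integrable M V"
    using V by (intro integrableI_bounded) (auto simp: top_unique intro: le_less_trans)
  have U_le: "AE x in M. \<bar>U x\<bar> \<le> C * (1 + V x)"
    using exp_le
  proof eventually_elim
    case (elim x)
    have "\<bar>U x\<bar> \<le> (c1 + c2) * exp (?b * (u x)\<^sup>2)" by (rule U)
    also have "\<dots> \<le> (2 * (c1 + c2) * exp (2 * ?b)) * exp (2 * ?b * (u x)\<^sup>2)"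
    proof (rule mult_mono)
      have "1 \<le> exp (2 * ?b)" using b by simp
      then have "1 \<le> 2 * exp (2 * ?b)" by linarith
      then have "1 * (c1 + c2) \<le> 2 * exp (2 * ?b) * (c1 + c2)"
        by (rule mult_right_mono) (use pos in simp)
      then show "c1 + c2 \<le> 2 * (c1 + c2) * exp (2 * ?b)" by (simp only: mult_1 mult.assoc mult.commute[of "c1 + c2"])
      have "?b * (u x)\<^sup>2 \<le> 2 * ?b * (u x)\<^sup>2"
        by (rule mult_right_mono) (use pos in simp_all)
      then show "exp (?b * (u x)\<^sup>2) \<le> exp (2 * ?b * (u x)\<^sup>2)" by simp
    qed (use pos in auto)
    also have "\<dots> \<le> (2 * (c1 + c2) * exp (2 * ?b)) * (K * (1 + V x))"
      using elim[rule_format, of "u x"] pos by (intro mult_left_mono) auto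
    finally show ?case by (simp add: C_def mult.assoc)
  qed
  have "integrable M (\<lambda>x. indicator A x * (C * (1 + V x)))"
  proof (rule Bochner_Integration.integrable_bound[of _ "\<lambda>x. C * (indicator A x + V x)"])
    show "integrable M (\<lambda>x. C * (indicator A x + V x))"
      by (intro integrable_mult_right Bochner_Integration.integrable_add V_int indicator_integrable A)
    show "(\<lambda>x. indicator A x * (C * (1 + V x))) \<in> borel_measurable M" by measurable
  qed (use C V(1) in \<open>auto simp: indicator_def intro!: mult_left_mono\<close>)
  then show U_int: "integrable M (\<lambda>x. indicator A x * U x)"
  proof (rule Bochner_Integration.integrable_bound)
    show "AE x in M. norm (indicator A x * U x) \<le> norm (indicator A x * (C * (1 + V x)))"
      using U_le by eventually_elim (use C V(1) in \<open>auto simp: indicator_def abs_mult\<close>)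
  qed measurable
  show "clarke_derivative support_closure N (Psi f \<Omega>) u (\<lambda>x. w * indicator A x) \<le>
      ereal (LINT x|M. indicator A x * U x)"
  proof (rule clarke_derivative_le_sequentially)
    \<comment> \<open>This radius makes the \<open>n\<close>-th modular at scale \<delta> at most
      \<open>(1/2) ^ Suc n\<close>, and the sum of all of them at most 1.\<close>
    show "0 < \<delta> / 2 ^ Suc n" for n using \<delta>(1) by simp
    fix y :: "nat \<Rightarrow> real^2 \<Rightarrow> real" and h :: "nat \<Rightarrow> real" and e :: real
    assume y: "\<And>n. y n \<in> support_closure" "\<And>n. N (\<lambda>x. y n x - u x) < \<delta> / 2 ^ Suc n"
      and h: "\<And>n. 0 < h n" "\<And>n. h n < 1 / real (Suc n)" and e: "e > 0"
    have ym [measurable]: "y n \<in> borel_measurable M" for n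
      by (intro L_measurable support_closure_L y)
    have h1: "h n \<le> 1" for n
      using h(2)[of n] by (rule less_imp_le[OF less_le_trans]) simp
    define p where "p n x = Phi ((y n x - u x) / \<delta>)" for n x
    have pm [measurable]: "p n \<in> borel_measurable M" for n
      unfolding p_def by measurable
    have p_nn: "0 \<le> p n x" for n x by (simp add: p_def Phi_nonneg)
    \<comment> \<open>The sum serves twice: its finiteness forces \<open>p n x\<close> to zero, and
      it dominates all \<open>p n x\<close> at once.\<close>
    define W where "W x = (\<Sum>n. ennreal (p n x))" for x
    have Wm [measurable]: "W \<in> borel_measurable M" unfolding W_def by measurable
    have "(\<integral>\<^sup>+x. W x \<partial>M) = (\<Sum>n. \<integral>\<^sup>+x. ennreal (p n x) \<partial>M)"
      unfolding W_def by (intro nn_integral_suminf) measurable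
    also have "\<dots> \<le> (\<Sum>n. ennreal ((1/2) ^ Suc n))"
    proof (intro suminf_le allI)
      fix n
      have "\<delta> / 2 ^ Suc n \<in> modular (\<lambda>x. y n x - u x)"
        by (intro modular_of_N_less L_modular L_diff support_closure_L y u)
      then show "(\<integral>\<^sup>+x. ennreal (p n x) \<partial>M) \<le> ennreal ((1/2) ^ Suc n)"
        unfolding p_def by (rule Phi_integral_scaled_le) measurable
    qed auto
    also have "\<dots> = ennreal 1"
      by (rule suminf_ennreal_eq[OF _ power_half_series]) simp
    finally have W_le: "(\<integral>\<^sup>+x. W x \<partial>M) \<le> 1" by simp
    then have "(\<integral>\<^sup>+x. W x \<partial>M) \<noteq> \<infinity>" by (auto simp: top_unique)
    then have W_fin: "AE x in M. W x \<noteq> \<infinity>"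
      using nn_integral_PInf_AE[OF Wm] by simp
    have p_sum: "AE x in M. (\<forall>n. p n x \<le> enn2real (W x)) \<and> (\<lambda>n. p n x) \<longlonglongrightarrow> 0"
      using W_fin
    proof eventually_elim
      case (elim x)
      have s: "summable (\<lambda>n. p n x)"
        using elim p_nn by (intro summable_suminf_not_top) (auto simp: W_def)
      then have "W x = ennreal (\<Sum>n. p n x)"
        unfolding W_def using p_nn by (intro suminf_ennreal2)
      then have "enn2real (W x) = (\<Sum>n. p n x)" using p_nn s by (simp add: suminf_nonneg)
      moreover have "p n x \<le> (\<Sum>n. p n x)" for n
        using sum_le_suminf[OF s, of "{n}"] p_nn by simp
      ultimately show ?case using summable_LIMSEQ_zero[OF s] by simp
    qed
    define q where "q n x = indicator A x * ((F x (y n x + h n * w) - F x (y n x)) / h n)" for n x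
    \<comment> \<open>A majorant independent of \<open>n\<close>; it is integrable because the
      constant 1 is integrated over the bounded set \<open>A\<close> only.\<close>
    define G where "G x = indicator A x * (C * (1 + enn2real (W x) + V x))" for x
    have qm [measurable]: "q n \<in> borel_measurable M" for n
      unfolding q_def by (intro borel_measurable_times borel_measurable_divide borel_measurable_diff Am F_comp_measurable) measurable
    have W_int: "integrable M (\<lambda>x. enn2real (W x))"
    proof (rule integrableI_bounded)
      have "(\<integral>\<^sup>+x. ennreal (norm (enn2real (W x))) \<partial>M) \<le> (\<integral>\<^sup>+x. W x \<partial>M)"
        by (intro nn_integral_mono) (auto simp: ennreal_enn2real_if)
      also have "\<dots> < \<infinity>" using W_le by (auto intro: le_less_trans)
      finally show "(\<integral>\<^sup>+x. ennreal (norm (enn2real (W x))) \<partial>M) < \<infinity>" .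
    qed measurable
    have G_int: "integrable M G"
    proof (rule Bochner_Integration.integrable_bound[of _ "\<lambda>x. C * (indicator A x + enn2real (W x) + V x)"])
      show "integrable M (\<lambda>x. C * (indicator A x + enn2real (W x) + V x))"
        by (intro integrable_mult_right Bochner_Integration.integrable_add V_int W_int indicator_integrable A)
      show "G \<in> borel_measurable M" unfolding G_def by measurable
    qed (use C V(1) in \<open>auto simp: G_def indicator_def intro!: mult_left_mono\<close>)
    have q_le: "AE x in M. \<forall>n. \<bar>q n x\<bar> \<le> G x"
      using exp_le p_sum
    proof eventually_elim
      case (elim x)
      show ?case
      proof
        fix n
        have "\<bar>(F x (y n x + h n * w) - F x (y n x)) / h n\<bar> \<le>
            2 * (c1 + c2) * exp (2 * ?b) * exp (2 * ?b * (y n x)\<^sup>2)"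
          by (rule difference_quotient_le[OF h(1) h1 w])
        also have "\<dots> \<le> 2 * (c1 + c2) * exp (2 * ?b) * (K * (1 + p n x + V x))"
          using elim(1) pos unfolding p_def by (intro mult_left_mono) auto
        also have "\<dots> = C * (1 + p n x + V x)" by (simp add: C_def mult.assoc)
        also have "\<dots> \<le> C * (1 + enn2real (W x) + V x)"
          using elim(2) C by (intro mult_left_mono) auto
        finally show "\<bar>q n x\<bar> \<le> G x" by (auto simp: q_def G_def indicator_def abs_mult)
      qed
    qed
    \<comment> \<open>\<open>q n\<close> need not converge, but its upper limit is at most \<open>U\<close> on \<open>A\<close>, so this maximum does.\<close>
    define g where "g n x = max (q n x) (indicator A x * U x)" for n x
    have g_le: "AE x in M. norm (g n x) \<le> G x" for n
      using q_le U_le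
    proof eventually_elim
      case (elim x)
      have "C * (1 + V x) \<le> C * (1 + enn2real (W x) + V x)" using C by (intro mult_left_mono) auto
      then have "\<bar>indicator A x * U x\<bar> \<le> G x"
        using elim(2) by (auto simp: G_def indicator_def)
      with elim(1) have "\<bar>q n x\<bar> \<le> G x" "\<bar>indicator A x * U x\<bar> \<le> G x" by auto
      then show ?case by (auto simp: g_def max_def)
    qed
    have lim: "AE x in M. (\<lambda>n. g n x) \<longlonglongrightarrow> indicator A x * U x"
      using p_sum
    proof eventually_elim
      case (elim x)
      show ?case
      proof (cases "x \<in> A")
        case True
        \<comment> \<open>\<open>p n x\<close> dominates the square of this quantity, so its
          convergence to zero gives \<open>y n x\<close> tending to \<open>u x\<close>.\<close>
        have "(\<lambda>n. (y n x - u x) / \<delta>) \<longlonglongrightarrow> 0"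
        proof (rule Lim_null_comparison)
          show "\<forall>\<^sub>F n in sequentially. norm ((y n x - u x) / \<delta>) \<le> sqrt (p n x)"
            by (intro always_eventually allI) (simp add: p_def real_le_rsqrt power2_le_Phi del: abs_divide)
          show "(\<lambda>n. sqrt (p n x)) \<longlonglongrightarrow> 0"
            using tendsto_real_sqrt[OF conjunct2[OF elim]] by simp
        qed
        from tendsto_add[OF tendsto_mult_right[OF this, of \<delta>] tendsto_const, of "u x"]
        have yu: "(\<lambda>n. y n x) \<longlonglongrightarrow> u x" using \<delta>(1) by simp
        have "h \<longlonglongrightarrow> 0"
          by (rule tendsto_sandwich[OF _ _ tendsto_const LIMSEQ_Suc[OF lim_1_over_n]])
            (use h in \<open>auto intro!: always_eventually less_imp_le\<close>)
        moreover have "h n \<noteq> 0" for n using h(1)[of n] by simp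
        ultimately have "filterlim h (at_right 0) sequentially"
          using h(1) by (simp add: filterlim_at)
        \<comment> \<open>Base points and steps converge along exactly the filter that defines the
          one-variable derivative.\<close>
        with yu have fl: "filterlim (\<lambda>n. (y n x, h n)) (nhds (u x) \<times>\<^sub>F at_right 0) sequentially"
          by (rule filterlim_Pair)
        show ?thesis
        proof (rule order_tendstoI)
          fix a assume "a < indicator A x * U x"
          then show "\<forall>\<^sub>F n in sequentially. a < g n x"
            by (simp add: g_def less_max_iff_disj)
        next
          fix a assume a: "indicator A x * U x < a"
          then have "clarke_derivative_real (F x) (u x) w < ereal a" using U(1) True by simp
          then have "\<forall>\<^sub>F (s, h) in nhds (u x) \<times>\<^sub>F at_right 0. ereal ((F x (s + h * w) - F x s) / h) < ereal a"
            unfolding clarke_derivative_real_def by (auto dest!: Limsup_lessD simp: case_prod_beta')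
          from eventually_compose_filterlim[OF this fl]
          have "\<forall>\<^sub>F n in sequentially. (F x (y n x + h n * w) - F x (y n x)) / h n < a" by simp
          then show "\<forall>\<^sub>F n in sequentially. g n x < a"
            by eventually_elim (use a True in \<open>simp add: g_def q_def\<close>)
        qed
      qed (simp add: g_def q_def)
    qed
    have "(\<lambda>n. LINT x|M. g n x) \<longlonglongrightarrow> (LINT x|M. indicator A x * U x)"
    proof (rule integral_dominated_convergence[OF _ _ G_int lim g_le])
      show "g n \<in> borel_measurable M" for n unfolding g_def by measurable
    qed measurable
    then have "\<forall>\<^sub>F n in sequentially. (LINT x|M. g n x) < (LINT x|M. indicator A x * U x) + e"
      using e by (intro order_tendstoD) auto
    then obtain n where n: "(LINT x|M. g n x) < (LINT x|M. indicator A x * U x) + e"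
      using eventually_happens'[OF sequentially_bot] by blast
    have ind: "indicator A \<in> support_closure"
      by (intro bounded_support_closure indicator_bounded_support A)
    have yv: "(\<lambda>x. y n x + h n * (w * indicator A x)) \<in> support_closure"
      using support_closure_add_scaled[OF y(1) ind, of n "h n * w"] by (simp add: mult.assoc)
    have q_int: "integrable M (q n)"
    proof (rule Bochner_Integration.integrable_bound[OF G_int qm])
      show "AE x in M. norm (q n x) \<le> norm (G x)"
        using q_le by eventually_elim (simp add: order_trans[OF _ abs_ge_self])
    qed
    have "(Psi f \<Omega> (\<lambda>x. y n x + h n * (w * indicator A x)) - Psi f \<Omega> (y n)) / h n =
        (LINT x|M. (F x (y n x + h n * (w * indicator A x)) - F x (y n x)) / h n)"
      using F_integrable[OF yv] F_integrable[OF y(1)] by (simp add: Psi_def)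
    \<comment> \<open>Outside \<open>A\<close> the direction is 0 and the increment
      vanishes.\<close>
    also have "\<dots> = (LINT x|M. q n x)"
      by (intro Bochner_Integration.integral_cong) (auto simp: q_def indicator_def)
    also have "\<dots> \<le> (LINT x|M. g n x)"
    proof (rule integral_mono[OF q_int])
      show "integrable M (g n)"
        unfolding g_def by (intro integrable_max q_int U_int)
    qed (simp add: g_def)
    finally show "\<exists>n. (Psi f \<Omega> (\<lambda>x. y n x + h n * (w * indicator A x)) - Psi f \<Omega> (y n)) / h n <
        (LINT x|M. indicator A x * U x) + e"
      using n by (intro exI[of _ n]) simp
  qed
qed

end

section \<open>Representation of subgradients\<close>

lemma suminf_swap_ennreal:
  fixes g :: "nat \<Rightarrow> nat \<Rightarrow> ennreal"
  shows "(\<Sum>i. \<Sum>j. g i j) = (\<Sum>j. \<Sum>i. g i j)"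
  using nn_integral_suminf[of "\<lambda>i j. g i j" "count_space UNIV"]
  by (simp add: nn_integral_count_space_nat)

text \<open>\<open>N_measurable\<close> speaks of functions on the whole plane, so \<open>u\<close>
  is extended by 0 outside the domain.\<close>

lemma (in lebesgue_domain) N_measurable_comp:
  assumes "N_measurable g" "u \<in> borel_measurable M"
  shows "(\<lambda>x. g x (u x)) \<in> borel_measurable M"
proof -
  have "(\<lambda>x. if x \<in> \<Omega> then u x else 0) \<in> borel_measurable lebesgue"
    using assms(2) domain_sets by (simp add: borel_measurable_if)
  then have "(\<lambda>x. g x (if x \<in> \<Omega> then u x else 0)) \<in> borel_measurable lebesgue"
    using assms(1) by (simp add: N_measurable_def)
  then have "(\<lambda>x. g x (if x \<in> \<Omega> then u x else 0)) \<in> borel_measurable M"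
    by (rule measurable_restrict_space1)
  then show ?thesis
    by (rule measurable_cong[THEN iffD1, rotated]) simp
qed

text \<open>The test set is where the inequality fails, cut off by balls because integrals are
  controlled over bounded sets only.\<close>

lemma (in lebesgue_domain) AE_le_of_integral_le:
  fixes P Q :: "real^2 \<Rightarrow> real"
  assumes [measurable]: "P \<in> borel_measurable M" "Q \<in> borel_measurable M"
    and int: "\<And>A. A \<in> sets lebesgue \<Longrightarrow> A \<subseteq> \<Omega> \<Longrightarrow> bounded A \<Longrightarrow> integrable M (\<lambda>x. indicator A x * P x)"
      "\<And>A. A \<in> sets lebesgue \<Longrightarrow> A \<subseteq> \<Omega> \<Longrightarrow> bounded A \<Longrightarrow> integrable M (\<lambda>x. indicator A x * Q x)"
    and le: "\<And>A. A \<in> sets lebesgue \<Longrightarrow> A \<subseteq> \<Omega> \<Longrightarrow> bounded A \<Longrightarrow>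
      (LINT x|M. indicator A x * P x) \<le> (LINT x|M. indicator A x * Q x)"
  shows "AE x in M. P x \<le> Q x"
proof -
  have "AE x in M. norm x \<le> real n \<longrightarrow> P x \<le> Q x" for n
  proof -
    define A where "A = {x \<in> \<Omega>. norm x \<le> real n \<and> Q x < P x}"
    have [measurable]: "norm \<in> borel_measurable M" by (rule norm_measurable)
    have A: "A \<in> sets lebesgue" "A \<subseteq> \<Omega>" "bounded A"
    proof -
      show "A \<in> sets lebesgue"
        unfolding A_def by (rule sets_lebesgue_Collect) measurable
    qed (auto simp: A_def bounded_iff)
    define h where "h x = indicator A x * P x - indicator A x * Q x" for x
    have hi: "integrable M h"
      unfolding h_def by (intro Bochner_Integration.integrable_diff int A)
    have hn: "0 \<le> h x" for x by (auto simp: h_def A_def indicator_def)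
    have "(LINT x|M. h x) \<le> 0"
      using le[OF A] int(1)[OF A] int(2)[OF A] by (simp add: h_def)
    moreover have "0 \<le> (LINT x|M. h x)" using hn by simp
    ultimately have "(LINT x|M. h x) = 0" by (rule antisym)
    then have "AE x in M. h x = 0"
      using integral_nonneg_eq_0_iff_AE[OF hi] hn by auto
    then show ?thesis
      using AE_space
    proof eventually_elim
      case (elim x)
      then show ?case by (auto simp: h_def A_def indicator_def split: if_splits)
    qed
  qed
  then have "AE x in M. \<forall>n::nat. norm x \<le> real n \<longrightarrow> P x \<le> Q x"
    by (subst AE_all_countable) blast
  then show ?thesis
  proof eventually_elim
    case (elim x)
    then show ?case using real_arch_simple[of "norm x"] by blast
  qed
qed

text \<open>Fatou's lemma under a uniform bound, the form in which truncations are removed.\<close>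

lemma nn_integral_limit_le:
  assumes [measurable]: "\<And>n. g n \<in> borel_measurable M" "g' \<in> borel_measurable M"
    and lim: "AE x in M. (\<lambda>n. g n x) \<longlonglongrightarrow> g' x" and le: "\<And>n. (\<integral>\<^sup>+x. g n x \<partial>M) \<le> c"
  shows "(\<integral>\<^sup>+x. g' x \<partial>M) \<le> c"
proof -
  have "(\<integral>\<^sup>+x. g' x \<partial>M) = (\<integral>\<^sup>+x. liminf (\<lambda>n. g n x) \<partial>M)"
    using lim by (intro nn_integral_cong_AE) (auto elim!: eventually_mono simp: lim_imp_Liminf)
  also have "\<dots> \<le> liminf (\<lambda>n. \<integral>\<^sup>+x. g n x \<partial>M)"
    by (rule nn_integral_liminf) measurable
  also have "\<dots> \<le> c"
    using Liminf_mono[of "\<lambda>n. \<integral>\<^sup>+x. g n x \<partial>M" "\<lambda>n. c" sequentially] le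
    by (simp add: Liminf_const)
  finally show ?thesis .
qed

locale dual_functional = lebesgue_domain +
  fixes \<xi> :: "(real^2 \<Rightarrow> real) \<Rightarrow> real"
  assumes dual: "\<xi> \<in> dual_space support_closure N"
begin

lemma linear:
  "u \<in> support_closure \<Longrightarrow> v \<in> support_closure \<Longrightarrow> \<xi> (\<lambda>x. a * u x + b * v x) = a * \<xi> u + b * \<xi> v"
  using dual by (simp add: dual_space_def)

lemma diff: "u \<in> support_closure \<Longrightarrow> v \<in> support_closure \<Longrightarrow> \<xi> (\<lambda>x. u x - v x) = \<xi> u - \<xi> v"
  using linear[of u v 1 "-1"] by simp

text \<open>The constant is taken at least 1 so that it may serve as a divisor and as a Luxemburg
  level.\<close>

lemma bound:
  obtains C where "C \<ge> 1" "\<And>v. v \<in> support_closure \<Longrightarrow> \<bar>\<xi> v\<bar> \<le> C * N v"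
proof -
  obtain C where C: "\<And>v. v \<in> support_closure \<Longrightarrow> \<bar>\<xi> v\<bar> \<le> C * N v"
    using dual unfolding dual_space_def by blast
  have "\<bar>\<xi> v\<bar> \<le> max C 1 * N v" if "v \<in> support_closure" for v
  proof -
    have "0 \<le> N v" by (intro N_nonneg L_modular support_closure_L that)
    then have "C * N v \<le> max C 1 * N v" by (intro mult_right_mono) auto
    with C[OF that] show ?thesis by linarith
  qed
  then show ?thesis by (intro that[of "max C 1"]) auto
qed

text \<open>Bounded convergence with common support is norm convergence, along which \<xi> is
  continuous.\<close>

lemma tendsto_bounded_support:
  assumes U: "\<And>n. U n \<in> bounded_support" and u: "u \<in> bounded_support"
    and b: "\<And>n. AE x in M. \<bar>U n x\<bar> \<le> C \<and> (R < norm x \<longrightarrow> U n x = 0)"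
    and lim: "AE x in M. (\<lambda>n. U n x) \<longlonglongrightarrow> u x"
  shows "(\<lambda>n. \<xi> (U n)) \<longlonglongrightarrow> \<xi> u"
proof -
  obtain C' R' where ub: "AE x in M. \<bar>u x\<bar> \<le> C' \<and> (R' < norm x \<longrightarrow> u x = 0)"
    using u by (auto simp: bounded_support_def)
  obtain D where D: "D \<ge> 1" "\<And>v. v \<in> support_closure \<Longrightarrow> \<bar>\<xi> v\<bar> \<le> D * N v" by (rule bound) blast
  have m: "U n \<in> borel_measurable M" "u \<in> borel_measurable M" for n
    using U[of n] u by (auto simp: bounded_support_def)
  have ev: "\<forall>\<^sub>F n in sequentially. e \<in> modular (\<lambda>x. U n x - u x)" if "e > 0" for e
  proof (rule eventually_modular[OF _ _ _ that])
    show "(\<lambda>x. U n x - u x) \<in> borel_measurable M" for n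
      by (intro borel_measurable_diff m)
    show "AE x in M. \<bar>U n x - u x\<bar> \<le> C + C' \<and> (max R R' < norm x \<longrightarrow> U n x - u x = 0)" for n
      using ub b[of n] by eventually_elim auto
    show "AE x in M. (\<lambda>n. U n x - u x) \<longlonglongrightarrow> 0"
      using lim by eventually_elim (simp add: LIM_zero)
  qed
  show ?thesis
  proof (rule tendstoI)
    fix e :: real assume e: "e > 0"
    then have "e / (2 * D) > 0" using D(1) by simp
    from ev[OF this] show "\<forall>\<^sub>F n in sequentially. dist (\<xi> (U n)) (\<xi> u) < e"
    proof eventually_elim
      case (elim n)
      have "\<bar>\<xi> (U n) - \<xi> u\<bar> = \<bar>\<xi> (\<lambda>x. U n x - u x)\<bar>"
        using diff[of "U n" u] U[of n] u by (simp add: bounded_support_closure)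
      also have "\<dots> \<le> D * N (\<lambda>x. U n x - u x)"
        by (intro D support_closure_diff bounded_support_closure U u)
      also have "\<dots> \<le> D * (e / (2 * D))"
        using D(1) N_le[OF elim] by (intro mult_left_mono) auto
      also have "\<dots> < e" using D(1) e by simp
      finally show ?case by (simp add: dist_real_def)
    qed
  qed
qed

text \<open>Partial unions converge boundedly to the full union, so continuity of \<xi> upgrades
  finite to countable additivity.\<close>

lemma sums_indicator:
  assumes A: "\<And>n::nat. A n \<in> sets lebesgue" "bounded (\<Union>n. A n)" and disj: "disjoint_family A"
  shows "(\<lambda>n. \<xi> (indicator (A n))) sums \<xi> (indicator (\<Union>n. A n))"
proof -
  have b: "bounded (A n)" for n using A(2) by (rule bounded_subset) blast
  have Abs: "indicator (A n) \<in> bounded_support" for n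
    by (rule indicator_bounded_support[OF A(1) b])
  have part: "\<xi> (\<lambda>x. \<Sum>i<n. indicator (A i) x) = (\<Sum>i<n. \<xi> (indicator (A i)))" for n
  proof (induction n)
    case 0
    have "indicator {} \<in> support_closure"
      by (intro bounded_support_closure indicator_bounded_support) auto
    from linear[OF this this, of 0 0] show ?case by simp
  next
    case (Suc n)
    have "(\<lambda>x. \<Sum>i<n. 1 * indicator (A i) x) \<in> bounded_support"
      by (rule bounded_support_sum) (auto intro: Abs)
    then show ?case
      using linear[of "\<lambda>x. \<Sum>i<n. indicator (A i) x" "indicator (A n)" 1 1] Abs Suc
      by (simp add: bounded_support_closure)
  qed
  have ind: "(\<Sum>i<n. indicator (A i) x :: real) = indicator (\<Union>i<n. A i) x" for n x
    using disj by (intro indicator_UN_disjoint[symmetric]) (auto simp: disjoint_family_on_def)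
  obtain R where R: "\<And>x n. x \<in> A n \<Longrightarrow> norm x \<le> R" using A(2) by (auto simp: bounded_iff)
  have "(\<lambda>n. \<xi> (\<lambda>x. \<Sum>i<n. indicator (A i) x)) \<longlonglongrightarrow> \<xi> (indicator (\<Union>n. A n))"
  proof (rule tendsto_bounded_support)
    show "(\<lambda>x. \<Sum>i<n. indicator (A i) x) \<in> bounded_support" for n
      using bounded_support_sum[of "{..<n}" "\<lambda>i. indicator (A i)" "\<lambda>i. 1"] Abs by simp
    show "indicator (\<Union>n. A n) \<in> bounded_support"
      using A by (intro indicator_bounded_support) auto
    show "AE x in M. \<bar>\<Sum>i<n. indicator (A i) x :: real\<bar> \<le> 1 \<and> (R < norm x \<longrightarrow> (\<Sum>i<n. indicator (A i) x) = (0::real))" for n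
      unfolding ind using R by (intro AE_I2) (force simp: indicator_def)
    show "AE x in M. (\<lambda>n. \<Sum>i<n. indicator (A i) x) \<longlonglongrightarrow> (indicator (\<Union>n. A n) x :: real)"
      unfolding ind by (intro AE_I2 LIMSEQ_indicator_UN)
  qed
  then show ?thesis by (simp add: sums_def part)
qed

end

section \<open>The measure of a positive functional and its density\<close>

text \<open>Together with positivity, the majorant \<open>U\<close>, integrable over bounded sets,
  forces \<xi> to vanish on indicators of bounded null sets; this yields the absolute continuity
  behind the density.\<close>

locale positive_functional = dual_functional +
  fixes U :: "real^2 \<Rightarrow> real"
  assumes U_measurable: "U \<in> borel_measurable M"
    and U_integrable: "\<And>A. A \<in> sets lebesgue \<Longrightarrow> A \<subseteq> \<Omega> \<Longrightarrow> bounded A \<Longrightarrow>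
      integrable M (\<lambda>x. indicator A x * U x)"
    and positive: "\<And>A. A \<in> sets lebesgue \<Longrightarrow> A \<subseteq> \<Omega> \<Longrightarrow> bounded A \<Longrightarrow> 0 \<le> \<xi> (indicator A)"
    and le_U: "\<And>A. A \<in> sets lebesgue \<Longrightarrow> A \<subseteq> \<Omega> \<Longrightarrow> bounded A \<Longrightarrow>
      \<xi> (indicator A) \<le> (LINT x|M. indicator A x * U x)"
begin

text \<open>Bounded sets are those whose indicators are known to be arguments of \<xi>, so an
  unbounded set is measured piece by piece. Half-open shells make the pieces disjoint.\<close>

definition annulus :: "nat \<Rightarrow> (real^2) set" where
  "annulus n = {x. real n \<le> norm x \<and> norm x < real n + 1}"

lemma annulus: "annulus n \<in> sets lebesgue" "bounded (annulus n)" "disjoint_family annulus" "(\<Union>n. annulus n) = UNIV"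
proof -
  have "annulus n = ball 0 (real n + 1) - ball 0 (real n)" by (auto simp: annulus_def)
  then show "annulus n \<in> sets lebesgue" by simp
  show "bounded (annulus n)"
    by (rule bounded_subset[of "ball 0 (real n + 1)"]) (auto simp: annulus_def)
  show "disjoint_family annulus"
  proof -
    have "i = j" if "x \<in> annulus i" "x \<in> annulus j" for x i j
    proof -
      have "real i < real j + 1" "real j < real i + 1" using that by (auto simp: annulus_def)
      then show ?thesis by linarith
    qed
    then show ?thesis by (auto simp: disjoint_family_on_def)
  qed
  show "(\<Union>n. annulus n) = UNIV"
  proof safe
    fix x :: "real^2"
    have "x \<in> annulus (nat \<lfloor>norm x\<rfloor>)" by (simp add: annulus_def)
    then show "x \<in> (\<Union>n. annulus n)" by blast
  qed auto
qed

definition \<nu> :: "(real^2) measure" where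
  "\<nu> = measure_of \<Omega> (sets M) (\<lambda>A. \<Sum>n. ennreal (\<xi> (indicator (A \<inter> annulus n))))"

lemma sets_iff: "A \<in> sets M \<longleftrightarrow> A \<in> sets lebesgue \<and> A \<subseteq> \<Omega>"
  using domain_sets by (subst sets_restrict_space_iff) auto

lemma sets_\<nu>: "sets \<nu> = sets M"
proof -
  have "sigma_algebra \<Omega> (sets M)"
    using sets.sigma_algebra_axioms[of M] by simp
  then show ?thesis unfolding \<nu>_def by (rule sigma_algebra.sets_measure_of_eq)
qed

lemma suminf_indicator:
  assumes A: "\<And>n::nat. A n \<in> sets lebesgue" "\<And>n. A n \<subseteq> \<Omega>" "bounded (\<Union>n. A n)" and disj: "disjoint_family A"
  shows "(\<Sum>n. ennreal (\<xi> (indicator (A n)))) = ennreal (\<xi> (indicator (\<Union>n. A n)))"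
proof (rule suminf_ennreal_eq)
  show "0 \<le> \<xi> (indicator (A n))" for n
    by (rule positive[OF A(1,2)]) (rule bounded_subset[OF A(3)], blast)
  show "(\<lambda>n. \<xi> (indicator (A n))) sums \<xi> (indicator (\<Union>n. A n))"
    by (rule sums_indicator[OF A(1,3) disj])
qed

text \<open>Countable additivity holds inside each shell; exchanging two series of nonnegative terms
  makes it global.\<close>

lemma emeasure_\<nu>:
  assumes A: "A \<in> sets M"
  shows "emeasure \<nu> A = (\<Sum>n. ennreal (\<xi> (indicator (A \<inter> annulus n))))"
  unfolding \<nu>_def
proof (rule emeasure_measure_of_sigma[OF _ _ _ A])
  show "sigma_algebra \<Omega> (sets M)"
    using sets.sigma_algebra_axioms[of M] by simp
  have "indicator {} \<in> support_closure"
    by (intro bounded_support_closure indicator_bounded_support) auto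
  from linear[OF this this, of 0 0] have "\<xi> (indicator {}) = 0" by (simp add: indicator_def[abs_def])
  then show "positive (sets M) (\<lambda>A. \<Sum>n. ennreal (\<xi> (indicator (A \<inter> annulus n))))"
    by (simp add: positive_def)
  show "countably_additive (sets M) (\<lambda>A. \<Sum>n. ennreal (\<xi> (indicator (A \<inter> annulus n))))"
  proof (rule countably_additiveI)
    fix A :: "nat \<Rightarrow> (real^2) set"
    assume A: "range A \<subseteq> sets M" "disjoint_family A"
    have As: "A i \<in> sets lebesgue" "A i \<subseteq> \<Omega>" for i using A(1) sets_iff by auto
    have "(\<Sum>i. \<Sum>n. ennreal (\<xi> (indicator (A i \<inter> annulus n)))) = (\<Sum>n. \<Sum>i. ennreal (\<xi> (indicator (A i \<inter> annulus n))))"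
      by (rule suminf_swap_ennreal)
    also have "\<dots> = (\<Sum>n. ennreal (\<xi> (indicator (\<Union>i. A i \<inter> annulus n))))"
    proof (intro arg_cong[where f=suminf] ext suminf_indicator)
      show "A i \<inter> annulus n \<in> sets lebesgue" for i n using As annulus by blast
      show "A i \<inter> annulus n \<subseteq> \<Omega>" for i n using As by blast
      show "bounded (\<Union>i. A i \<inter> annulus n)" for n
        by (rule bounded_subset[OF annulus(2)[of n]]) blast
      show "disjoint_family (\<lambda>i. A i \<inter> annulus n)" for n
        using A(2) unfolding disjoint_family_on_def by blast
    qed
    also have "\<dots> = (\<Sum>n. ennreal (\<xi> (indicator ((\<Union>i. A i) \<inter> annulus n))))"
      by (simp only: UN_simps)
    finally show "(\<Sum>i. \<Sum>n. ennreal (\<xi> (indicator (A i \<inter> annulus n)))) =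
        (\<Sum>n. ennreal (\<xi> (indicator ((\<Union>i. A i) \<inter> annulus n))))" .
  qed
qed

lemma emeasure_\<nu>_bounded:
  assumes A: "A \<in> sets lebesgue" "A \<subseteq> \<Omega>" "bounded A"
  shows "emeasure \<nu> A = ennreal (\<xi> (indicator A))"
proof -
  have "emeasure \<nu> A = (\<Sum>n. ennreal (\<xi> (indicator (A \<inter> annulus n))))"
    by (rule emeasure_\<nu>) (use A sets_iff in blast)
  also have "\<dots> = ennreal (\<xi> (indicator (\<Union>n. A \<inter> annulus n)))"
  proof (rule suminf_indicator)
    show "disjoint_family (\<lambda>n. A \<inter> annulus n)"
      using annulus(3) unfolding disjoint_family_on_def by blast
    show "bounded (\<Union>n. A \<inter> annulus n)" by (rule bounded_subset[OF A(3)]) blast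
  qed (use A annulus in auto)
  also have "(\<Union>n. A \<inter> annulus n) = A" using annulus(4) by blast
  finally show ?thesis .
qed

lemma representation_indicator:
  obtains z where "z \<in> borel_measurable M" "\<And>x. 0 \<le> z x"
    "\<And>A. A \<in> sets lebesgue \<Longrightarrow> A \<subseteq> \<Omega> \<Longrightarrow> bounded A \<Longrightarrow>
      has_bochner_integral M (\<lambda>x. indicator A x * z x) (\<xi> (indicator A))"
proof -
  have sf: "sigma_finite_measure M"
  proof (rule sigma_finite_measure_restrict_space[OF _ domain_sets])
    show "sigma_finite_measure (lebesgue :: (real^2) measure)"
    proof
      have "emeasure lebesgue a \<noteq> \<infinity>" if "a \<in> range annulus" for a
        using that fmeasurableD2[OF bounded_set_imp_lmeasurable[OF annulus(2,1)]] by fastforce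
      then show "\<exists>A::(real^2) set set. countable A \<and> A \<subseteq> sets lebesgue \<and> \<Union>A = space lebesgue \<and>
          (\<forall>a\<in>A. emeasure lebesgue a \<noteq> \<infinity>)"
        using annulus by (intro exI[of _ "range annulus"]) auto
    qed
  qed
  have ac: "absolutely_continuous M \<nu>"
    unfolding absolutely_continuous_def
  proof
    fix A assume A: "A \<in> null_sets M"
    then have As: "A \<in> sets lebesgue" "A \<subseteq> \<Omega>" using sets_iff by auto
    have "\<xi> (indicator (A \<inter> annulus n)) = 0" for n
    proof -
      have B: "A \<inter> annulus n \<in> sets lebesgue" "A \<inter> annulus n \<subseteq> \<Omega>" "bounded (A \<inter> annulus n)"
        using As annulus by (auto intro: bounded_Int)
      have "AE x in M. x \<notin> A" using A by (rule AE_not_in)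
      then have "AE x in M. indicator (A \<inter> annulus n) x * U x = 0"
        by eventually_elim simp
      then have "(LINT x|M. indicator (A \<inter> annulus n) x * U x) = 0"
        by (rule integral_eq_zero_AE)
      then show ?thesis using le_U[OF B] positive[OF B] by simp
    qed
    then have "emeasure \<nu> A = 0" using A by (subst emeasure_\<nu>) auto
    then show "A \<in> null_sets \<nu>" using A sets_\<nu> by (auto simp: null_sets_def)
  qed
  from sigma_finite_measure.Radon_Nikodym[OF sf ac sets_\<nu>]
  obtain g where g [measurable]: "g \<in> borel_measurable M" and dens: "density M g = \<nu>"
    by blast
  have g_int: "(\<integral>\<^sup>+x. g x * indicator A x \<partial>M) = ennreal (\<xi> (indicator A))"
    if A: "A \<in> sets lebesgue" "A \<subseteq> \<Omega>" "bounded A" for A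
  proof -
    have "A \<in> sets M" using A sets_iff by blast
    then have "emeasure \<nu> A = (\<integral>\<^sup>+x. g x * indicator A x \<partial>M)"
      unfolding dens[symmetric] by (rule emeasure_density[OF g])
    then show ?thesis using emeasure_\<nu>_bounded[OF A] by simp
  qed
  \<comment> \<open>The Radon-Nikodym density has values in \<open>ennreal\<close>; its finite
    integral over each bounded shell excludes infinity almost everywhere, so a real density may be
    taken.\<close>
  have "AE x in M. x \<in> annulus n \<longrightarrow> g x \<noteq> \<infinity>" for n
  proof -
    have B: "\<Omega> \<inter> annulus n \<in> sets lebesgue" "\<Omega> \<inter> annulus n \<subseteq> \<Omega>" "bounded (\<Omega> \<inter> annulus n)"
      using domain_sets annulus by (auto intro: bounded_Int)
    have Bs [measurable]: "\<Omega> \<inter> annulus n \<in> sets M" using B sets_iff by blast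
    have "AE x in M. g x * indicator (\<Omega> \<inter> annulus n) x \<noteq> \<infinity>"
      by (rule nn_integral_PInf_AE) (use g_int[OF B] in auto)
    then show ?thesis
      using AE_space by eventually_elim (auto simp: indicator_def)
  qed
  then have "AE x in M. \<forall>n. x \<in> annulus n \<longrightarrow> g x \<noteq> \<infinity>"
    by (subst AE_all_countable) blast
  then have fin: "AE x in M. g x \<noteq> \<infinity>"
    by eventually_elim (use annulus(4) in blast)
  show ?thesis
  proof (rule that[of "\<lambda>x. enn2real (g x)"])
    show "(\<lambda>x. enn2real (g x)) \<in> borel_measurable M" by measurable
    fix A assume A: "A \<in> sets lebesgue" "A \<subseteq> \<Omega>" "bounded A"
    show "has_bochner_integral M (\<lambda>x. indicator A x * enn2real (g x)) (\<xi> (indicator A))"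
    proof (rule has_bochner_integral_nn_integral)
      show "(\<lambda>x. indicator A x * enn2real (g x)) \<in> borel_measurable M"
        using indicator_measurable[OF A(1)] by (intro borel_measurable_times) auto
      have "(\<integral>\<^sup>+x. ennreal (indicator A x * enn2real (g x)) \<partial>M) = (\<integral>\<^sup>+x. g x * indicator A x \<partial>M)"
      proof (rule nn_integral_cong_AE)
        show "AE x in M. ennreal (indicator A x * enn2real (g x)) = g x * indicator A x"
          using fin by eventually_elim (auto simp: indicator_def less_top)
      qed
      then show "(\<integral>\<^sup>+x. ennreal (indicator A x * enn2real (g x)) \<partial>M) = ennreal (\<xi> (indicator A))"
        using g_int[OF A] by simp
      show "0 \<le> \<xi> (indicator A)" by (rule positive[OF A])
    qed simp
  qed simp
qed

text \<open>The last clause reaches the whole Orlicz space: truncations of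
  \<open>\<bar>v\<bar>\<close> have bounded support, where the pairing equals \<xi>, and Fatou's
  lemma removes the truncation. It gives integrability of \<open>z * v\<close> here and membership
  of \<open>z\<close> in the conjugate space later.\<close>

lemma representation:
  obtains z where "z \<in> borel_measurable M" "\<And>x. 0 \<le> z x"
    "\<And>A. A \<in> sets lebesgue \<Longrightarrow> A \<subseteq> \<Omega> \<Longrightarrow> bounded A \<Longrightarrow>
      has_bochner_integral M (\<lambda>x. indicator A x * z x) (\<xi> (indicator A))"
    "\<And>v. v \<in> support_closure \<Longrightarrow> has_bochner_integral M (\<lambda>x. z x * v x) (\<xi> v)"
    "\<And>C v. (\<And>v. v \<in> support_closure \<Longrightarrow> \<bar>\<xi> v\<bar> \<le> C * N v) \<Longrightarrow> C \<ge> 0 \<Longrightarrow> v \<in> L \<Longrightarrow>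
      (\<integral>\<^sup>+x. ennreal (z x * \<bar>v x\<bar>) \<partial>M) \<le> ennreal (C * N v)"
proof -
  obtain z where z [measurable]: "z \<in> borel_measurable M" and z0: "\<And>x. 0 \<le> z x"
    and zA: "\<And>A. A \<in> sets lebesgue \<Longrightarrow> A \<subseteq> \<Omega> \<Longrightarrow> bounded A \<Longrightarrow>
      has_bochner_integral M (\<lambda>x. indicator A x * z x) (\<xi> (indicator A))"
    by (rule representation_indicator) blast
  have zb: "has_bochner_integral M (\<lambda>x. z x * w x) (\<xi> w)" if "w \<in> bounded_support" for w
    using that
  proof (induction rule: bounded_support_induct)
    case (indicator A)
    then show ?case using zA[of A] by (simp add: mult.commute)
  next
    case (lincomb u v a b)
    have "has_bochner_integral M (\<lambda>x. a * (z x * u x) + b * (z x * v x)) (a * \<xi> u + b * \<xi> v)"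
      using lincomb by (intro has_bochner_integral_add has_bochner_integral_mult_right)
    then show ?case
      using lincomb linear[of u v a b] by (simp add: bounded_support_closure algebra_simps)
  next
    case (limit u W C R)
    let ?B = "\<Omega> \<inter> cball 0 R"
    have B: "?B \<in> sets lebesgue" "?B \<subseteq> \<Omega>" "bounded ?B" using domain_sets by (auto intro: bounded_Int)
    have um: "u \<in> borel_measurable M" "W n \<in> borel_measurable M" for n
      using limit.hyps(1) limit.hyps(2)[of n] by (auto simp: bounded_support_def)
    have meas: "(\<lambda>x. z x * u x) \<in> borel_measurable M"
      "\<And>n. (\<lambda>x. z x * W n x) \<in> borel_measurable M"
      using um by measurable
    \<comment> \<open>The approximants share the bounded set \<open>?B\<close> as support, and
      \<open>zA\<close> makes \<open>z\<close> integrable over it.\<close>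
    have dom: "integrable M (\<lambda>x. C * (indicator ?B x * z x))"
      using zA[OF B] by (intro integrable_mult_right) (auto simp: has_bochner_integral_iff)
    have lim: "AE x in M. (\<lambda>n. z x * W n x) \<longlonglongrightarrow> z x * u x"
      using limit.hyps(4) by eventually_elim (intro tendsto_mult_left)
    have le: "AE x in M. norm (z x * W n x) \<le> C * (indicator ?B x * z x)" for n
      using limit.hyps(3)[of n] AE_space
    proof eventually_elim
      case (elim x)
      have "z x * \<bar>W n x\<bar> \<le> z x * C" using elim z0 by (intro mult_left_mono) auto
      then show ?case using elim z0[of x] by (cases "norm x \<le> R") (auto simp: abs_mult mult.commute)
    qed
    have "(\<lambda>n. LINT x|M. z x * W n x) \<longlonglongrightarrow> (LINT x|M. z x * u x)"
      by (rule integral_dominated_convergence[OF meas dom lim le])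
    moreover have "(LINT x|M. z x * W n x) = \<xi> (W n)" for n
      using limit.IH[of n] by (simp add: has_bochner_integral_iff)
    moreover have "(\<lambda>n. \<xi> (W n)) \<longlonglongrightarrow> \<xi> u"
      by (rule tendsto_bounded_support[OF limit.hyps(2,1,3,4)])
    ultimately have "(LINT x|M. z x * u x) = \<xi> u"
      using LIMSEQ_unique by auto
    moreover have "integrable M (\<lambda>x. z x * u x)"
      by (rule integrable_dominated_convergence[OF meas dom lim le])
    ultimately show ?case by (simp add: has_bochner_integral_iff)
  qed
  have zL: "(\<integral>\<^sup>+x. ennreal (z x * \<bar>v x\<bar>) \<partial>M) \<le> ennreal (C * N v)"
    if C: "\<And>v. v \<in> support_closure \<Longrightarrow> \<bar>\<xi> v\<bar> \<le> C * N v" "C \<ge> 0" and v: "v \<in> L" for C v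
  proof -
    note [measurable] = L_measurable[OF v] norm_measurable
    define W where "W n x = (if norm x \<le> real n then min \<bar>v x\<bar> (real n) else 0)" for n x
    have Wm [measurable]: "W n \<in> borel_measurable M" for n unfolding W_def by measurable
    have "AE x in M. \<bar>W n x\<bar> \<le> real n \<and> (real n < norm x \<longrightarrow> W n x = 0)" for n
      by (intro AE_I2) (auto simp: W_def)
    then have Wb: "W n \<in> bounded_support" for n using Wm unfolding bounded_support_def by blast
    have W0: "0 \<le> W n x" "W n x \<le> \<bar>v x\<bar>" for n x by (auto simp: W_def)
    show ?thesis
    proof (rule nn_integral_limit_le)
      show "(\<lambda>x. ennreal (z x * W n x)) \<in> borel_measurable M" for n by measurable
      show "(\<lambda>x. ennreal (z x * \<bar>v x\<bar>)) \<in> borel_measurable M" by measurable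
      show "AE x in M. (\<lambda>n. ennreal (z x * W n x)) \<longlonglongrightarrow> ennreal (z x * \<bar>v x\<bar>)"
      proof (intro AE_I2 tendsto_eventually)
        fix x
        obtain m where m: "max (norm x) \<bar>v x\<bar> \<le> real m" using real_arch_simple by blast
        show "\<forall>\<^sub>F n in sequentially. ennreal (z x * W n x) = ennreal (z x * \<bar>v x\<bar>)"
          using eventually_ge_at_top[of m]
        proof eventually_elim
          case (elim n)
          then have "real m \<le> real n" by simp
          then have "W n x = \<bar>v x\<bar>" using m by (auto simp: W_def)
          then show ?case by simp
        qed
      qed
      show "(\<integral>\<^sup>+x. ennreal (z x * W n x) \<partial>M) \<le> ennreal (C * N v)" for n
      proof -
        have "(\<integral>\<^sup>+x. ennreal (z x * W n x) \<partial>M) = ennreal (LINT x|M. z x * W n x)"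
          using zb[OF Wb[of n]] z0 W0 by (intro nn_integral_eq_integral) (auto simp: has_bochner_integral_iff)
        also have "(LINT x|M. z x * W n x) = \<xi> (W n)"
          using zb[OF Wb[of n]] by (simp add: has_bochner_integral_iff)
        also have "\<xi> (W n) \<le> C * N (W n)" using C(1)[OF bounded_support_closure[OF Wb[of n]]] by linarith
        also have "\<dots> \<le> C * N v"
          using C(2) W0 by (intro mult_left_mono N_mono v) auto
        finally show ?thesis by (simp add: ennreal_leI)
      qed
    qed
  qed
  obtain C where C: "C \<ge> 1" "\<And>v. v \<in> support_closure \<Longrightarrow> \<bar>\<xi> v\<bar> \<le> C * N v" by (rule bound) blast
  have zE: "has_bochner_integral M (\<lambda>x. z x * v x) (\<xi> v)" if v: "v \<in> support_closure" for v
  proof -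
    have int: "integrable M (\<lambda>x. z x * v x)" "\<bar>LINT x|M. z x * v x\<bar> \<le> C * N v"
      if v: "v \<in> L" for v
    proof -
      note [measurable] = L_measurable[OF v]
      have eq: "(\<integral>\<^sup>+x. ennreal (norm (z x * v x)) \<partial>M) = (\<integral>\<^sup>+x. ennreal (z x * \<bar>v x\<bar>) \<partial>M)"
        using z0 by (simp add: abs_mult)
      have le: "(\<integral>\<^sup>+x. ennreal (norm (z x * v x)) \<partial>M) \<le> ennreal (C * N v)"
        unfolding eq by (rule zL) (use C v in auto)
      show i: "integrable M (\<lambda>x. z x * v x)"
      proof (rule integrableI_bounded)
        show "(\<integral>\<^sup>+x. ennreal (norm (z x * v x)) \<partial>M) < \<infinity>"
          using le by (rule le_less_trans) simp
      qed measurable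
      have "ennreal (norm (LINT x|M. z x * v x)) \<le> ennreal (C * N v)"
        using integral_norm_bound_ennreal[OF i] le by (rule order_trans)
      moreover have "0 \<le> C * N v" using C(1) N_nonneg[OF L_modular[OF v]] by simp
      ultimately show "\<bar>LINT x|M. z x * v x\<bar> \<le> C * N v"
        by (simp add: ennreal_le_iff)
    qed
    \<comment> \<open>Both sides depend on \<open>v\<close> with the same norm constant
      \<open>C\<close>, so replacing \<open>v\<close> by a nearby \<open>w\<close> costs at most
      \<open>e / 2\<close> on each side.\<close>
    have "\<bar>\<xi> v - (LINT x|M. z x * v x)\<bar> \<le> 0"
    proof (rule field_le_epsilon)
      fix e :: real assume e: "e > 0"
      then have "e / (2 * C) > 0" using C(1) by simp
      then obtain w where w: "w \<in> bounded_support" "N (\<lambda>x. v x - w x) < e / (2 * C)"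
        using v by (auto simp: support_closure_def)
      have vL: "v \<in> L" and wL: "w \<in> L" using v w(1) by (auto intro: support_closure_L bounded_support_L)
      have dE: "(\<lambda>x. v x - w x) \<in> support_closure"
        by (intro support_closure_diff v bounded_support_closure w)
      have CN: "C * N (\<lambda>x. v x - w x) \<le> e / 2"
      proof -
        have "C * N (\<lambda>x. v x - w x) \<le> C * (e / (2 * C))" using w(2) C(1) by (intro mult_left_mono) auto
        then show ?thesis using C(1) by simp
      qed
      have 1: "\<xi> v - \<xi> w = \<xi> (\<lambda>x. v x - w x)"
        using diff[OF v bounded_support_closure[OF w(1)]] by simp
      have 2: "(LINT x|M. z x * v x) - \<xi> w = (LINT x|M. z x * (v x - w x))"
        using zb[OF w(1)] int(1)[OF vL] by (simp add: has_bochner_integral_iff right_diff_distrib)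
      have "\<bar>\<xi> (\<lambda>x. v x - w x)\<bar> \<le> e / 2" using C(2)[OF dE] CN by linarith
      moreover have "\<bar>LINT x|M. z x * (v x - w x)\<bar> \<le> e / 2"
        using int(2)[OF support_closure_L[OF dE]] CN by linarith
      ultimately show "\<bar>\<xi> v - (LINT x|M. z x * v x)\<bar> \<le> 0 + e"
        using 1 2 by linarith
    qed
    then show ?thesis using int(1)[OF support_closure_L[OF v]] by (simp add: has_bochner_integral_iff)
  qed
  show ?thesis by (rule that[OF z z0 zA zE zL])
qed

end

section \<open>The conjugate function\<close>

text \<open>The derivative of \<open>Phi\<close>.\<close>

definition Phi_slope :: "real \<Rightarrow> real" where
  "Phi_slope t = 2 * t * exp (t\<^sup>2)"

lemma Phi_slope_strict_mono:
  assumes "0 \<le> s" "s < t"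
  shows "Phi_slope s < Phi_slope t"
proof -
  have "exp (s\<^sup>2) \<le> exp (t\<^sup>2)" using assms by (simp add: power_mono)
  then have "2 * s * exp (s\<^sup>2) \<le> 2 * s * exp (t\<^sup>2)" using assms by (intro mult_left_mono) auto
  also have "\<dots> < 2 * t * exp (t\<^sup>2)" using assms by simp
  finally show ?thesis by (simp add: Phi_slope_def)
qed

text \<open>The inverse of the derivative on the nonnegative half line; \<open>max s 0\<close> makes
  it total and monotone on the line, hence Borel measurable.\<close>

definition Phi_slope_inv :: "real \<Rightarrow> real" where
  "Phi_slope_inv s = (SOME t. 0 \<le> t \<and> Phi_slope t = max s 0)"

lemma Phi_slope_inv: "0 \<le> Phi_slope_inv s" "Phi_slope (Phi_slope_inv s) = max s 0"
proof -
  define m where "m = max s 0"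
  have m: "0 \<le> m" by (simp add: m_def)
  have "1 * m \<le> 2 * exp (m\<^sup>2) * m"
  proof (rule mult_right_mono[OF _ m])
    have "1 \<le> exp (m\<^sup>2)" by simp
    then show "1 \<le> 2 * exp (m\<^sup>2)" by linarith
  qed
  \<comment> \<open>The right endpoint for the intermediate value theorem on
    \<open>{0..m}\<close>.\<close>
  then have up: "m \<le> Phi_slope m" by (simp add: Phi_slope_def mult_ac)
  have "\<exists>t\<ge>0. t \<le> m \<and> Phi_slope t = m"
  proof (rule IVT')
    show "continuous_on {0..m} Phi_slope"
      unfolding Phi_slope_def by (intro continuous_intros)
  qed (use m up in \<open>auto simp: Phi_slope_def\<close>)
  then have "\<exists>t. 0 \<le> t \<and> Phi_slope t = max s 0" by (auto simp: m_def)
  then show "0 \<le> Phi_slope_inv s" "Phi_slope (Phi_slope_inv s) = max s 0"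
    unfolding Phi_slope_inv_def by (metis (mono_tags, lifting) someI_ex)+
qed

lemma mono_Phi_slope_inv: "mono Phi_slope_inv"
proof (rule monoI, rule ccontr)
  fix s t :: real assume st: "s \<le> t" "\<not> Phi_slope_inv s \<le> Phi_slope_inv t"
  then have "Phi_slope (Phi_slope_inv t) < Phi_slope (Phi_slope_inv s)"
    by (intro Phi_slope_strict_mono Phi_slope_inv) auto
  then show False using st(1) by (simp add: Phi_slope_inv(2)) linarith
qed

lemma Phi_slope_inv_0: "Phi_slope_inv 0 = 0"
  using Phi_slope_inv[of 0] by (simp add: Phi_slope_def)

text \<open>The bound \<open>exp x \<ge> 1 + x\<close> is used at \<open>x = r^2 - t^2\<close>,
  which is at least \<open>2 * t * (r - t)\<close>.\<close>

lemma Phi_tangent_le: "0 \<le> t \<Longrightarrow> Phi t + Phi_slope t * (r - t) \<le> Phi r"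
proof -
  assume t: "0 \<le> t"
  have "2 * t * (r - t) \<le> r\<^sup>2 - t\<^sup>2"
    using zero_le_power2[of "r - t"] by (simp add: power2_eq_square algebra_simps)
  then have "1 + 2 * t * (r - t) \<le> exp (r\<^sup>2 - t\<^sup>2)"
    using exp_ge_add_one_self[of "r\<^sup>2 - t\<^sup>2"] by linarith
  then have "exp (t\<^sup>2) * (1 + 2 * t * (r - t)) \<le> exp (t\<^sup>2) * exp (r\<^sup>2 - t\<^sup>2)"
    by (intro mult_left_mono) auto
  also have "\<dots> = exp (r\<^sup>2)" by (simp add: exp_add[symmetric])
  finally show ?thesis by (simp add: Phi_def Phi_slope_def algebra_simps)
qed

text \<open>Equality in Young's inequality: by convexity the supremum is attained where the
  derivative of \<open>Phi\<close> equals \<open>s\<close>.\<close>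

lemma conjugate_Phi_eq:
  assumes s: "0 \<le> s"
  shows "conjugate_N Phi s = s * Phi_slope_inv s - Phi (Phi_slope_inv s)"
  unfolding conjugate_N_def
proof (rule cSup_eq_maximum)
  show "s * Phi_slope_inv s - Phi (Phi_slope_inv s) \<in> (\<lambda>t. s * t - Phi t) ` {0..}"
    using Phi_slope_inv(1) by auto
  fix y assume "y \<in> (\<lambda>t. s * t - Phi t) ` {0..}"
  then obtain t where "y = s * t - Phi t" by blast
  then show "y \<le> s * Phi_slope_inv s - Phi (Phi_slope_inv s)"
    using Phi_tangent_le[OF Phi_slope_inv(1)[of s], of t] s
    by (simp add: Phi_slope_inv(2) right_diff_distrib)
qed

lemma conjugate_Phi_nonneg:
  assumes "0 \<le> s"
  shows "0 \<le> conjugate_N Phi s"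
  using Phi_tangent_le[OF Phi_slope_inv(1)[of s], of 0] assms
  by (simp add: conjugate_Phi_eq Phi_slope_inv(2))

section \<open>Membership in the conjugate Orlicz space\<close>

text \<open>Convexity with the factor \<open>1 / (1 + I)\<close> lowers the modular from
  \<open>I\<close> to \<open>I / (1 + I)\<close>, which is below 1.\<close>

lemma (in lebesgue_domain) N_le_modular_integral:
  assumes [measurable]: "t \<in> borel_measurable M"
    and I: "(\<integral>\<^sup>+x. ennreal (Phi (t x)) \<partial>M) = ennreal I" "0 \<le> I"
  shows "N t \<le> 1 + I"
proof (rule N_le)
  have "(\<integral>\<^sup>+x. ennreal (Phi (t x / (1 + I))) \<partial>M) \<le>
      (\<integral>\<^sup>+x. ennreal (1 / (1 + I)) * ennreal (Phi (t x)) \<partial>M)"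
  proof (rule nn_integral_mono)
    fix x
    have "Phi (t x / (1 + I)) \<le> 1 / (1 + I) * Phi (t x)"
      using Phi_scale_le[of "1 / (1 + I)" "t x"] I(2) by simp
    then show "ennreal (Phi (t x / (1 + I))) \<le> ennreal (1 / (1 + I)) * ennreal (Phi (t x))"
      using I(2) by (subst ennreal_mult[symmetric]) (auto simp: Phi_nonneg intro: ennreal_leI)
  qed
  also have "\<dots> = ennreal (1 / (1 + I)) * ennreal I"
    by (subst nn_integral_cmult) (simp_all add: I)
  also have "\<dots> = ennreal (I / (1 + I))" using I(2) by (simp add: ennreal_mult[symmetric])
  also have "\<dots> \<le> ennreal 1" using I(2) by (intro ennreal_leI) simp
  finally show "1 + I \<in> modular t" using I(2) by (simp add: modular_iff)
qed

text \<open>At \<open>t = Phi_slope_inv (Z n)\<close> the product \<open>Z n * t\<close> is the sum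
  of the conjugate of \<open>Z n\<close> and of \<open>Phi t\<close>. The pairing bounds its
  integral by \<open>N t\<close>, hence by 1 plus the integral of \<open>Phi t\<close>; cancelling
  the latter leaves a conjugate modular of at most 1, and \<open>C\<close> becomes an admissible
  level of \<open>z\<close>.\<close>

lemma (in lebesgue_domain) conjugate_orlicz_of_bounded_pairing:
  assumes z [measurable]: "z \<in> borel_measurable M" and z0: "\<And>x. 0 \<le> z x"
    and C: "C \<ge> 1" "\<And>v. v \<in> L \<Longrightarrow> (\<integral>\<^sup>+x. ennreal (z x * \<bar>v x\<bar>) \<partial>M) \<le> ennreal (C * N v)"
  shows "z \<in> orlicz_space (conjugate_N Phi) \<Omega>"
proof -
  note [measurable] = borel_measurable_mono[OF mono_Phi_slope_inv] norm_measurable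
  \<comment> \<open>Truncation in size and support makes \<open>t\<close> below bounded with bounded
    support, so the integral to be cancelled is finite.\<close>
  define Z where "Z n x = (if norm x \<le> real n then min (z x / C) (real n) else 0)" for n x
  have Zm [measurable]: "Z n \<in> borel_measurable M" for n unfolding Z_def by measurable
  have Z0: "0 \<le> Z n x" "Z n x \<le> z x / C" for n x using z0 C(1) by (auto simp: Z_def)
  have zC: "0 \<le> z x / C" for x using z0 C(1) by simp
  have meas: "(\<lambda>x. ennreal (conjugate_N Phi (g x))) \<in> borel_measurable M"
    if [measurable]: "g \<in> borel_measurable M" and "\<And>x. 0 \<le> g x" for g
    using that(2) by (simp add: conjugate_Phi_eq)
  have "(\<integral>\<^sup>+x. ennreal (conjugate_N Phi (z x / C)) \<partial>M) \<le> 1"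
  proof (rule nn_integral_limit_le)
    show "(\<lambda>x. ennreal (conjugate_N Phi (Z n x))) \<in> borel_measurable M" for n
      by (rule meas[OF Zm Z0(1)])
    show "(\<lambda>x. ennreal (conjugate_N Phi (z x / C))) \<in> borel_measurable M"
      by (rule meas[OF _ zC]) measurable
    show "AE x in M. (\<lambda>n. ennreal (conjugate_N Phi (Z n x))) \<longlonglongrightarrow> ennreal (conjugate_N Phi (z x / C))"
    proof (intro AE_I2 tendsto_eventually)
      fix x
      obtain m where m: "max (norm x) (z x / C) \<le> real m" using real_arch_simple by blast
      show "\<forall>\<^sub>F n in sequentially. ennreal (conjugate_N Phi (Z n x)) = ennreal (conjugate_N Phi (z x / C))"
        using eventually_ge_at_top[of m]
      proof eventually_elim
        case (elim n)
        then have "real m \<le> real n" by simp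
        then have "Z n x = z x / C" using m by (auto simp: Z_def)
        then show ?case by simp
      qed
    qed
    show "(\<integral>\<^sup>+x. ennreal (conjugate_N Phi (Z n x)) \<partial>M) \<le> 1" for n
    proof -
      define t where "t x = Phi_slope_inv (Z n x)" for x
      have tm [measurable]: "t \<in> borel_measurable M" unfolding t_def by measurable
      have t0: "0 \<le> t x" for x by (simp add: t_def Phi_slope_inv)
      have t_le: "t x \<le> Phi_slope_inv (real n)" for x
        unfolding t_def by (rule monoD[OF mono_Phi_slope_inv]) (simp add: Z_def)
      have t_supp: "t x = 0" if "real n < norm x" for x
        using that by (simp add: t_def Z_def Phi_slope_inv_0)
      have "AE x in M. \<bar>t x\<bar> \<le> Phi_slope_inv (real n) \<and> (real n < norm x \<longrightarrow> t x = 0)"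
        using t0 t_le t_supp by (intro AE_I2) auto
      then have tb: "t \<in> bounded_support" using tm unfolding bounded_support_def by blast
      have "(\<integral>\<^sup>+x. ennreal (Phi (t x)) \<partial>M) \<le>
          (\<integral>\<^sup>+x. ennreal (Phi (Phi_slope_inv (real n))) * indicator (cball 0 (real n)) x \<partial>M)"
      proof (rule nn_integral_mono)
        fix x
        have "Phi (t x) \<le> Phi (Phi_slope_inv (real n))"
          using t0[of x] t_le[of x] by (intro Phi_mono) linarith
        then show "ennreal (Phi (t x)) \<le> ennreal (Phi (Phi_slope_inv (real n))) * indicator (cball 0 (real n)) x"
          using t_supp[of x] by (auto simp: indicator_def intro: ennreal_leI)
      qed
      also have "\<dots> < \<infinity>"
      proof -
        have "(\<lambda>x. indicator (cball 0 (real n)) x :: ennreal) \<in> borel_measurable M"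
          by (intro restrict_lborel_measurable borel_measurable_indicator) auto
        then show ?thesis using cball_finite[of "real n"]
          by (subst nn_integral_cmult) (auto simp: ennreal_mult_less_top)
      qed
      finally obtain I where I: "(\<integral>\<^sup>+x. ennreal (Phi (t x)) \<partial>M) = ennreal I" "0 \<le> I"
        by (metis ennreal_cases less_irrefl infinity_ennreal_def)
      have NI: "N t \<le> 1 + I" by (rule N_le_modular_integral[OF tm I])
      have "(\<integral>\<^sup>+x. ennreal (conjugate_N Phi (Z n x)) \<partial>M) + ennreal I =
          (\<integral>\<^sup>+x. ennreal (conjugate_N Phi (Z n x)) + ennreal (Phi (t x)) \<partial>M)"
        using meas[OF Zm Z0(1)] by (simp add: nn_integral_add I)
      also have "\<dots> = (\<integral>\<^sup>+x. ennreal (Z n x * t x) \<partial>M)"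
      proof (rule nn_integral_cong)
        fix x
        have "ennreal (conjugate_N Phi (Z n x)) + ennreal (Phi (t x)) = ennreal (conjugate_N Phi (Z n x) + Phi (t x))"
          using Z0 by (intro ennreal_plus[symmetric] conjugate_Phi_nonneg Phi_nonneg)
        then show "ennreal (conjugate_N Phi (Z n x)) + ennreal (Phi (t x)) = ennreal (Z n x * t x)"
          using Z0 by (simp add: conjugate_Phi_eq t_def)
      qed
      also have "\<dots> \<le> (\<integral>\<^sup>+x. ennreal (1 / C) * ennreal (z x * \<bar>t x\<bar>) \<partial>M)"
      proof (rule nn_integral_mono)
        fix x
        have "Z n x * t x \<le> z x / C * t x" using Z0 t0 by (intro mult_right_mono) auto
        then show "ennreal (Z n x * t x) \<le> ennreal (1 / C) * ennreal (z x * \<bar>t x\<bar>)"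
          using C(1) z0 t0 by (subst ennreal_mult[symmetric]) (auto intro: ennreal_leI)
      qed
      also have "\<dots> = ennreal (1 / C) * (\<integral>\<^sup>+x. ennreal (z x * \<bar>t x\<bar>) \<partial>M)"
        by (rule nn_integral_cmult) measurable
      also have "\<dots> \<le> ennreal (1 / C) * ennreal (C * N t)"
        by (intro mult_left_mono C bounded_support_L tb) simp
      also have "\<dots> = ennreal (N t)"
        using C(1) N_nonneg[OF L_modular[OF bounded_support_L[OF tb]]] by (subst ennreal_mult[symmetric]) auto
      also have "\<dots> \<le> ennreal (1 + I)" using NI by (rule ennreal_leI)
      also have "\<dots> = 1 + ennreal I" using I(2) by simp
      finally show ?thesis
        by (simp add: ennreal_add_left_cancel_le add.commute[of _ "ennreal I"])
    qed
  qed
  then have "C \<in> modular_le_1 (conjugate_N Phi) \<Omega> z"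
    using C(1) z0 by (simp add: modular_le_1_def)
  then show ?thesis using z by (auto simp: orlicz_space_def)
qed

lemma (in lipschitz_problem) clarke_gradient_Psi_representation:
  assumes u: "u \<in> support_closure"
    and \<xi>: "\<xi> \<in> clarke_gradient support_closure N (Psi f \<Omega>) u"
  shows "\<exists>z \<in> orlicz_space (conjugate_N Phi) \<Omega>.
    (\<forall>v \<in> support_closure. has_bochner_integral M (\<lambda>x. z x * v x) (\<xi> v)) \<and>
    (AE x in M. z x \<in> clarke_gradient_real (F x) (u x) \<and>
       clarke_gradient_real (F x) (u x) = {f_lower f x (u x) .. f_upper f x (u x)})"
proof -
  have dual: "\<xi> \<in> dual_space support_closure N"
    and le: "\<And>v. v \<in> support_closure \<Longrightarrow> ereal (\<xi> v) \<le> clarke_derivative support_closure N (Psi f \<Omega>) u v"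
    using \<xi> by (auto simp: clarke_gradient_def)
  interpret dual_functional \<Omega> \<xi> by unfold_locales (rule dual)
  have um: "u \<in> borel_measurable M" by (intro L_measurable support_closure_L u)
  let ?U = "\<lambda>x. f_upper f x (u x)" and ?l = "\<lambda>x. f_lower f x (u x)"
  have Um: "?U \<in> borel_measurable M" and lm: "?l \<in> borel_measurable M"
    using N_meas um by (auto intro: N_measurable_comp)
  have Ub: "\<bar>?U x\<bar> \<le> (c1 + c2) * exp ((\<alpha>0 + 1) * (u x)\<^sup>2)" for x
    using f_upper_le[of "u x" "\<bar>u x\<bar>" x] f_upper_nonneg[of x "u x"] by simp
  have lb: "\<bar>- ?l x\<bar> \<le> (c1 + c2) * exp ((\<alpha>0 + 1) * (u x)\<^sup>2)" for x
    using Ub[of x] f_lower_nonneg[of x "u x"] f_lower_le_upper[of x "u x"] by simp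
  have lm': "(\<lambda>x. - ?l x) \<in> borel_measurable M" using lm by measurable
  have ind: "indicator A \<in> support_closure" if "A \<in> sets lebesgue" "bounded A" for A
    by (intro bounded_support_closure indicator_bounded_support that)
  have up: "integrable M (\<lambda>x. indicator A x * ?U x)"
    "\<xi> (indicator A) \<le> (LINT x|M. indicator A x * ?U x)"
    if A: "A \<in> sets lebesgue" "A \<subseteq> \<Omega>" "bounded A" for A
  proof -
    note * = clarke_derivative_Psi_le[OF u A _ _ Ub Um, of 1, OF _ clarke_derivative_f(1)]
    show "integrable M (\<lambda>x. indicator A x * ?U x)" by (rule *) simp
    show "\<xi> (indicator A) \<le> (LINT x|M. indicator A x * ?U x)"
      using order_trans[OF le[OF ind[OF A(1,3)]], of "ereal (LINT x|M. indicator A x * ?U x)"] *(2) by simp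
  qed
  have low: "integrable M (\<lambda>x. indicator A x * ?l x)"
    "(LINT x|M. indicator A x * ?l x) \<le> \<xi> (indicator A)"
    if A: "A \<in> sets lebesgue" "A \<subseteq> \<Omega>" "bounded A" for A
  proof -
    \<comment> \<open>Since -f_lower is the derivative in direction -1, the same upper estimate
      yields the lower bound for \<xi>.\<close>
    note * = clarke_derivative_Psi_le[OF u A _ _ lb lm', of "-1", OF _ clarke_derivative_f(2)]
    have "integrable M (\<lambda>x. indicator A x * - ?l x)" by (rule *) simp
    then show "integrable M (\<lambda>x. indicator A x * ?l x)" by simp
    have "(\<lambda>x. -1 * indicator A x :: real) \<in> support_closure"
      using support_closure_lincomb[OF ind ind, OF A(1,3) A(1,3), of "-1" 0] by simp
    from order_trans[OF le[OF this], of "ereal (LINT x|M. indicator A x * - ?l x)"] *(2)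
    have "\<xi> (\<lambda>x. -1 * indicator A x) \<le> (LINT x|M. indicator A x * - ?l x)" by simp
    moreover have "\<xi> (\<lambda>x. -1 * indicator A x) = - \<xi> (indicator A)"
      using linear[OF ind ind, OF A(1,3) A(1,3), of "-1" 0] by simp
    ultimately show "(LINT x|M. indicator A x * ?l x) \<le> \<xi> (indicator A)" by simp
  qed
  interpret positive_functional \<Omega> \<xi> ?U
  proof
    fix A assume A: "A \<in> sets lebesgue" "A \<subseteq> \<Omega>" "bounded A"
    have "0 \<le> (LINT x|M. indicator A x * ?l x)"
      using f_lower_nonneg by (intro Bochner_Integration.integral_nonneg) auto
    with low(2)[OF A] show "0 \<le> \<xi> (indicator A)" by simp
  qed (use Um up in auto)
  obtain z where z: "z \<in> borel_measurable M" "\<And>x. 0 \<le> z x"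
    and zA: "\<And>A. A \<in> sets lebesgue \<Longrightarrow> A \<subseteq> \<Omega> \<Longrightarrow> bounded A \<Longrightarrow>
      has_bochner_integral M (\<lambda>x. indicator A x * z x) (\<xi> (indicator A))"
    and zE: "\<And>v. v \<in> support_closure \<Longrightarrow> has_bochner_integral M (\<lambda>x. z x * v x) (\<xi> v)"
    and zL: "\<And>C v. (\<And>v. v \<in> support_closure \<Longrightarrow> \<bar>\<xi> v\<bar> \<le> C * N v) \<Longrightarrow> C \<ge> 0 \<Longrightarrow> v \<in> L \<Longrightarrow>
      (\<integral>\<^sup>+x. ennreal (z x * \<bar>v x\<bar>) \<partial>M) \<le> ennreal (C * N v)"
    by (rule representation) blast
  obtain C where C: "C \<ge> 1" "\<And>v. v \<in> support_closure \<Longrightarrow> \<bar>\<xi> v\<bar> \<le> C * N v" by (rule bound) blast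
  have "z \<in> orlicz_space (conjugate_N Phi) \<Omega>"
    by (rule conjugate_orlicz_of_bounded_pairing[OF z C(1)]) (use zL[OF C(2)] C(1) in simp)
  moreover have "AE x in M. z x \<le> ?U x"
    by (rule AE_le_of_integral_le[OF z(1) Um]) (use zA up in \<open>auto simp: has_bochner_integral_iff\<close>)
  moreover have "AE x in M. ?l x \<le> z x"
    by (rule AE_le_of_integral_le[OF lm z(1)]) (use zA low in \<open>auto simp: has_bochner_integral_iff\<close>)
  ultimately show ?thesis
    using zE by (intro bexI[of _ z] conjI) (auto simp: clarke_gradient_f)
qed

section \<open>Restriction to dense subspaces\<close>

text \<open>A continuous embedding makes the neighbourhood filter of \<open>X\<close> finer, and an
  upper limit along a finer filter is no larger.\<close>

lemma clarke_derivative_subspace_le: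
  assumes XV: "X \<subseteq> V" and C: "C > 0" "\<And>v. v \<in> X \<Longrightarrow> NV v \<le> C * NX v"
    and diff: "\<And>y. y \<in> X \<Longrightarrow> (\<lambda>x. y x - u x) \<in> X"
  shows "clarke_derivative X NX J u v \<le> clarke_derivative V NV J u v"
proof -
  have "nhds_in X NX u \<le> nhds_in V NV u"
  proof (rule filter_leI)
    fix P assume "eventually P (nhds_in V NV u)"
    then obtain \<epsilon> where \<epsilon>: "\<epsilon> > 0" "\<forall>y\<in>V. NV (\<lambda>x. y x - u x) < \<epsilon> \<longrightarrow> P y"
      unfolding eventually_nhds_in by blast
    have "P y" if y: "y \<in> X" "NX (\<lambda>x. y x - u x) < \<epsilon> / C" for y
    proof -
      have "NV (\<lambda>x. y x - u x) \<le> C * NX (\<lambda>x. y x - u x)" by (intro C diff y)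
      also have "\<dots> < \<epsilon>" using y(2) C(1) by (simp add: pos_less_divide_eq mult.commute)
      finally show ?thesis using \<epsilon>(2) y(1) XV by blast
    qed
    then show "eventually P (nhds_in X NX u)"
      unfolding eventually_nhds_in using \<epsilon>(1) C(1) by (intro exI[of _ "\<epsilon> / C"]) simp
  qed
  then have le: "nhds_in X NX u \<times>\<^sub>F at_right (0::real) \<le> nhds_in V NV u \<times>\<^sub>F at_right 0"
    by (intro prod_filter_mono) auto
  show ?thesis
    unfolding clarke_derivative_def
  proof (rule dense_ge)
    fix z
    assume "Limsup (nhds_in V NV u \<times>\<^sub>F at_right 0) (\<lambda>(y, h). ereal ((J (\<lambda>x. y x + h * v x) - J y) / h)) < z"
    then have "\<forall>\<^sub>F p in nhds_in V NV u \<times>\<^sub>F at_right 0. (\<lambda>(y, h). ereal ((J (\<lambda>x. y x + h * v x) - J y) / h)) p < z"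
      by (rule Limsup_lessD)
    then have "\<forall>\<^sub>F p in nhds_in X NX u \<times>\<^sub>F at_right 0. (\<lambda>(y, h). ereal ((J (\<lambda>x. y x + h * v x) - J y) / h)) p < z"
      using le by (rule filter_leD[rotated])
    then show "Limsup (nhds_in X NX u \<times>\<^sub>F at_right 0) (\<lambda>(y, h). ereal ((J (\<lambda>x. y x + h * v x) - J y) / h)) \<le> z"
      by (intro Limsup_bounded) (auto elim!: eventually_mono)
  qed
qed

context lipschitz_problem begin

text \<open>Replacing \<open>v'\<close> by \<open>v\<close> changes each quotient by at most
  \<open>K\<close> times the distance of the directions, once both displaced points lie in the ball
  of Lipschitz continuity. Comparison through a real bound \<open>b\<close> avoids arithmetic with
  possibly infinite derivatives.\<close>

lemma clarke_derivative_Psi_lipschitz: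
  assumes u: "u \<in> support_closure"
  obtains K where "K \<ge> 0" "\<And>v v' b. v \<in> support_closure \<Longrightarrow> v' \<in> support_closure \<Longrightarrow>
    clarke_derivative support_closure N (Psi f \<Omega>) u v' \<le> ereal b \<Longrightarrow>
    clarke_derivative support_closure N (Psi f \<Omega>) u v \<le> ereal (b + K * N (\<lambda>x. v x - v' x))"
proof -
  obtain r K0 where r: "r > 0" and K0: "\<And>y z. y \<in> support_closure \<Longrightarrow> z \<in> support_closure \<Longrightarrow>
     N (\<lambda>x. y x - u x) < r \<Longrightarrow> N (\<lambda>x. z x - u x) < r \<Longrightarrow>
     \<bar>Psi f \<Omega> y - Psi f \<Omega> z\<bar> \<le> K0 * N (\<lambda>x. y x - z x)"
    using Psi_lipschitz u unfolding locally_lipschitz_functional_def by blast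
  define K where "K = max K0 0"
  have Nnn: "0 \<le> N v" if "v \<in> support_closure" for v
    by (intro N_nonneg L_modular support_closure_L that)
  show ?thesis
  proof (rule that)
    show "K \<ge> 0" by (simp add: K_def)
    fix v v' b assume v: "v \<in> support_closure" and v': "v' \<in> support_closure"
      and b: "clarke_derivative support_closure N (Psi f \<Omega>) u v' \<le> ereal b"
    define c where "c = K * N (\<lambda>x. v x - v' x)"
    \<comment> \<open>Half of \<open>r\<close> is reserved for the base point; steps below
      \<open>h0\<close> use at most the other half.\<close>
    define h0 where "h0 = r / (2 * (N v + N v' + 1))"
    have h0: "h0 > 0" using r Nnn[OF v] Nnn[OF v'] by (simp add: h0_def add_nonneg_pos)
    show "clarke_derivative support_closure N (Psi f \<Omega>) u v \<le> ereal (b + K * N (\<lambda>x. v x - v' x))"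
    proof (rule ereal_le_epsilon2)
      fix e :: real assume "0 < e"
      let ?q = "\<lambda>v (y, h). ereal ((Psi f \<Omega> (\<lambda>x. y x + h * v x) - Psi f \<Omega> y) / h)"
      have "clarke_derivative support_closure N (Psi f \<Omega>) u v' < ereal (b + e)"
        using le_less_trans[OF b, of "ereal (b + e)"] \<open>0 < e\<close> by simp
      then have "\<forall>\<^sub>F p in nhds_in support_closure N u \<times>\<^sub>F at_right 0. ?q v' p < ereal (b + e)"
        unfolding clarke_derivative_def by (rule Limsup_lessD)
      moreover have "\<forall>\<^sub>F p in nhds_in support_closure N u \<times>\<^sub>F at_right 0. ?q v p \<le> ?q v' p + ereal c"
        unfolding eventually_prod_filter
      proof (intro exI conjI allI impI)
        show "\<forall>\<^sub>F y in nhds_in support_closure N u. y \<in> support_closure \<and> N (\<lambda>x. y x - u x) < r / 2"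
          unfolding eventually_nhds_in using r by (intro exI[of _ "r / 2"]) simp
        show "\<forall>\<^sub>F h in at_right 0. 0 < h \<and> h < h0"
          unfolding eventually_at_right_field using h0 by (intro exI[of _ h0]) simp
        fix y h
        assume y: "y \<in> support_closure \<and> N (\<lambda>x. y x - u x) < r / 2" and h: "0 < h \<and> h < h0"
        have near: "(\<lambda>x. y x + h * w x) \<in> support_closure" "N (\<lambda>x. y x + h * w x - u x) < r"
          if w: "w \<in> support_closure" "N w \<le> N v + N v'" for w
        proof -
          show "(\<lambda>x. y x + h * w x) \<in> support_closure" using y w by (intro support_closure_add_scaled) auto
          have "N (\<lambda>x. 1 * (y x - u x) + h * w x) \<le> \<bar>1\<bar> * N (\<lambda>x. y x - u x) + \<bar>h\<bar> * N w"
            using y w u by (intro N_lincomb_le L_diff support_closure_L) auto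
          moreover have "h * N w \<le> h0 * (N v + N v' + 1)"
            using h w Nnn[OF w(1)] by (intro mult_mono) auto
          moreover have "h0 * (N v + N v' + 1) = r / 2"
            using Nnn[OF v] Nnn[OF v'] by (simp add: h0_def field_simps)
          ultimately show "N (\<lambda>x. y x + h * w x - u x) < r"
            using y h by (simp add: algebra_simps)
        qed
        have "\<bar>Psi f \<Omega> (\<lambda>x. y x + h * v x) - Psi f \<Omega> (\<lambda>x. y x + h * v' x)\<bar> \<le>
            K0 * N (\<lambda>x. (y x + h * v x) - (y x + h * v' x))"
          using Nnn[OF v] Nnn[OF v'] by (intro K0 near v v') auto
        also have "\<dots> \<le> K * N (\<lambda>x. (y x + h * v x) - (y x + h * v' x))"
        proof (rule mult_right_mono)
          show "0 \<le> N (\<lambda>x. (y x + h * v x) - (y x + h * v' x))"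
            using Nnn[OF v] Nnn[OF v'] by (intro Nnn support_closure_diff near v v') auto
        qed (simp add: K_def)
        also have "N (\<lambda>x. (y x + h * v x) - (y x + h * v' x)) = N (\<lambda>x. h * (v x - v' x))"
          by (simp add: algebra_simps)
        also have "K * N (\<lambda>x. h * (v x - v' x)) \<le> K * (\<bar>h\<bar> * N (\<lambda>x. v x - v' x))"
          using v v' by (intro mult_left_mono N_scale_le L_diff support_closure_L) (simp_all add: K_def)
        also have "\<dots> = c * h" using h by (simp add: c_def)
        finally have "(Psi f \<Omega> (\<lambda>x. y x + h * v x) - Psi f \<Omega> y) \<le> (Psi f \<Omega> (\<lambda>x. y x + h * v' x) - Psi f \<Omega> y) + c * h"
          by linarith
        then have "(Psi f \<Omega> (\<lambda>x. y x + h * v x) - Psi f \<Omega> y) / h \<le> ((Psi f \<Omega> (\<lambda>x. y x + h * v' x) - Psi f \<Omega> y) + c * h) / h"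
          using h by (intro divide_right_mono) auto
        also have "\<dots> = (Psi f \<Omega> (\<lambda>x. y x + h * v' x) - Psi f \<Omega> y) / h + c"
          using h by (simp add: add_divide_distrib)
        finally show "?q v (y, h) \<le> ?q v' (y, h) + ereal c" by simp
      qed
      ultimately have "\<forall>\<^sub>F p in nhds_in support_closure N u \<times>\<^sub>F at_right 0. ?q v p \<le> ereal (b + c) + ereal e"
      proof eventually_elim
        case (elim p)
        obtain y h where p: "p = (y, h)" by (cases p)
        show ?case using elim by (simp add: p)
      qed
      then show "clarke_derivative support_closure N (Psi f \<Omega>) u v \<le> ereal (b + K * N (\<lambda>x. v x - v' x)) + ereal e"
        unfolding clarke_derivative_def c_def by (rule Limsup_bounded)
    qed
  qed
qed

text \<open>The extension is the McShane extension of the \<open>N\<close>-Lipschitz functional \<open>\<xi>\<close>; it is linear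
  because \<open>X\<close> is dense.\<close>

lemma clarke_gradient_extension:
  assumes XE: "X \<subseteq> support_closure"
    and lin: "\<And>v w a b. v \<in> X \<Longrightarrow> w \<in> X \<Longrightarrow> (\<lambda>x. a * v x + b * w x) \<in> X"
    and dense: "\<And>v \<epsilon>. v \<in> support_closure \<Longrightarrow> \<epsilon> > 0 \<Longrightarrow> \<exists>w\<in>X. N (\<lambda>x. v x - w x) < \<epsilon>"
    and C: "\<And>v. v \<in> X \<Longrightarrow> N v \<le> C * NX v" and NX: "\<And>v. v \<in> X \<Longrightarrow> 0 \<le> NX v"
    and u: "u \<in> X" and \<xi>: "\<xi> \<in> clarke_gradient X NX (Psi f \<Omega>) u"
  obtains \<eta> where "\<eta> \<in> clarke_gradient support_closure N (Psi f \<Omega>) u" "\<And>v. v \<in> X \<Longrightarrow> \<xi> v = \<eta> v"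
proof -
  let ?D = "clarke_derivative support_closure N (Psi f \<Omega>) u"
  have uE: "u \<in> support_closure" using u XE by blast
  have X_E: "v \<in> X \<Longrightarrow> v \<in> support_closure" for v using XE by blast
  have Nnn: "0 \<le> N v" if "v \<in> support_closure" for v
    by (intro N_nonneg L_modular support_closure_L that)
  have lin\<xi>: "\<xi> (\<lambda>x. a * v x + b * w x) = a * \<xi> v + b * \<xi> w" if "v \<in> X" "w \<in> X" for v w a b
    using \<xi> that by (simp add: clarke_gradient_def dual_space_def)
  have Xdiff: "(\<lambda>x. v x - w x) \<in> X" if "v \<in> X" "w \<in> X" for v w
    using lin[OF that, of 1 "-1"] by simp
  have X0: "(\<lambda>x. 0) \<in> X" using lin[OF u u, of 0 0] by simp
  have E0: "(\<lambda>x. 0) \<in> support_closure" using X0 by (rule X_E)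
  \<comment> \<open>The embedding constant need not be positive, while the comparison of derivatives
    divides by it.\<close>
  have "N v \<le> max C 1 * NX v" if "v \<in> X" for v
    using C[OF that] NX[OF that] mult_right_mono[of C "max C 1" "NX v"] by linarith
  then have D_le: "clarke_derivative X NX (Psi f \<Omega>) u v \<le> ?D v" for v
    using Xdiff u by (intro clarke_derivative_subspace_le[OF XE, of "max C 1"]) auto
  have \<xi>D: "ereal (\<xi> v) \<le> ?D v" if "v \<in> X" for v
    using \<xi> that D_le[of v] by (auto simp: clarke_gradient_def intro: order_trans)
  obtain K where K: "K \<ge> 0" "\<And>v v' b. v \<in> support_closure \<Longrightarrow> v' \<in> support_closure \<Longrightarrow>
    ?D v' \<le> ereal b \<Longrightarrow> ?D v \<le> ereal (b + K * N (\<lambda>x. v x - v' x))"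
    by (rule clarke_derivative_Psi_lipschitz[OF uE]) blast
  have D0: "?D (\<lambda>x. 0) \<le> ereal 0"
    unfolding clarke_derivative_def
    by (rule Limsup_bounded, rule always_eventually) auto
  \<comment> \<open>Comparison with the direction 0, whose derivative is at most 0, bounds \<xi> by
    \<open>N\<close> although continuity was known for \<open>NX\<close> only.\<close>
  have \<xi>_le: "\<xi> v \<le> K * N v" if "v \<in> X" for v
    using order_trans[OF \<xi>D[OF that] K(2)[OF X_E[OF that] E0 D0]] by simp
  have \<xi>_lip: "\<xi> v - \<xi> w \<le> K * N (\<lambda>x. v x - w x)" if "v \<in> X" "w \<in> X" for v w
    using \<xi>_le[OF Xdiff[OF that]] lin\<xi>[OF that, of 1 "-1"] by simp
  define \<eta> where "\<eta> v = (SUP w\<in>X. \<xi> w - K * N (\<lambda>x. v x - w x))" for v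
  \<comment> \<open>Every lower candidate for the value at \<open>v\<close> lies below every upper
    one; hence the supremum is finite and within \<open>K * N (v - w)\<close> of
    \<open>\<xi> w\<close> for each \<open>w\<close> in \<open>X\<close>.\<close>
  have cross: "\<xi> w - K * N (\<lambda>x. v x - w x) \<le> \<xi> w' + K * N (\<lambda>x. v x - w' x)"
    if v: "v \<in> support_closure" and w: "w \<in> X" "w' \<in> X" for v w w'
  proof -
    have "\<xi> w - \<xi> w' \<le> K * N (\<lambda>x. w x - w' x)" by (rule \<xi>_lip[OF w])
    also have "\<dots> \<le> K * (N (\<lambda>x. w x - v x) + N (\<lambda>x. v x - w' x))"
      using K(1) v X_E[OF w(1)] X_E[OF w(2)] by (intro mult_left_mono N_diff_triangle support_closure_L)
    also have "N (\<lambda>x. w x - v x) = N (\<lambda>x. v x - w x)" by (rule N_diff_commute)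
    finally show ?thesis by (simp add: distrib_left)
  qed
  have \<eta>_near: "\<bar>\<eta> v - \<xi> w\<bar> \<le> K * N (\<lambda>x. v x - w x)" if v: "v \<in> support_closure" and w: "w \<in> X" for v w
  proof -
    have bdd: "bdd_above ((\<lambda>w. \<xi> w - K * N (\<lambda>x. v x - w x)) ` X)"
      using cross[OF v _ w] by (intro bdd_aboveI2) blast
    have "\<xi> w - K * N (\<lambda>x. v x - w x) \<le> \<eta> v"
      unfolding \<eta>_def by (rule cSUP_upper[OF w bdd])
    moreover have "\<eta> v \<le> \<xi> w + K * N (\<lambda>x. v x - w x)"
      unfolding \<eta>_def using w cross[OF v _ w] by (intro cSUP_least) auto
    ultimately show ?thesis by linarith
  qed
  have \<eta>_eq: "\<xi> v = \<eta> v" if "v \<in> X" for v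
    using \<eta>_near[OF X_E[OF that] that] by (simp add: N_zero)
  have small: "a = 0" if "\<And>e. e > 0 \<Longrightarrow> \<bar>a\<bar> \<le> m * e" for a m :: real
  proof -
    have "\<bar>a\<bar> \<le> 0"
    proof (rule field_le_epsilon)
      fix e :: real assume e: "e > 0"
      then have "\<bar>a\<bar> \<le> m * (e / (\<bar>m\<bar> + 1))" by (intro that) auto
      also have "\<dots> \<le> (\<bar>m\<bar> + 1) * (e / (\<bar>m\<bar> + 1))" using e by (intro mult_right_mono) auto
      finally show "\<bar>a\<bar> \<le> 0 + e" by (simp add: add_nonneg_pos order.strict_implies_not_eq[symmetric])
    qed
    then show ?thesis by simp
  qed
  have \<eta>_lin: "\<eta> (\<lambda>x. a * v x + b * w x) = a * \<eta> v + b * \<eta> w"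
    if v: "v \<in> support_closure" and w: "w \<in> support_closure" for v w a b
  proof -
    have "\<eta> (\<lambda>x. a * v x + b * w x) - (a * \<eta> v + b * \<eta> w) = 0"
    \<comment> \<open>The approximation error is paid once for the combination and once for its two
      terms, whence the factor 2.\<close>
    proof (rule small[of _ "2 * K * (\<bar>a\<bar> + \<bar>b\<bar>)"])
      fix e :: real assume e: "e > 0"
      obtain p where p: "p \<in> X" "N (\<lambda>x. v x - p x) < e" using dense[OF v e] by blast
      obtain q where q: "q \<in> X" "N (\<lambda>x. w x - q x) < e" using dense[OF w e] by blast
      have 1: "\<bar>\<eta> v - \<xi> p\<bar> \<le> K * e"
        using \<eta>_near[OF v p(1)] mult_left_mono[OF less_imp_le[OF p(2)] K(1)] by linarith
      have 2: "\<bar>\<eta> w - \<xi> q\<bar> \<le> K * e"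
        using \<eta>_near[OF w q(1)] mult_left_mono[OF less_imp_le[OF q(2)] K(1)] by linarith
      have "\<bar>\<eta> (\<lambda>x. a * v x + b * w x) - \<xi> (\<lambda>x. a * p x + b * q x)\<bar> \<le>
          K * N (\<lambda>x. (a * v x + b * w x) - (a * p x + b * q x))"
        by (intro \<eta>_near support_closure_lincomb v w lin p q)
      also have "N (\<lambda>x. (a * v x + b * w x) - (a * p x + b * q x)) = N (\<lambda>x. a * (v x - p x) + b * (w x - q x))"
        by (simp add: algebra_simps)
      also have "K * \<dots> \<le> K * (\<bar>a\<bar> * N (\<lambda>x. v x - p x) + \<bar>b\<bar> * N (\<lambda>x. w x - q x))"
        using K(1) v w X_E[OF p(1)] X_E[OF q(1)] by (intro mult_left_mono N_lincomb_le L_diff support_closure_L) auto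
      also have "\<dots> \<le> K * (\<bar>a\<bar> * e + \<bar>b\<bar> * e)"
        using K(1) p q by (intro mult_left_mono add_mono) auto
      finally have 3: "\<bar>\<eta> (\<lambda>x. a * v x + b * w x) - (a * \<xi> p + b * \<xi> q)\<bar> \<le> K * (\<bar>a\<bar> * e + \<bar>b\<bar> * e)"
        using lin\<xi>[OF p(1) q(1), of a b] by simp
      have 4: "\<bar>a * \<xi> p - a * \<eta> v\<bar> \<le> \<bar>a\<bar> * (K * e)"
        using mult_left_mono[OF 1, of "\<bar>a\<bar>"] by (simp add: abs_mult[symmetric] right_diff_distrib abs_minus_commute)
      have 5: "\<bar>b * \<xi> q - b * \<eta> w\<bar> \<le> \<bar>b\<bar> * (K * e)"
        using mult_left_mono[OF 2, of "\<bar>b\<bar>"] by (simp add: abs_mult[symmetric] right_diff_distrib abs_minus_commute)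
      have "2 * K * (\<bar>a\<bar> + \<bar>b\<bar>) * e = K * (\<bar>a\<bar> * e + \<bar>b\<bar> * e) + \<bar>a\<bar> * (K * e) + \<bar>b\<bar> * (K * e)"
        by (simp add: algebra_simps)
      with 3 4 5 show "\<bar>\<eta> (\<lambda>x. a * v x + b * w x) - (a * \<eta> v + b * \<eta> w)\<bar> \<le> 2 * K * (\<bar>a\<bar> + \<bar>b\<bar>) * e"
        by linarith
    qed
    then show ?thesis by simp
  qed
  have \<xi>0: "\<xi> (\<lambda>x. 0) = 0" using lin\<xi>[OF X0 X0, of 0 0] by simp
  have "\<bar>\<eta> v\<bar> \<le> K * N v" if "v \<in> support_closure" for v
    using \<eta>_near[OF that X0] by (simp add: \<xi>0)
  then have dual: "\<eta> \<in> dual_space support_closure N"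
    using \<eta>_lin unfolding dual_space_def by blast
  have le: "ereal (\<eta> v) \<le> ?D v" if v: "v \<in> support_closure" for v
  proof (rule ereal_le_real)
    fix b assume b: "?D v \<le> ereal b"
    have "\<eta> v \<le> b"
    proof (rule field_le_epsilon)
      fix e :: real assume e: "e > 0"
      \<comment> \<open>One \<open>K\<close> pays for moving from \<open>v\<close> to
        \<open>p\<close> in \<eta>, the other for the same move in the derivative; the 1 covers
        \<open>K = 0\<close>.\<close>
      define d where "d = e / (2 * K + 1)"
      have d: "d > 0" "(2 * K + 1) * d = e" using e K(1) by (simp_all add: d_def)
      obtain p where p: "p \<in> X" "N (\<lambda>x. v x - p x) < d" using dense[OF v d(1)] by blast
      have Np: "K * N (\<lambda>x. v x - p x) \<le> K * d" using p(2) K(1) by (intro mult_left_mono) auto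
      have "ereal (\<xi> p) \<le> ereal (b + K * N (\<lambda>x. p x - v x))"
        using \<xi>D[OF p(1)] K(2)[OF X_E[OF p(1)] v b] by (rule order_trans)
      then have "\<xi> p \<le> b + K * N (\<lambda>x. v x - p x)" by (simp add: N_diff_commute[of p v])
      moreover have "2 * (K * d) + d = e" using d(2) by (simp add: algebra_simps)
      ultimately show "\<eta> v \<le> b + e" using \<eta>_near[OF v p(1)] Np d(1) by linarith
    qed
    then show "ereal (\<eta> v) \<le> ereal b" by simp
  qed
  show ?thesis
    by (rule that[OF _ \<eta>_eq]) (use dual le in \<open>auto simp: clarke_gradient_def\<close>)
qed

end

section \<open>Sobolev spaces\<close>

lemma test_functions_smooth: "\<phi> \<in> test_functions \<Omega> \<Longrightarrow> smooth_on UNIV \<phi>"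
  by (simp add: test_functions_def)

lemma test_function_frechet_outside:
  assumes \<phi>: "\<phi> \<in> test_functions \<Omega>" and x: "x \<notin> closure {x. \<phi> x \<noteq> 0}"
  shows "frechet_derivative \<phi> (at x) b = 0"
proof -
  have "((\<lambda>x. 0) has_derivative (\<lambda>h. 0)) (at x)" by simp
  then have "(\<phi> has_derivative (\<lambda>h. 0)) (at x)"
  proof (rule has_derivative_transform_within_open)
    show "open (- closure {x. \<phi> x \<noteq> 0})" by auto
    show "0 = \<phi> y" if "y \<in> - closure {x. \<phi> x \<noteq> 0}" for y
      using that closure_subset[of "{x. \<phi> x \<noteq> 0}"] by auto
  qed (use x in simp)
  then show ?thesis using frechet_derivative_at by metis
qed

lemma test_function_frechet_bounds:
  assumes \<phi>: "\<phi> \<in> test_functions \<Omega>" and b: "b \<in> Basis"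
  obtains C R where "\<And>x. \<bar>frechet_derivative \<phi> (at x) b\<bar> \<le> C" "\<And>x. R < norm x \<Longrightarrow> frechet_derivative \<phi> (at x) b = 0"
proof (rule continuous_compact_support_bounds)
  show "continuous_on UNIV (\<lambda>x. frechet_derivative \<phi> (at x) b)"
    by (rule smooth_on_UNIV_derivative(3)[OF test_functions_smooth[OF \<phi>] b])
  show "compact (closure {x. \<phi> x \<noteq> 0})" using \<phi> by (simp add: test_functions_def)
  show "frechet_derivative \<phi> (at x) b = 0" if "x \<notin> closure {x. \<phi> x \<noteq> 0}" for x
    by (rule test_function_frechet_outside[OF \<phi> that])
qed (rule that)

lemma test_functions_mult:
  assumes "\<phi> \<in> test_functions \<Omega>" "\<psi> \<in> test_functions \<Omega>"
  shows "(\<lambda>x. \<phi> x * \<psi> x) \<in> test_functions \<Omega>"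
proof -
  let ?K = "closure {x. \<phi> x \<noteq> 0}"
  have K: "compact ?K" "?K \<subseteq> \<Omega>" using assms by (auto simp: test_functions_def)
  have "{x. \<phi> x * \<psi> x \<noteq> 0} \<subseteq> {x. \<phi> x \<noteq> 0}" by auto
  then have cl: "closure {x. \<phi> x * \<psi> x \<noteq> 0} \<subseteq> ?K" by (rule closure_mono)
  have "smooth_on UNIV (\<lambda>x. \<phi> x * \<psi> x)"
    using assms unfolding smooth_on_def test_functions_def
    by (auto intro!: Ck_on_mult simp del: Ck_on.simps)
  moreover have "compact (closure {x. \<phi> x * \<psi> x \<noteq> 0})"
    using cl K(1) by (meson bounded_subset closed_closure compact_eq_bounded_closed)
  ultimately show ?thesis using cl K(2) unfolding test_functions_def by blast
qed

text \<open>By translation invariance the difference quotients have integral zero.\<close>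

lemma integral_frechet_test_function:
  assumes h: "h \<in> test_functions \<Omega>" and b: "b \<in> Basis"
  shows "(LINT x|lborel. frechet_derivative h (at x) b) = 0"
proof -
  let ?D = "\<lambda>x. frechet_derivative h (at x) b"
  note sm = smooth_on_UNIV_derivative[OF test_functions_smooth[OF h]]
  have nb: "norm b = 1" using b by simp
  obtain C0 R where R: "\<And>x. \<bar>h x\<bar> \<le> C0" "\<And>x. R < norm x \<Longrightarrow> h x = 0"
    using test_function_bounded[OF h] by blast
  obtain C R' where C: "\<And>x. \<bar>?D x\<bar> \<le> C" "\<And>x. R' < norm x \<Longrightarrow> ?D x = 0"
    using test_function_frechet_bounds[OF h b] by blast
  have hm [measurable]: "h \<in> borel_measurable lborel"
    using borel_measurable_continuous_onI[OF sm(1)] by simp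
  have Dm [measurable]: "?D \<in> borel_measurable lborel"
    using borel_measurable_continuous_onI[OF sm(3)[OF b]] by simp
  have ball: "integrable lborel (\<lambda>x. c * indicator (cball (0 :: real^2) r) x)" for c r :: real
    using emeasure_bounded_finite[of "cball (0 :: real^2) r"]
    by (intro integrable_mult_right integrable_real_indicator) auto
  have h_int: "integrable lborel h"
  proof (rule Bochner_Integration.integrable_bound[OF ball[of C0 R] hm], rule AE_I2)
    fix x show "norm (h x) \<le> norm (C0 * indicator (cball 0 R) x)"
      using R(1)[of x] R(2)[of x] by (cases "norm x \<le> R") auto
  qed
  define t where "t n = 1 / real (Suc n)" for n
  have t: "0 < t n" "t n \<le> 1" for n by (simp_all add: t_def)
  have t_lim: "t \<longlonglongrightarrow> 0" unfolding t_def by (rule LIMSEQ_Suc[OF lim_1_over_n])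
  define s where "s n x = (h (t n *\<^sub>R b + x) - h x) / t n" for n x
  have line: "((\<lambda>r. h (r *\<^sub>R b + x)) has_real_derivative ?D (r *\<^sub>R b + x)) (at r)" for r x
  proof -
    have "((\<lambda>r. r *\<^sub>R b + x) has_derivative (\<lambda>d. d *\<^sub>R b)) (at r)"
      by (auto intro!: derivative_eq_intros)
    from has_derivative_compose[OF this sm(2)]
    have "((\<lambda>r. h (r *\<^sub>R b + x)) has_derivative (\<lambda>d. frechet_derivative h (at (r *\<^sub>R b + x)) (d *\<^sub>R b))) (at r)" .
    moreover have "frechet_derivative h (at (r *\<^sub>R b + x)) (d *\<^sub>R b) = ?D (r *\<^sub>R b + x) * d" for d
      using linear_scale[OF has_derivative_linear[OF sm(2)]] by (simp add: mult.commute)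
    ultimately show ?thesis by (simp add: has_field_derivative_def)
  qed
  have shift: "(\<lambda>x. h (c + x)) \<in> borel_measurable lborel" for c
    using hm by measurable
  have shift_int: "integrable lborel (\<lambda>x. h (c + x))" "(LINT x|lborel. h (c + x)) = (LINT x|lborel. h x)" for c
  proof -
    have m: "(+) c \<in> measurable lborel borel" by simp
    have hb: "h \<in> borel_measurable borel" using hm by simp
    show "integrable lborel (\<lambda>x. h (c + x))"
      using integrable_distr[OF m, of h] h_int by (simp add: lborel_distr_plus)
    show "(LINT x|lborel. h (c + x)) = (LINT x|lborel. h x)"
      using integral_distr[OF m hb] by (simp add: lborel_distr_plus)
  qed
  have s_int: "(LINT x|lborel. s n x) = 0" for n
    unfolding s_def using shift_int h_int by simp
  have "(\<lambda>n. LINT x|lborel. s n x) \<longlonglongrightarrow> (LINT x|lborel. ?D x)"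
  \<comment> \<open>Steps have length at most 1, so the quotients vanish outside the ball of radius
    \<open>R + 1\<close>; inside it the mean value theorem bounds them by \<open>C\<close>.\<close>
  proof (rule integral_dominated_convergence[OF Dm _ ball[of C "R + 1"]])
    show "s n \<in> borel_measurable lborel" for n unfolding s_def using shift by measurable
    show "AE x in lborel. (\<lambda>n. s n x) \<longlonglongrightarrow> ?D x"
    proof (rule AE_I2)
      fix x
      have "((\<lambda>r. (h ((0 + r) *\<^sub>R b + x) - h (0 *\<^sub>R b + x)) / r) \<longlongrightarrow> ?D (0 *\<^sub>R b + x)) (at 0)"
        using line[of x 0] by (simp only: DERIV_def)
      then have "((\<lambda>r. (h (r *\<^sub>R b + x) - h x) / r) \<longlongrightarrow> ?D x) (at 0)" by simp
      moreover have "t n \<noteq> 0" for n using t(1)[of n] by simp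
      then have "filterlim t (at 0) sequentially"
        using t_lim by (simp add: filterlim_at)
      ultimately show "(\<lambda>n. s n x) \<longlonglongrightarrow> ?D x"
        unfolding s_def by (rule filterlim_compose)
    qed
    show "AE x in lborel. norm (s n x) \<le> C * indicator (cball 0 (R + 1)) x" for n
    proof (rule AE_I2)
      fix x
      show "norm (s n x) \<le> C * indicator (cball 0 (R + 1)) x"
      proof (cases "norm x \<le> R + 1")
        case True
        obtain r where "h (t n *\<^sub>R b + x) - h (0 *\<^sub>R b + x) = (t n - 0) * ?D (r *\<^sub>R b + x)"
          using MVT2[OF t(1)[of n], of "\<lambda>r. h (r *\<^sub>R b + x)" "\<lambda>r. ?D (r *\<^sub>R b + x)"] line by blast
        then have "s n x = ?D (r *\<^sub>R b + x)" using t(1)[of n] by (simp add: s_def)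
        then show ?thesis using C(1) True by simp
      next
        case False
        have "norm (t n *\<^sub>R b) \<le> 1" using t[of n] nb by simp
        moreover have "norm x \<le> norm (t n *\<^sub>R b + x) + norm (t n *\<^sub>R b)"
          using norm_triangle_ineq4[of "t n *\<^sub>R b + x" "t n *\<^sub>R b"] by simp
        ultimately have "R < norm (t n *\<^sub>R b + x)" "R < norm x" using False by linarith+
        then show ?thesis using R(2) False by (simp add: s_def)
      qed
    qed
  qed
  then have "(\<lambda>n. 0) \<longlonglongrightarrow> (LINT x|lborel. ?D x)" by (simp add: s_int)
  from LIMSEQ_unique[OF this tendsto_const] show ?thesis by simp
qed

lemma frechet_derivative_mult:
  fixes \<phi> \<psi> :: "real^2 \<Rightarrow> real"
  assumes "(\<phi> has_derivative frechet_derivative \<phi> (at x)) (at x)" "(\<psi> has_derivative frechet_derivative \<psi> (at x)) (at x)"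
  shows "frechet_derivative (\<lambda>x. \<phi> x * \<psi> x) (at x) b =
    \<phi> x * frechet_derivative \<psi> (at x) b + frechet_derivative \<phi> (at x) b * \<psi> x"
  by (simp add: frechet_derivative_at[OF has_derivative_mult[OF assms], symmetric])

section \<open>Test functions as elements of the Sobolev spaces\<close>

context open_domain begin

lemma bounded_support_integrable:
  assumes "w \<in> bounded_support"
  shows "integrable M w"
proof -
  obtain C R where w: "w \<in> borel_measurable M" "AE x in M. \<bar>w x\<bar> \<le> C \<and> (R < norm x \<longrightarrow> w x = 0)"
    using assms by (auto simp: bounded_support_def)
  let ?B = "\<Omega> \<inter> cball 0 R"
  have B: "?B \<in> sets lebesgue" "bounded ?B" using domain_sets by (auto intro: bounded_Int)
  have "?B \<in> lmeasurable" using B by (simp add: bounded_set_imp_lmeasurable)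
  then have "emeasure lebesgue ?B < \<infinity>" unfolding fmeasurable_def by blast
  moreover have "emeasure M ?B = emeasure lebesgue ?B"
    using B domain_sets by (intro emeasure_restrict_space) auto
  ultimately have "integrable M (\<lambda>x. C * indicator ?B x)"
    using B domain_sets by (intro integrable_mult_right integrable_real_indicator) (auto simp: sets_restrict_space_iff)
  then show ?thesis
  proof (rule Bochner_Integration.integrable_bound[OF _ w(1)])
    show "AE x in M. norm (w x) \<le> norm (C * indicator ?B x)"
      using w(2) AE_space by eventually_elim (auto simp: indicator_def)
  qed
qed

lemma square_integrable_mult:
  fixes p q :: "real^2 \<Rightarrow> real"
  assumes [measurable]: "p \<in> borel_measurable M" "q \<in> borel_measurable M"
    and "integrable M (\<lambda>x. (p x)\<^sup>2)" "integrable M (\<lambda>x. (q x)\<^sup>2)"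
  shows "integrable M (\<lambda>x. p x * q x)"
proof (rule Bochner_Integration.integrable_bound[OF Bochner_Integration.integrable_add[OF assms(3,4)]])
  show "AE x in M. norm (p x * q x) \<le> norm ((p x)\<^sup>2 + (q x)\<^sup>2)"
  proof (rule AE_I2)
    fix x
    have "2 * (\<bar>p x\<bar> * \<bar>q x\<bar>) \<le> (p x)\<^sup>2 + (q x)\<^sup>2" using sum_squares_bound[of "\<bar>p x\<bar>" "\<bar>q x\<bar>"] by simp
    moreover have "0 \<le> \<bar>p x\<bar> * \<bar>q x\<bar>" by simp
    ultimately have "\<bar>p x\<bar> * \<bar>q x\<bar> \<le> (p x)\<^sup>2 + (q x)\<^sup>2" by linarith
    then show "norm (p x * q x) \<le> norm ((p x)\<^sup>2 + (q x)\<^sup>2)" by (simp add: abs_mult)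
  qed
qed measurable

lemma bounded_support_square_integrable: "w \<in> bounded_support \<Longrightarrow> integrable M (\<lambda>x. (w x)\<^sup>2)"
proof -
  assume "w \<in> bounded_support"
  then obtain C R where w: "w \<in> borel_measurable M" "AE x in M. \<bar>w x\<bar> \<le> C \<and> (R < norm x \<longrightarrow> w x = 0)"
    by (auto simp: bounded_support_def)
  have "AE x in M. \<bar>(w x)\<^sup>2\<bar> \<le> C\<^sup>2 \<and> (R < norm x \<longrightarrow> (w x)\<^sup>2 = 0)"
    using w(2)
  proof eventually_elim
    case (elim x)
    then have "(w x)\<^sup>2 \<le> C\<^sup>2" using power_mono[of "\<bar>w x\<bar>" C 2] by simp
    with elim show ?case by simp
  qed
  moreover have "(\<lambda>x. (w x)\<^sup>2) \<in> borel_measurable M" using w(1) by measurable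
  ultimately have "(\<lambda>x. (w x)\<^sup>2) \<in> bounded_support" unfolding bounded_support_def by blast
  then show ?thesis by (rule bounded_support_integrable)
qed

lemma frechet_derivative_bounded_support:
  assumes \<phi>: "\<phi> \<in> test_functions \<Omega>" and b: "b \<in> Basis"
  shows "(\<lambda>x. frechet_derivative \<phi> (at x) b) \<in> bounded_support"
proof -
  have "(\<lambda>x. frechet_derivative \<phi> (at x) b) \<in> borel_measurable M"
    by (intro restrict_lborel_measurable borel_measurable_continuous_onI smooth_on_UNIV_derivative(3)[OF test_functions_smooth[OF \<phi>] b])
  moreover obtain C R where "\<And>x. \<bar>frechet_derivative \<phi> (at x) b\<bar> \<le> C" "\<And>x. R < norm x \<Longrightarrow> frechet_derivative \<phi> (at x) b = 0"
    using test_function_frechet_bounds[OF \<phi> b] by blast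
  ultimately show ?thesis unfolding bounded_support_def by blast
qed

lemma integral_frechet_domain:
  assumes h: "h \<in> test_functions \<Omega>" and b: "b \<in> Basis"
  shows "(LINT x|M. frechet_derivative h (at x) b) = 0"
proof -
  let ?D = "\<lambda>x. frechet_derivative h (at x) b"
  have out: "?D x = 0" if "x \<notin> \<Omega>" for x
    using h that by (intro test_function_frechet_outside[OF h]) (auto simp: test_functions_def)
  have "(LINT x|M. ?D x) = (LINT x|lebesgue. indicator \<Omega> x *\<^sub>R ?D x)"
    using domain_sets by (intro integral_restrict_space) auto
  also have "\<dots> = (LINT x|lebesgue. ?D x)"
    using out by (intro Bochner_Integration.integral_cong) (auto simp: indicator_def)
  also have "\<dots> = (LINT x|lborel. ?D x)"
    using borel_measurable_continuous_onI[OF smooth_on_UNIV_derivative(3)[OF test_functions_smooth[OF h] b]]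
    by (intro integral_completion) simp
  finally show ?thesis using integral_frechet_test_function[OF h b] by simp
qed

definition classical_gradient :: "(real^2 \<Rightarrow> real) \<Rightarrow> real^2 \<Rightarrow> real^2" where
  "classical_gradient \<phi> x = (\<chi> i. frechet_derivative \<phi> (at x) (axis i 1))"

lemma classical_gradient_L2:
  assumes \<phi>: "\<phi> \<in> test_functions \<Omega>"
  shows "classical_gradient \<phi> \<in> L2_space \<Omega>"
proof -
  have b: "(axis i 1 :: real^2) \<in> Basis" for i by simp
  have "continuous_on UNIV (classical_gradient \<phi>)"
    unfolding classical_gradient_def
    by (intro continuous_on_vec_lambda smooth_on_UNIV_derivative(3)[OF test_functions_smooth[OF \<phi>] b])
  then have "classical_gradient \<phi> \<in> borel_measurable M"
    by (intro restrict_lborel_measurable borel_measurable_continuous_onI)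
  moreover have "(norm (classical_gradient \<phi> x))\<^sup>2 = (\<Sum>i\<in>UNIV. (frechet_derivative \<phi> (at x) (axis i 1))\<^sup>2)" for x
    by (simp add: norm_vec_def L2_set_def classical_gradient_def sum_nonneg)
  moreover have "integrable M (\<lambda>x. \<Sum>i\<in>UNIV. (frechet_derivative \<phi> (at x) (axis i 1))\<^sup>2)"
    by (intro Bochner_Integration.integrable_sum bounded_support_square_integrable frechet_derivative_bounded_support \<phi> b)
  ultimately show ?thesis by (simp add: L2_space_def)
qed

text \<open>The product of two test functions is a test function, and the vanishing integral of its
  derivative is integration by parts.\<close>

lemma classical_gradient_weak:
  assumes \<phi>: "\<phi> \<in> test_functions \<Omega>"
  shows "is_weak_gradient \<Omega> \<phi> (classical_gradient \<phi>)"
  unfolding is_weak_gradient_def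
proof (intro ballI allI)
  fix \<psi> and i :: 2 assume \<psi>: "\<psi> \<in> test_functions \<Omega>"
  let ?b = "axis i 1 :: real^2"
  have b: "?b \<in> Basis" by simp
  note B = test_function_bounded_support[OF \<phi>] test_function_bounded_support[OF \<psi>]
    frechet_derivative_bounded_support[OF \<phi> b] frechet_derivative_bounded_support[OF \<psi> b]
  have 1: "integrable M (\<lambda>x. \<phi> x * frechet_derivative \<psi> (at x) ?b)"
    "integrable M (\<lambda>x. frechet_derivative \<phi> (at x) ?b * \<psi> x)"
    by (intro square_integrable_mult bounded_support_square_integrable bounded_support_measurable B)+
  have "0 = (LINT x|M. frechet_derivative (\<lambda>x. \<phi> x * \<psi> x) (at x) ?b)"
    using integral_frechet_domain[OF test_functions_mult[OF \<phi> \<psi>] b] by simp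
  also have "\<dots> = (LINT x|M. \<phi> x * frechet_derivative \<psi> (at x) ?b + frechet_derivative \<phi> (at x) ?b * \<psi> x)"
    by (intro Bochner_Integration.integral_cong refl frechet_derivative_mult
        smooth_on_UNIV_derivative(2)[OF test_functions_smooth[OF \<phi>]] smooth_on_UNIV_derivative(2)[OF test_functions_smooth[OF \<psi>]])
  also have "\<dots> = (LINT x|M. \<phi> x * frechet_derivative \<psi> (at x) ?b) +
      (LINT x|M. frechet_derivative \<phi> (at x) ?b * \<psi> x)"
    using 1 by simp
  finally show "(LINT x|M. \<phi> x * frechet_derivative \<psi> (at x) ?b) =
      - (LINT x|M. classical_gradient \<phi> x $ i * \<psi> x)"
    by (simp add: classical_gradient_def)
qed

lemma test_function_L2: "\<phi> \<in> test_functions \<Omega> \<Longrightarrow> \<phi> \<in> L2_space \<Omega>"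
  using test_function_bounded_support[of \<phi>] bounded_support_square_integrable[of \<phi>] bounded_support_measurable[of \<phi>]
  by (simp add: L2_space_def)

lemma test_function_H1: "\<phi> \<in> test_functions \<Omega> \<Longrightarrow> \<phi> \<in> H1 \<Omega>"
  using test_function_L2 classical_gradient_L2 classical_gradient_weak unfolding H1_def by blast

end

section \<open>Uniqueness of weak gradients and linear structure of the Sobolev spaces\<close>

context open_domain begin

lemma L2_measurable: "p \<in> L2_space \<Omega> \<Longrightarrow> p \<in> borel_measurable M"
  by (simp add: L2_space_def)

lemma L2_integrable: "p \<in> L2_space \<Omega> \<Longrightarrow> integrable M (\<lambda>x. (norm (p x))\<^sup>2)"
  by (simp add: L2_space_def)

lemma norm_lincomb_square_le:
  fixes p q :: "'b::real_normed_vector"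
  shows "(norm (a *\<^sub>R p + b *\<^sub>R q))\<^sup>2 \<le> 2 * a\<^sup>2 * (norm p)\<^sup>2 + 2 * b\<^sup>2 * (norm q)\<^sup>2"
proof -
  have "norm (a *\<^sub>R p + b *\<^sub>R q) \<le> \<bar>a\<bar> * norm p + \<bar>b\<bar> * norm q"
    using norm_triangle_ineq[of "a *\<^sub>R p" "b *\<^sub>R q"] by simp
  then have "(norm (a *\<^sub>R p + b *\<^sub>R q))\<^sup>2 \<le> (\<bar>a\<bar> * norm p + \<bar>b\<bar> * norm q)\<^sup>2"
    by (intro power_mono) auto
  also have "\<dots> \<le> 2 * (\<bar>a\<bar> * norm p)\<^sup>2 + 2 * (\<bar>b\<bar> * norm q)\<^sup>2"
    using sum_squares_bound[of "\<bar>a\<bar> * norm p" "\<bar>b\<bar> * norm q"] by (simp add: power2_sum)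
  finally show ?thesis by (simp add: power_mult_distrib)
qed

lemma L2_lincomb:
  fixes p q :: "real^2 \<Rightarrow> 'b::euclidean_space"
  assumes p: "p \<in> L2_space \<Omega>" and q: "q \<in> L2_space \<Omega>"
  shows "(\<lambda>x. a *\<^sub>R p x + b *\<^sub>R q x) \<in> L2_space \<Omega>"
    and "(LINT x|M. (norm (a *\<^sub>R p x + b *\<^sub>R q x))\<^sup>2) \<le>
      2 * a\<^sup>2 * (LINT x|M. (norm (p x))\<^sup>2) + 2 * b\<^sup>2 * (LINT x|M. (norm (q x))\<^sup>2)"
proof -
  note [measurable] = L2_measurable[OF p] L2_measurable[OF q]
  have i: "integrable M (\<lambda>x. 2 * a\<^sup>2 * (norm (p x))\<^sup>2 + 2 * b\<^sup>2 * (norm (q x))\<^sup>2)"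
    by (intro Bochner_Integration.integrable_add integrable_mult_right L2_integrable p q)
  have m: "(\<lambda>x. a *\<^sub>R p x + b *\<^sub>R q x) \<in> borel_measurable M" by measurable
  have j: "integrable M (\<lambda>x. (norm (a *\<^sub>R p x + b *\<^sub>R q x))\<^sup>2)"
  proof (rule Bochner_Integration.integrable_bound[OF i])
    show "AE x in M. norm ((norm (a *\<^sub>R p x + b *\<^sub>R q x))\<^sup>2) \<le>
        norm (2 * a\<^sup>2 * (norm (p x))\<^sup>2 + 2 * b\<^sup>2 * (norm (q x))\<^sup>2)"
    proof (rule AE_I2)
      fix x
      have "0 \<le> 2 * a\<^sup>2 * (norm (p x))\<^sup>2 + 2 * b\<^sup>2 * (norm (q x))\<^sup>2" by simp
      then show "norm ((norm (a *\<^sub>R p x + b *\<^sub>R q x))\<^sup>2) \<le>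
          norm (2 * a\<^sup>2 * (norm (p x))\<^sup>2 + 2 * b\<^sup>2 * (norm (q x))\<^sup>2)"
        using norm_lincomb_square_le[of a "p x" b "q x"] by simp
    qed
  qed measurable
  show "(\<lambda>x. a *\<^sub>R p x + b *\<^sub>R q x) \<in> L2_space \<Omega>" using m j by (simp add: L2_space_def)
  have "(LINT x|M. (norm (a *\<^sub>R p x + b *\<^sub>R q x))\<^sup>2) \<le>
      (LINT x|M. 2 * a\<^sup>2 * (norm (p x))\<^sup>2 + 2 * b\<^sup>2 * (norm (q x))\<^sup>2)"
    by (rule integral_mono[OF j i]) (rule norm_lincomb_square_le)
  also have "\<dots> = 2 * a\<^sup>2 * (LINT x|M. (norm (p x))\<^sup>2) + 2 * b\<^sup>2 * (LINT x|M. (norm (q x))\<^sup>2)"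
    using L2_integrable[OF p] L2_integrable[OF q] by simp
  finally show "(LINT x|M. (norm (a *\<^sub>R p x + b *\<^sub>R q x))\<^sup>2) \<le>
      2 * a\<^sup>2 * (LINT x|M. (norm (p x))\<^sup>2) + 2 * b\<^sup>2 * (LINT x|M. (norm (q x))\<^sup>2)" .
qed

lemma L2_component:
  fixes g :: "real^2 \<Rightarrow> real^2"
  assumes g: "g \<in> L2_space \<Omega>"
  shows "(\<lambda>x. g x $ i) \<in> borel_measurable M" "integrable M (\<lambda>x. (g x $ i)\<^sup>2)"
proof -
  show m: "(\<lambda>x. g x $ i) \<in> borel_measurable M"
    using borel_measurable_inner[OF L2_measurable[OF g] borel_measurable_const, of "axis i 1"]
    by (simp add: inner_axis)
  show "integrable M (\<lambda>x. (g x $ i)\<^sup>2)"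
  proof (rule Bochner_Integration.integrable_bound[OF L2_integrable[OF g]])
    show "(\<lambda>x. (g x $ i)\<^sup>2) \<in> borel_measurable M" using m by measurable
    show "AE x in M. norm ((g x $ i)\<^sup>2) \<le> norm ((norm (g x))\<^sup>2)"
      using component_le_norm_cart[of "g _" i] by (intro AE_I2) (simp add: abs_le_square_iff[symmetric])
  qed
qed

lemma square_integrable_mult_bounded_support:
  assumes "p \<in> borel_measurable M" "integrable M (\<lambda>x. (p x)\<^sup>2)" "w \<in> bounded_support"
  shows "integrable M (\<lambda>x. p x * w x)"
  by (rule square_integrable_mult[OF assms(1) bounded_support_measurable[OF assms(3)] assms(2) bounded_support_square_integrable[OF assms(3)]])

lemma is_weak_gradient_lincomb:
  assumes u: "u \<in> L2_space \<Omega>" "g \<in> L2_space \<Omega>" "is_weak_gradient \<Omega> u g"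
    and v: "v \<in> L2_space \<Omega>" "h \<in> L2_space \<Omega>" "is_weak_gradient \<Omega> v h"
  shows "is_weak_gradient \<Omega> (\<lambda>x. a * u x + b * v x) (\<lambda>x. a *\<^sub>R g x + b *\<^sub>R h x)"
  unfolding is_weak_gradient_def
proof (intro ballI allI)
  fix \<phi> and i :: 2 assume \<phi>: "\<phi> \<in> test_functions \<Omega>"
  let ?D = "\<lambda>x. frechet_derivative \<phi> (at x) (axis i 1 :: real^2)"
  have D: "?D \<in> bounded_support" by (rule frechet_derivative_bounded_support[OF \<phi>]) simp
  have sq: "p \<in> L2_space \<Omega> \<Longrightarrow> integrable M (\<lambda>x. (p x)\<^sup>2)" for p :: "real^2 \<Rightarrow> real"
    by (simp add: L2_space_def)
  have i1: "integrable M (\<lambda>x. u x * ?D x)" "integrable M (\<lambda>x. v x * ?D x)"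
    by (intro square_integrable_mult_bounded_support L2_measurable sq u v D)+
  have i2: "integrable M (\<lambda>x. g x $ i * \<phi> x)" "integrable M (\<lambda>x. h x $ i * \<phi> x)"
    by (intro square_integrable_mult_bounded_support L2_component u v test_function_bounded_support \<phi>)+
  have "(LINT x|M. (a * u x + b * v x) * ?D x) = (LINT x|M. a * (u x * ?D x) + b * (v x * ?D x))"
    by (simp add: algebra_simps)
  also have "\<dots> = a * (LINT x|M. u x * ?D x) + b * (LINT x|M. v x * ?D x)"
    using i1 by simp
  also have "\<dots> = - (a * (LINT x|M. g x $ i * \<phi> x) + b * (LINT x|M. h x $ i * \<phi> x))"
    using u(3) v(3) \<phi> by (simp add: is_weak_gradient_def)
  also have "\<dots> = - (LINT x|M. a * (g x $ i * \<phi> x) + b * (h x $ i * \<phi> x))"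
    using i2 by simp
  also have "\<dots> = - (LINT x|M. (a *\<^sub>R g x + b *\<^sub>R h x) $ i * \<phi> x)"
    by (simp add: algebra_simps)
  finally show "(LINT x|M. (a * u x + b * v x) * ?D x) =
      - (LINT x|M. (a *\<^sub>R g x + b *\<^sub>R h x) $ i * \<phi> x)" .
qed

text \<open>The fundamental lemma of the calculus of variations: dominated convergence replaces test
  functions by indicators of bounded sets, which detect the sign of \<open>p\<close>.\<close>

lemma AE_zero_of_test_integrals:
  fixes p :: "real^2 \<Rightarrow> real"
  assumes p [measurable]: "p \<in> borel_measurable M" and sq: "integrable M (\<lambda>x. (p x)\<^sup>2)"
    and zero: "\<And>\<phi>. \<phi> \<in> test_functions \<Omega> \<Longrightarrow> (LINT x|M. p x * \<phi> x) = 0"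
  shows "AE x in M. p x = 0"
proof -
  have int: "integrable M (\<lambda>x. indicator A x * p x)" if "A \<in> sets lebesgue" "bounded A" for A
    using square_integrable_mult_bounded_support[OF p sq indicator_bounded_support[OF that]] by (simp add: mult.commute)
  have ind0: "(LINT x|M. indicator A x * p x) = 0"
    if A: "A \<in> sets lebesgue" "A \<subseteq> \<Omega>" "bounded A" for A
  proof -
    obtain \<phi> R where \<phi>: "\<And>n. \<phi> n \<in> test_functions \<Omega>" "\<And>n x. 0 \<le> \<phi> n x" "\<And>n x. \<phi> n x \<le> 1"
      "\<And>n x. R < norm x \<Longrightarrow> \<phi> n x = 0" "AE x in lebesgue. (\<lambda>n. \<phi> n x) \<longlonglongrightarrow> (indicator A x :: real)"
      using test_functions_approx_indicator[OF A open_domain] by blast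
    have Am: "(indicator A :: _ \<Rightarrow> real) \<in> borel_measurable M" by (rule indicator_measurable[OF A(1)])
    have \<phi>m: "\<phi> n \<in> borel_measurable M" for n
      by (intro bounded_support_measurable test_function_bounded_support \<phi>)
    have dom: "integrable M (\<lambda>x. indicator (cball 0 R) x * \<bar>p x\<bar>)"
      using integrable_abs[OF int[of "cball 0 R"]] by (simp add: abs_mult)
    have "(\<lambda>n. LINT x|M. p x * \<phi> n x) \<longlonglongrightarrow> (LINT x|M. p x * indicator A x)"
    proof (rule integral_dominated_convergence[OF _ _ dom])
      show "(\<lambda>x. p x * indicator A x) \<in> borel_measurable M" using Am by measurable
      show "(\<lambda>x. p x * \<phi> n x) \<in> borel_measurable M" for n using \<phi>m by measurable
      show "AE x in M. (\<lambda>n. p x * \<phi> n x) \<longlonglongrightarrow> p x * indicator A x"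
        using AE_lebesgue_on[OF \<phi>(5)] by eventually_elim (rule tendsto_mult_left)
      show "AE x in M. norm (p x * \<phi> n x) \<le> indicator (cball 0 R) x * \<bar>p x\<bar>" for n
      proof (rule AE_I2)
        fix x
        have "\<bar>p x\<bar> * \<phi> n x \<le> \<bar>p x\<bar> * 1" using \<phi>(3) by (intro mult_left_mono) auto
        then show "norm (p x * \<phi> n x) \<le> indicator (cball 0 R) x * \<bar>p x\<bar>"
          using \<phi>(2)[of n x] \<phi>(4)[of x n] by (cases "norm x \<le> R") (auto simp: abs_mult)
      qed
    qed
    then have "(\<lambda>n. 0) \<longlonglongrightarrow> (LINT x|M. p x * indicator A x)"
      by (simp add: zero[OF \<phi>(1)])
    from LIMSEQ_unique[OF this tendsto_const] show ?thesis by (simp add: mult.commute)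
  qed
  have "AE x in M. p x \<le> 0"
    by (rule AE_le_of_integral_le) (use int ind0 in auto)
  moreover have "AE x in M. 0 \<le> p x"
    by (rule AE_le_of_integral_le) (use int ind0 in auto)
  ultimately show ?thesis by eventually_elim simp
qed

text \<open>\<open>weak_gradient\<close> is an arbitrary choice, so the one chosen for a linear
  combination need not be the combination of the chosen ones; uniqueness almost everywhere makes the
  norms agree.\<close>

lemma weak_gradient_unique:
  assumes g: "g \<in> L2_space \<Omega>" "is_weak_gradient \<Omega> u g" and h: "h \<in> L2_space \<Omega>" "is_weak_gradient \<Omega> u h"
  shows "AE x in M. g x = h x"
proof -
  have d: "(\<lambda>x. 1 *\<^sub>R g x + (-1) *\<^sub>R h x) \<in> L2_space \<Omega>" by (rule L2_lincomb(1)[OF g(1) h(1)])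
  have "AE x in M. (1 *\<^sub>R g x + (-1) *\<^sub>R h x) $ i = 0" for i
  proof (rule AE_zero_of_test_integrals[OF L2_component[OF d]])
    fix \<phi> assume \<phi>: "\<phi> \<in> test_functions \<Omega>"
    have i2: "integrable M (\<lambda>x. g x $ i * \<phi> x)" "integrable M (\<lambda>x. h x $ i * \<phi> x)"
      by (intro square_integrable_mult_bounded_support L2_component g h test_function_bounded_support \<phi>)+
    have "(LINT x|M. g x $ i * \<phi> x) = (LINT x|M. h x $ i * \<phi> x)"
    proof -
      let ?I = "LINT x|M. u x * frechet_derivative \<phi> (at x) (axis i 1)"
      have "?I = - (LINT x|M. g x $ i * \<phi> x)" "?I = - (LINT x|M. h x $ i * \<phi> x)"
        using g(2) h(2) \<phi> unfolding is_weak_gradient_def by blast+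
      then show ?thesis by linarith
    qed
    then show "(LINT x|M. (1 *\<^sub>R g x + (-1) *\<^sub>R h x) $ i * \<phi> x) = 0"
      using i2 by (simp add: left_diff_distrib)
  qed
  then have "AE x in M. \<forall>i\<in>UNIV. (1 *\<^sub>R g x + (-1) *\<^sub>R h x) $ i = 0"
    by (intro AE_finite_allI) auto
  then show ?thesis by eventually_elim (simp add: vec_eq_iff)
qed

lemma H1_weak_gradient:
  assumes "u \<in> H1 \<Omega>"
  shows "u \<in> L2_space \<Omega>" "weak_gradient \<Omega> u \<in> L2_space \<Omega>" "is_weak_gradient \<Omega> u (weak_gradient \<Omega> u)"
proof -
  show "u \<in> L2_space \<Omega>" using assms by (simp add: H1_def)
  have "\<exists>g. g \<in> L2_space \<Omega> \<and> is_weak_gradient \<Omega> u g" using assms by (auto simp: H1_def)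
  from someI_ex[OF this] show "weak_gradient \<Omega> u \<in> L2_space \<Omega>" "is_weak_gradient \<Omega> u (weak_gradient \<Omega> u)"
    unfolding weak_gradient_def by blast+
qed

lemma H1_norm_nonneg: "0 \<le> H1_norm \<Omega> u"
  unfolding H1_norm_def by (intro real_sqrt_ge_zero add_nonneg_nonneg Bochner_Integration.integral_nonneg) auto

lemma H1_norm_square: "(H1_norm \<Omega> u)\<^sup>2 = (LINT x|M. (u x)\<^sup>2) + (LINT x|M. (norm (weak_gradient \<Omega> u x))\<^sup>2)"
  unfolding H1_norm_def by (intro real_sqrt_pow2 add_nonneg_nonneg Bochner_Integration.integral_nonneg) auto

text \<open>The pointwise estimate \<open>norm_lincomb_square_le\<close> gives a triangle inequality
  up to the factor 2, strong enough to show \<open>H10\<close> closed under linear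
  combinations.\<close>

lemma H1_lincomb:
  assumes u: "u \<in> H1 \<Omega>" and v: "v \<in> H1 \<Omega>"
  shows "(\<lambda>x. a * u x + b * v x) \<in> H1 \<Omega>"
    and "H1_norm \<Omega> (\<lambda>x. a * u x + b * v x) \<le> 2 * (\<bar>a\<bar> * H1_norm \<Omega> u + \<bar>b\<bar> * H1_norm \<Omega> v)"
proof -
  let ?w = "\<lambda>x. a * u x + b * v x" and ?g = "\<lambda>x. a *\<^sub>R weak_gradient \<Omega> u x + b *\<^sub>R weak_gradient \<Omega> v x"
  note U = H1_weak_gradient[OF u] and V = H1_weak_gradient[OF v]
  have w: "?w \<in> L2_space \<Omega>" using L2_lincomb(1)[OF U(1) V(1), of a b] by simp
  have g: "?g \<in> L2_space \<Omega>" by (rule L2_lincomb(1)[OF U(2) V(2)])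
  have wg: "is_weak_gradient \<Omega> ?w ?g" by (rule is_weak_gradient_lincomb[OF U V])
  show wH: "?w \<in> H1 \<Omega>" using w g wg unfolding H1_def by blast
  note W = H1_weak_gradient[OF wH]
  have "AE x in M. weak_gradient \<Omega> ?w x = ?g x"
    by (rule weak_gradient_unique[OF W(2,3) g wg])
  then have "AE x in M. (norm (weak_gradient \<Omega> ?w x))\<^sup>2 = (norm (?g x))\<^sup>2"
    by eventually_elim simp
  then have eq: "(LINT x|M. (norm (weak_gradient \<Omega> ?w x))\<^sup>2) = (LINT x|M. (norm (?g x))\<^sup>2)"
  proof (rule integral_cong_AE[rotated -1])
    show "(\<lambda>x. (norm (weak_gradient \<Omega> ?w x))\<^sup>2) \<in> borel_measurable M"
      "(\<lambda>x. (norm (?g x))\<^sup>2) \<in> borel_measurable M"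
      using L2_integrable[OF W(2)] L2_integrable[OF g] by auto
  qed
  have "(H1_norm \<Omega> ?w)\<^sup>2 = (LINT x|M. (?w x)\<^sup>2) + (LINT x|M. (norm (?g x))\<^sup>2)"
    by (simp add: H1_norm_square eq)
  also have "\<dots> \<le> (2 * a\<^sup>2 * (LINT x|M. (u x)\<^sup>2) + 2 * b\<^sup>2 * (LINT x|M. (v x)\<^sup>2)) +
     (2 * a\<^sup>2 * (LINT x|M. (norm (weak_gradient \<Omega> u x))\<^sup>2) + 2 * b\<^sup>2 * (LINT x|M. (norm (weak_gradient \<Omega> v x))\<^sup>2))"
    using L2_lincomb(2)[OF U(1) V(1), of a b] L2_lincomb(2)[OF U(2) V(2), of a b] by (intro add_mono) simp_all
  also have "\<dots> = 2 * (\<bar>a\<bar> * H1_norm \<Omega> u)\<^sup>2 + 2 * (\<bar>b\<bar> * H1_norm \<Omega> v)\<^sup>2"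
    by (simp add: H1_norm_square power_mult_distrib algebra_simps)
  also have "\<dots> \<le> (2 * (\<bar>a\<bar> * H1_norm \<Omega> u + \<bar>b\<bar> * H1_norm \<Omega> v))\<^sup>2"
  proof -
    define p q where "p = \<bar>a\<bar> * H1_norm \<Omega> u" and "q = \<bar>b\<bar> * H1_norm \<Omega> v"
    have pq: "0 \<le> p" "0 \<le> q" by (simp_all add: p_def q_def H1_norm_nonneg)
    have "(2 * (p + q))\<^sup>2 - (2 * p\<^sup>2 + 2 * q\<^sup>2) = 2 * p\<^sup>2 + 2 * q\<^sup>2 + 8 * (p * q)"
      by (simp add: power2_eq_square algebra_simps)
    moreover have "0 \<le> p * q" using pq by simp
    ultimately have "2 * p\<^sup>2 + 2 * q\<^sup>2 \<le> (2 * (p + q))\<^sup>2"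
      using zero_le_power2[of p] zero_le_power2[of q] by linarith
    then show ?thesis by (simp add: p_def q_def)
  qed
  finally show "H1_norm \<Omega> ?w \<le> 2 * (\<bar>a\<bar> * H1_norm \<Omega> u + \<bar>b\<bar> * H1_norm \<Omega> v)"
    by (rule power2_le_imp_le) (simp add: H1_norm_nonneg)
qed

lemma H10_lincomb:
  assumes u: "u \<in> H10 \<Omega>" and v: "v \<in> H10 \<Omega>"
  shows "(\<lambda>x. a * u x + b * v x) \<in> H10 \<Omega>"
proof -
  have uH: "u \<in> H1 \<Omega>" and vH: "v \<in> H1 \<Omega>" using u v by (auto simp: H10_def)
  have "\<exists>\<phi>\<in>test_functions \<Omega>. H1_norm \<Omega> (\<lambda>x. (a * u x + b * v x) - \<phi> x) < \<epsilon>" if \<epsilon>: "\<epsilon> > 0" for \<epsilon>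
  proof -
    \<comment> \<open>The 2 in the denominator offsets the factor 2 in
      \<open>H1_lincomb\<close>.\<close>
    define d where "d = \<epsilon> / (2 * (\<bar>a\<bar> + \<bar>b\<bar> + 1))"
    have d: "d > 0" using \<epsilon> by (simp add: d_def add_nonneg_pos)
    obtain \<phi> where \<phi>: "\<phi> \<in> test_functions \<Omega>" "H1_norm \<Omega> (\<lambda>x. u x - \<phi> x) < d"
      using u d unfolding H10_def by blast
    obtain \<psi> where \<psi>: "\<psi> \<in> test_functions \<Omega>" "H1_norm \<Omega> (\<lambda>x. v x - \<psi> x) < d"
      using v d unfolding H10_def by blast
    have dH: "(\<lambda>x. u x - \<phi> x) \<in> H1 \<Omega>" "(\<lambda>x. v x - \<psi> x) \<in> H1 \<Omega>"
      using H1_lincomb(1)[OF uH test_function_H1[OF \<phi>(1)], of 1 "-1"]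
        H1_lincomb(1)[OF vH test_function_H1[OF \<psi>(1)], of 1 "-1"] by simp_all
    have "H1_norm \<Omega> (\<lambda>x. (a * u x + b * v x) - (a * \<phi> x + b * \<psi> x)) =
        H1_norm \<Omega> (\<lambda>x. a * (u x - \<phi> x) + b * (v x - \<psi> x))" by (simp add: algebra_simps)
    also have "\<dots> \<le> 2 * (\<bar>a\<bar> * H1_norm \<Omega> (\<lambda>x. u x - \<phi> x) + \<bar>b\<bar> * H1_norm \<Omega> (\<lambda>x. v x - \<psi> x))"
      by (rule H1_lincomb(2)[OF dH])
    also have "\<dots> \<le> 2 * (\<bar>a\<bar> * d + \<bar>b\<bar> * d)"
      using \<phi>(2) \<psi>(2) by (intro mult_left_mono add_mono) auto
    also have "\<dots> < \<epsilon>"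
    proof -
      have "2 * (\<bar>a\<bar> + \<bar>b\<bar> + 1) * d = \<epsilon>"
        by (simp add: d_def add_nonneg_pos order.strict_implies_not_eq[symmetric])
      then have "2 * (\<bar>a\<bar> * d + \<bar>b\<bar> * d) + 2 * d = \<epsilon>" by (simp add: algebra_simps)
      then show ?thesis using d by linarith
    qed
    finally show ?thesis by (rule bexI[OF _ test_functions_lincomb[OF \<phi>(1) \<psi>(1)]])
  qed
  then show ?thesis using H1_lincomb(1)[OF uH vH] by (simp add: H10_def)
qed

lemma test_function_H10: "\<phi> \<in> test_functions \<Omega> \<Longrightarrow> \<phi> \<in> H10 \<Omega>"
proof -
  assume \<phi>: "\<phi> \<in> test_functions \<Omega>"
  \<comment> \<open>Zero coefficients in \<open>H1_lincomb\<close> show that the weak gradient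
    chosen for the zero function contributes nothing to the norm.\<close>
  have "H1_norm \<Omega> (\<lambda>x. \<phi> x - \<phi> x) = 0"
    using H1_lincomb(2)[OF test_function_H1[OF \<phi>] test_function_H1[OF \<phi>], of 0 0] H1_norm_nonneg[of "\<lambda>x. 0"]
    by simp
  then show ?thesis using \<phi> test_function_H1[OF \<phi>] by (simp add: H10_def) (use \<phi> in \<open>intro allI impI bexI[of _ \<phi>], simp_all\<close>)
qed

end

section \<open>Assembly of the representation and the restriction result\<close>

theorem theorem4p2:
  fixes f :: "real^2 \<Rightarrow> real \<Rightarrow> real" and \<Omega> :: "(real^2) set" and t0 \<alpha>0 c1 c2 :: real
  assumes f_measurable: "\<And>t. (\<lambda>x. f x t) \<in> borel_measurable lebesgue"
    and F_defined: "\<And>x t. interval_lebesgue_integrable lebesgue 0 (ereal t) (f x)"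
    and F_lipschitz: "\<And>x t. \<exists>r>0. \<exists>L. L-lipschitz_on (ball t r) (primitive f x)"
    and t0: "t0 \<ge> 0" "\<And>x t. t < t0 \<Longrightarrow> f x t = 0" "\<And>x t. t > t0 \<Longrightarrow> f x t > 0"
    and pos: "\<alpha>0 > 0" "c1 > 0" "c2 > 0"
    and growth: "\<And>x t \<xi>. \<xi> \<in> clarke_gradient_real (primitive f x) t \<Longrightarrow>
                   \<bar>\<xi>\<bar> \<le> c1 * \<bar>t\<bar> + c2 * exp (\<alpha>0 * \<bar>t\<bar>\<^sup>2)"
    and N_meas: "N_measurable (f_lower f)" "N_measurable (f_upper f)"
    and domain: "smooth_bounded_domain \<Omega> \<or> \<Omega> = UNIV"
    and F_measurable: "\<And>t. (\<lambda>x. primitive f x t) \<in> borel_measurable (lebesgue_on \<Omega>)"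
    and Psi_defined: "\<Omega> = UNIV \<Longrightarrow> t0 = 0 \<Longrightarrow>
          (\<forall>u\<in>E_space Phi \<Omega>. integrable (lebesgue_on \<Omega>) (\<lambda>x. primitive f x (u x))) \<and>
          locally_lipschitz_functional (E_space Phi \<Omega>) (luxemburg_norm Phi \<Omega>) (Psi f \<Omega>)"
  shows "(\<forall>u \<in> E_space Phi \<Omega>.
            \<forall>\<xi> \<in> clarke_gradient (E_space Phi \<Omega>) (luxemburg_norm Phi \<Omega>) (Psi f \<Omega>) u.
              \<exists>\<xi>' \<in> orlicz_space (conjugate_N Phi) \<Omega>.
                (\<forall>v \<in> E_space Phi \<Omega>.
                   has_bochner_integral (lebesgue_on \<Omega>) (\<lambda>x. \<xi>' x * v x) (\<xi> v)) \<and>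
                (AE x in lebesgue_on \<Omega>.
                   \<xi>' x \<in> clarke_gradient_real (primitive f x) (u x) \<and>
                   clarke_gradient_real (primitive f x) (u x) = {f_lower f x (u x) .. f_upper f x (u x)})) \<and>
         (\<forall>X. X = H10 \<Omega> \<or> X = H1 \<Omega> \<longrightarrow>
            continuously_embedded X (H1_norm \<Omega>) (E_space Phi \<Omega>) (luxemburg_norm Phi \<Omega>) \<longrightarrow>
            (\<forall>u \<in> X. \<forall>\<xi> \<in> clarke_gradient X (H1_norm \<Omega>) (Psi f \<Omega>) u.
               \<exists>\<eta> \<in> clarke_gradient (E_space Phi \<Omega>) (luxemburg_norm Phi \<Omega>) (Psi f \<Omega>) u.
                 \<forall>v \<in> X. \<xi> v = \<eta> v))"
proof -
  have \<Omega>: "open \<Omega>" "bounded \<Omega> \<or> \<Omega> = UNIV"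
    using domain by (auto simp: smooth_bounded_domain_def)
  interpret problem f t0 \<alpha>0 c1 c2 \<Omega>
  proof
    show "\<Omega> \<in> sets lebesgue" using \<Omega>(1) by auto
  qed (use F_defined F_lipschitz t0 pos growth N_meas \<Omega> F_measurable in auto)
  have E: "E_space Phi \<Omega> = support_closure" by (rule E_space_eq_support_closure[OF \<Omega>(2)])
  \<comment> \<open>The cases are split by whether superlevel sets have controlled measure; what
    remains is the plane with \<open>t0 = 0\<close>, where \<open>Psi_defined\<close>
    applies.\<close>
  have reg: "(\<forall>u\<in>support_closure. integrable (lebesgue_on \<Omega>) (\<lambda>x. F x (u x))) \<and>
      locally_lipschitz_functional support_closure N (Psi f \<Omega>)"
  proof (cases "bounded \<Omega> \<or> t0 > 0")
    case True
    then show ?thesis using Psi_integrable_lipschitz by blast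
  next
    case False
    then have "\<Omega> = UNIV" "t0 = 0" using \<Omega>(2) t0(1) by auto
    from Psi_defined[OF this] show ?thesis unfolding E .
  qed
  interpret lipschitz_problem f t0 \<alpha>0 c1 c2 \<Omega>
    by unfold_locales (use reg in blast)+
  show ?thesis
    unfolding E
  proof (intro conjI ballI allI impI)
    fix u \<xi>
    assume "u \<in> support_closure" "\<xi> \<in> clarke_gradient support_closure N (Psi f \<Omega>) u"
    then show "\<exists>\<xi>' \<in> orlicz_space (conjugate_N Phi) \<Omega>.
        (\<forall>v \<in> support_closure. has_bochner_integral (lebesgue_on \<Omega>) (\<lambda>x. \<xi>' x * v x) (\<xi> v)) \<and>
        (AE x in lebesgue_on \<Omega>. \<xi>' x \<in> clarke_gradient_real (F x) (u x) \<and>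
           clarke_gradient_real (F x) (u x) = {f_lower f x (u x) .. f_upper f x (u x)})"
      by (rule clarke_gradient_Psi_representation)
  next
    fix X u \<xi>
    assume X: "X = H10 \<Omega> \<or> X = H1 \<Omega>" and emb: "continuously_embedded X (H1_norm \<Omega>) support_closure N"
      and u: "u \<in> X" and \<xi>: "\<xi> \<in> clarke_gradient X (H1_norm \<Omega>) (Psi f \<Omega>) u"
    obtain C where XE: "X \<subseteq> support_closure" and C: "\<And>v. v \<in> X \<Longrightarrow> N v \<le> C * H1_norm \<Omega> v"
      using emb unfolding continuously_embedded_def by blast
    have lin: "(\<lambda>x. a * v x + b * w x) \<in> X" if "v \<in> X" "w \<in> X" for v w a b
      using X that H10_lincomb H1_lincomb(1) by blast
    have test: "test_functions \<Omega> \<subseteq> X"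
      using X test_function_H10 test_function_H1 by blast
    have dense: "\<exists>w\<in>X. N (\<lambda>x. v x - w x) < \<epsilon>" if "v \<in> support_closure" "\<epsilon> > 0" for v \<epsilon>
      using test_functions_dense[OF that] test by blast
    obtain \<eta> where "\<eta> \<in> clarke_gradient support_closure N (Psi f \<Omega>) u" "\<And>v. v \<in> X \<Longrightarrow> \<xi> v = \<eta> v"
      using clarke_gradient_extension[OF XE lin dense C H1_norm_nonneg u \<xi>] by blast
    then show "\<exists>\<eta> \<in> clarke_gradient support_closure N (Psi f \<Omega>) u. \<forall>v \<in> X. \<xi> v = \<eta> v"
      by blast
  qed
qed

end
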